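(* Let $\lambda,\mu,k,r,m,n$ be positive integers with $m\ge n$, $2(r-1)\ge\mu>\lambda$, $m=2n-2$ and $r\ge2$. Let $\mathcal{G}$ be a decomposition of $\lambda K_n$ into $k$ colors. Then $\mathcal{G}$ can be enclosed in some $2$-edge-connected $r$-factorization of $\mu K_m$ (into $k$ colors) if and only if all of the following hold: (C1) $rk=\mu(m-1)$ and $rm$ is even; (C2) $\mathcal{G}$ is $r$-admissible; (C3) $\displaystyle\sum_{i=0}^{r}(r-i)\,|\mathcal{S}_i(\mathcal{G})|\le(\mu-\lambda)\frac{n(n-1)}{2}$; (C4) for each $u,v\in V(K_n)$, $\displaystyle|\mathcal{S}_0(\mathcal{G})|+\sum_{i=1}^{r-1}|\mathcal{S}_i(u,v;\mathcal{G})|\le(\mu-\lambda)\left(\frac{n(n-1)}{2}-1\right)$.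
   Context: Graphs are undirected and may have multiple edges but no loops. $\lambda K_n$ is the complete graph on $n$ vertices in which every pair of distinct vertices is joined by exactly $\lambda$ parallel edges; for $\lambda\le\mu$ and $n\le m$, $\lambda K_n$ is regarded as a subgraph of $\mu K_m$. A decomposition of a graph $G$ into $k$ colors is a collection $\mathcal{G}=\{\mathcal{G}(1),\dots,\mathcal{G}(k)\}$ of spanning subgraphs of $G$ (color classes), indexed by $1,\dots,k$, whose edge sets partition $E(G)$; color classes may have isolated vertices and may have no edges. A decomposition $\mathcal{G}$ of $\lambda K_n$ into $k$ colors is enclosed in a decomposition $\mathcal{H}$ of $\mu K_m$ into $k$ colors if $\mathcal{G}(i)$ is a subgraph of $\mathcal{H}(i)$ for every $1\le i\le k$. A $2$-edge-connected $r$-factorization of a graph is a decomposition of it in which every color class is an $r$-regular, $2$-edge-connected spanning subgraph. A decomposition $\mathcal{G}$ into $k$ colors (with vertex set $V(K_n)$) is $r$-admissible if: (1) $d_{\mathcal{G}(i)}(v)\le r$ for every vertex $v$ and every $1\le i\le k$, where $d_{\mathcal{G}(i)}(v)$ is the degree of $v$ in $\mathcal{G}(i)$; (2) every connected component of every $\mathcal{G}(i)$ contains a vertex of degree at most $r-2$ in $\mathcal{G}(i)$ or at least two vertices of degree at most $r-1$ in $\mathcal{G}(i)$; (3) if $C$ is a connected component of some $\mathcal{G}(i)$ and $e$ is a cutedge of $C$, then each of the two components of $C-e$ contains a vertex of degree at most $r-1$ in $\mathcal{G}(i)$. $\mathcal{S}_i(\mathcal{G})$ denotes the set of color classes of $\mathcal{G}$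 that contain exactly $i$ edges, and $\mathcal{S}_i(u,v;\mathcal{G})$ denotes the set of color classes of $\mathcal{G}$ that consist of exactly $i$ edges, all of them between $u$ and $v$.
   Formalization: The case n = 2 (so m = n = 2) is excluded: there the claim is false, e.g. for r = μ = 2, λ = k = 1, where K_2 is enclosed in the 2-edge-connected 2-regular graph 2K_2 but (C4) reads 1 ≤ 0. *)

theory Defs
  imports Complex_Main "HOL-Library.Disjoint_Sets"
begin

text \<open>
  An edge is its set of two ends together with a label distinguishing parallel edges.
  With edges as such pairs, a subgraph relation between multigraphs is plain inclusion.
\<close>

type_synonym 'a edge = "'a set \<times> nat"

record 'a mgraph =
  verts :: "'a set"
  edges :: "'a edge set"

definition subgraph :: "'a mgraph \<Rightarrow> 'a mgraph \<Rightarrow> bool" where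
  "subgraph H G \<longleftrightarrow> verts H \<subseteq> verts G \<and> edges H \<subseteq> edges G"

definition spanning_subgraph :: "'a mgraph \<Rightarrow> 'a mgraph \<Rightarrow> bool" where
  "spanning_subgraph H G \<longleftrightarrow> subgraph H G \<and> verts H = verts G"

text \<open>
  The vertices are \<open>0, \<dots>, n - 1\<close> and the labels \<open>0, \<dots>, l - 1\<close>, so for \<open>l \<le> l'\<close> and
  \<open>n \<le> n'\<close> the graph \<open>complete_mgraph l n\<close> literally is a subgraph of
  \<open>complete_mgraph l' n'\<close>.
\<close>

definition complete_mgraph :: "nat \<Rightarrow> nat \<Rightarrow> nat mgraph" where
  "complete_mgraph l n =
     \<lparr>verts = {..<n}, edges = {e. e \<subseteq> {..<n} \<and> card e = 2} \<times> {..<l}\<rparr>"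

definition degree :: "'a mgraph \<Rightarrow> 'a \<Rightarrow> nat" where
  "degree G v = card {e \<in> edges G. v \<in> fst e}"

definition regular :: "nat \<Rightarrow> 'a mgraph \<Rightarrow> bool" where
  "regular r G \<longleftrightarrow> (\<forall>v \<in> verts G. degree G v = r)"

definition adjacent :: "'a mgraph \<Rightarrow> 'a \<Rightarrow> 'a \<Rightarrow> bool" where
  "adjacent G u v \<longleftrightarrow> (\<exists>e \<in> edges G. fst e = {u, v})"

definition connected_graph :: "'a mgraph \<Rightarrow> bool" where
  "connected_graph G \<longleftrightarrow>
     verts G \<noteq> {} \<and> (\<forall>u \<in> verts G. \<forall>v \<in> verts G. (adjacent G)\<^sup>*\<^sup>* u v)"

definition induced_subgraph :: "'a mgraph \<Rightarrow> 'a set \<Rightarrow> 'a mgraph" where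
  "induced_subgraph G W = \<lparr>verts = W, edges = {e \<in> edges G. fst e \<subseteq> W}\<rparr>"

definition components :: "'a mgraph \<Rightarrow> 'a mgraph set" where
  "components G =
     (\<lambda>v. induced_subgraph G {u \<in> verts G. (adjacent G)\<^sup>*\<^sup>* v u}) ` verts G"

definition delete_edge :: "'a mgraph \<Rightarrow> 'a edge \<Rightarrow> 'a mgraph" where
  "delete_edge G e = \<lparr>verts = verts G, edges = edges G - {e}\<rparr>"

definition cutedge :: "'a mgraph \<Rightarrow> 'a edge \<Rightarrow> bool" where
  "cutedge G e \<longleftrightarrow>
     e \<in> edges G \<and> card (components G) < card (components (delete_edge G e))"

definition two_edge_connected :: "'a mgraph \<Rightarrow> bool" where
  "two_edge_connected G \<longleftrightarrow> connected_graph G \<and> (\<forall>e. \<not> cutedge G e)"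

definition decomposition :: "nat \<Rightarrow> 'a mgraph \<Rightarrow> (nat \<Rightarrow> 'a mgraph) \<Rightarrow> bool" where
  "decomposition k G D \<longleftrightarrow>
     (\<forall>i \<in> {1..k}. spanning_subgraph (D i) G) \<and>
     (\<Union>i \<in> {1..k}. edges (D i)) = edges G \<and>
     disjoint_family_on (\<lambda>i. edges (D i)) {1..k}"

definition enclosed :: "nat \<Rightarrow> (nat \<Rightarrow> 'a mgraph) \<Rightarrow> (nat \<Rightarrow> 'a mgraph) \<Rightarrow> bool" where
  "enclosed k D D' \<longleftrightarrow> (\<forall>i \<in> {1..k}. subgraph (D i) (D' i))"

definition two_edge_connected_factorization ::
  "nat \<Rightarrow> nat \<Rightarrow> 'a mgraph \<Rightarrow> (nat \<Rightarrow> 'a mgraph) \<Rightarrow> bool" where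
  "two_edge_connected_factorization r k G D \<longleftrightarrow>
     decomposition k G D \<and>
     (\<forall>i \<in> {1..k}. regular r (D i) \<and> two_edge_connected (D i))"

text \<open>
  Upper bounds \<open>d \<le> r - c\<close> on degrees are written \<open>d + c \<le> r\<close> to avoid truncated
  subtraction. All degrees below are degrees in the color class \<open>D i\<close>.
\<close>

definition admissible :: "nat \<Rightarrow> nat \<Rightarrow> (nat \<Rightarrow> 'a mgraph) \<Rightarrow> bool" where
  "admissible r k D \<longleftrightarrow>
     (\<forall>i \<in> {1..k}.
        (\<forall>v \<in> verts (D i). degree (D i) v \<le> r) \<and>
        (\<forall>C \<in> components (D i).
           (\<exists>v \<in> verts C. degree (D i) v + 2 \<le> r) \<or>
           (\<exists>u \<in> verts C. \<exists>v \<in> verts C.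
              u \<noteq> v \<and> degree (D i) u + 1 \<le> r \<and> degree (D i) v + 1 \<le> r)) \<and>
        (\<forall>C \<in> components (D i). \<forall>e. cutedge C e \<longrightarrow>
           (\<forall>B \<in> components (delete_edge C e). \<exists>v \<in> verts B. degree (D i) v + 1 \<le> r)))"

text \<open>
  Sets of color classes are represented by sets of colors, since distinct colors may have
  equal (edgeless) color classes, which have to be counted separately.
\<close>

definition classes_of_size :: "nat \<Rightarrow> (nat \<Rightarrow> 'a mgraph) \<Rightarrow> nat \<Rightarrow> nat set" where
  "classes_of_size k D i = {c \<in> {1..k}. card (edges (D c)) = i}"

definition classes_between ::
  "nat \<Rightarrow> (nat \<Rightarrow> 'a mgraph) \<Rightarrow> nat \<Rightarrow> 'a \<Rightarrow> 'a \<Rightarrow> nat set" where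
  "classes_between k D i u v =
     {c \<in> {1..k}. card (edges (D c)) = i \<and> (\<forall>e \<in> edges (D c). fst e = {u, v})}"

text \<open>
  The enclosing theorem for \<open>m = 2 * n - 2\<close> must exclude \<open>n = 2\<close>: there \<open>m = n\<close>, so the bound
  \<open>(mu - lam) * (n * (n - 1) / 2 - 1)\<close> on the number of edgeless color classes and classes
  between two fixed vertices is 0. For \<open>r = mu = 2\<close> and \<open>lam = k = 1\<close> it is violated, although
  the decomposition can be enclosed.
\<close>

lemma edges_complete_two:
  "edges (complete_mgraph l 2) = {{0, 1}} \<times> {..<l}"
proof -
  have "{e. e \<subseteq> {..<2::nat} \<and> card e = 2} = {{0, 1}}"
  proof (intro equalityI subsetI)
    fix e :: "nat set"
    assume "e \<in> {e. e \<subseteq> {..<2} \<and> card e = 2}"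
    then have "e = {..<2}" by (intro card_subset_eq) auto
    then show "e \<in> {{0, 1}}" by (auto simp: lessThan_nat_numeral lessThan_Suc)
  qed auto
  then show ?thesis by (simp add: complete_mgraph_def)
qed

lemma two_vertices_counterexample:
  fixes D H :: "nat \<Rightarrow> nat mgraph"
  defines "D \<equiv> \<lambda>_. complete_mgraph 1 2" and "H \<equiv> \<lambda>_. complete_mgraph 2 2"
  shows "decomposition 1 (complete_mgraph 1 2) D"
    and "two_edge_connected_factorization 2 1 (complete_mgraph 2 2) H \<and> enclosed 1 D H"
    and "\<not> (\<forall>u \<in> {..<2}. \<forall>v \<in> {..<2}.
           real (card (classes_of_size 1 D 0))
             + (\<Sum>i=1..2-1. real (card (classes_between 1 D i u v)))
           \<le> (real 2 - real 1) * (real 2 * (real 2 - 1) / 2 - 1))"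
proof -
  let ?K = "complete_mgraph 2 2"
  have V: "verts (complete_mgraph l 2) = {0, 1}" for l
    by (auto simp: complete_mgraph_def)
  have e0: "({0, 1}, 0) \<in> edges ?K"
    by (simp add: edges_complete_two)
  have dec: "decomposition 1 G (\<lambda>_. G)" for G :: "nat mgraph"
    by (auto simp: decomposition_def spanning_subgraph_def subgraph_def
        disjoint_family_on_def)
  show "decomposition 1 (complete_mgraph 1 2) D"
    unfolding D_def by (rule dec)
  have one: "card (components G) = 1"
    if "verts G = {0, 1}" "\<exists>e \<in> edges G. fst e = {0, 1}" for G :: "nat mgraph"
  proof -
    have "adjacent G 0 1" "adjacent G 1 0"
      using that(2) by (auto simp: adjacent_def insert_commute)
    then have "{u \<in> {0, 1}. (adjacent G)\<^sup>*\<^sup>* v u} = {0, 1}" if "v \<in> {0, 1}" for v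
      using that by (blast intro: r_into_rtranclp)
    then show ?thesis
      by (simp add: components_def that(1))
  qed
  have del: "card (components (delete_edge ?K e)) = 1" for e
  proof (rule one)
    have "({0, 1}, 0) \<noteq> e \<or> ({0, 1}, 1) \<noteq> e" by auto
    then have "({0, 1}, 0) \<in> edges (delete_edge ?K e) \<or> ({0, 1}, 1) \<in> edges (delete_edge ?K e)"
      by (auto simp: delete_edge_def edges_complete_two)
    then show "\<exists>e' \<in> edges (delete_edge ?K e). fst e' = {0, 1}"
      by (metis fst_conv)
  qed (simp add: delete_edge_def V)
  have "card (components ?K) = 1"
  proof (rule one)
    show "\<exists>e \<in> edges ?K. fst e = {0, 1}"
      by (rule bexI[OF _ e0]) simp
  qed (rule V)
  then have cut: "\<not> cutedge ?K e" for e
    by (simp add: cutedge_def del)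
  have "adjacent ?K 0 1" "adjacent ?K 1 0"
    unfolding adjacent_def by (rule bexI[OF _ e0], simp add: insert_commute)+
  then have con: "connected_graph ?K"
    unfolding connected_graph_def V by (blast intro: r_into_rtranclp)
  have "{e \<in> edges ?K. v \<in> fst e} = {{0, 1}} \<times> {..<2}" if "v \<in> {0, 1}" for v
    using that by (auto simp: edges_complete_two)
  then have reg: "regular 2 ?K"
    by (simp add: regular_def degree_def V)
  show "two_edge_connected_factorization 2 1 ?K H \<and> enclosed 1 D H"
    using dec cut con reg
    by (auto simp: two_edge_connected_factorization_def two_edge_connected_def enclosed_def
        subgraph_def D_def H_def V edges_complete_two)
  have "classes_between 1 D 1 0 1 = {1}"
    by (auto simp: classes_between_def D_def edges_complete_two)
  then have "\<not> real (card (classes_of_size 1 D 0))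
             + (\<Sum>i=1..2-1. real (card (classes_between 1 D i 0 1)))
           \<le> (real 2 - real 1) * (real 2 * (real 2 - 1) / 2 - 1)"
    by simp
  moreover have "(0::nat) \<in> {..<2}" "(1::nat) \<in> {..<2}" by simp_all
  ultimately show "\<not> (\<forall>u \<in> {..<2}. \<forall>v \<in> {..<2}.
           real (card (classes_of_size 1 D 0))
             + (\<Sum>i=1..2-1. real (card (classes_between 1 D i u v)))
           \<le> (real 2 - real 1) * (real 2 * (real 2 - 1) / 2 - 1))"
    by blast
qed

end

theory Submission
  imports Defs
begin

text \<open>
  Amalgamate the \<open>m - n = n - 2\<close> missing vertices to a single vertex \<open>x\<close>. A color class with edge set
  \<open>F\<close> on \<open>V = V(K_n)\<close>, in which every vertex \<open>v\<close> is joined to \<open>x\<close> by \<open>r - deg F v\<close> edges, is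
  2-edge-connected iff \<open>r |S| - 2 inner F S \<ge> 2\<close> for all nonempty \<open>S \<subseteq> V\<close>; this is what
  \<open>r\<close>-admissibility means. For \<open>m = 2 n - 2\<close> the number of loops at \<open>x\<close> in a color is the number of its
  edges inside \<open>V\<close> minus \<open>r\<close>, so every color needs at least \<open>r\<close> edges inside \<open>V\<close>, not all of them
  parallel if there are exactly \<open>r\<close>; this explains the two counting conditions. Conversely, (C3) and
  (C4) allow filling every color up to \<open>r\<close> edges; the other extra edges are then colored one by one,
  where by counting the edges that touch \<open>{u, v}\<close> some color accepts an edge \<open>uv\<close>, possibly after
  one recoloring. Finally the vertices are split off from \<open>x\<close> one at a time: a matching in a regular
  bipartite graph selects the edges that move to the new vertex, and it never selects both edges of
  certain disjoint pairs, which are chosen such that 2-edge-connectivity is preserved.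
\<close>

section \<open>Matchings\<close>

text \<open>The number of loops comes from counting edge ends: with \<open>e\<close> edges inside
  \<open>V\<close>, a color sends \<open>r n - 2 e\<close> edges to \<open>x\<close>, while the
  \<open>n - 2\<close> merged vertices need \<open>r (n - 2)\<close> edge ends; half of the
  difference is \<open>e - r\<close>. If a color has only \<open>r\<close> edges inside
  \<open>V\<close> and all of them join \<open>u\<close> and \<open>v\<close>, these two vertices
  are saturated and separated from the rest; this is the obstruction behind (C4). The vertex
  \<open>x\<close> is never built, as degrees and \<open>inner\<close> determine its edges. While it
  stands for \<open>s\<close> vertices, every color has \<open>s r\<close> half-edges at
  \<open>x\<close> and every old vertex sends \<open>s mu\<close> edges to it; the next vertex must
  receive the fraction \<open>1/s\<close> of each count. The obstacle is that such a fair share can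
  take too many of the edges that leave a set \<open>S\<close>, so that too few edges leave
  \<open>S\<close> together with the new vertex. The matching can forbid selecting two elements of a
  block of at most \<open>s\<close> half-edges. Since \<open>s\<close> drops to \<open>2\<close>
  before the last vertex, the blocks have to be pairs; they must also be disjoint, so it matters how
  the critical sets overlap.\<close>

theorem hall:
  fixes N :: "'a \<Rightarrow> 'b set"
  assumes "finite A" and "\<And>a. a \<in> A \<Longrightarrow> finite (N a)"
    and "\<And>X. X \<subseteq> A \<Longrightarrow> card X \<le> card (\<Union>(N ` X))"
  shows "\<exists>f. inj_on f A \<and> (\<forall>a\<in>A. f a \<in> N a)"
  using assms
proof (induction "card A" arbitrary: A N rule: less_induct)
  case less
  note fin = less.prems(1) and finN = less.prems(2) and H = less.prems(3)
  have finU: "finite (\<Union>(N ` X))" if "X \<subseteq> A" for X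
    using that fin finN by (meson finite_UN_I finite_subset subsetD)
  \<comment> \<open>Induction of Halmos and Vaughan: a tight nonempty proper subset splits the
    problem into two smaller ones; if there is none, every such subset has a neighbor to spare and
    an arbitrary first choice is harmless.\<close>
  consider "A = {}"
    | X where "X \<subset> A" "X \<noteq> {}" "card X = card (\<Union>(N ` X))"
    | "A \<noteq> {}" "\<And>X. X \<subset> A \<Longrightarrow> X \<noteq> {} \<Longrightarrow> card X < card (\<Union>(N ` X))"
    by (metis H psubset_imp_subset le_neq_implies_less)
  then show ?case
  proof cases
    case 1 then show ?thesis by simp
  next
    case (2 X)
    have XA: "X \<subseteq> A" and finX: "finite X" using 2 fin finite_subset by auto
    have "\<exists>f. inj_on f X \<and> (\<forall>a\<in>X. f a \<in> N a)"
    proof (rule less.hyps)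
      show "card X < card A" using psubset_card_mono[OF fin] 2 by blast
    qed (use finX finN H XA in auto)
    then obtain f where f: "inj_on f X" "\<And>a. a \<in> X \<Longrightarrow> f a \<in> N a" by blast
    let ?U = "\<Union>(N ` X)"
    have "\<exists>g. inj_on g (A - X) \<and> (\<forall>a\<in>A - X. g a \<in> N a - ?U)"
    proof (rule less.hyps)
      show "card (A - X) < card A"
        using 2 fin finX XA by (metis Diff_subset Diff_Int2 Int_absorb2 Int_commute inf.absorb_iff2 card_mono
          card_Diff_subset card_gt_0_iff diff_less less_le_trans)
      fix Y assume Y: "Y \<subseteq> A - X"
      then have finY: "finite Y" using fin finite_subset by blast
      have "card X + card Y = card (X \<union> Y)"
        using Y finX finY by (subst card_Un_disjoint) auto
      also have "\<dots> \<le> card (\<Union>(N ` (X \<union> Y)))" using Y XA by (intro H) auto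
      also have "\<Union>(N ` (X \<union> Y)) = ?U \<union> (\<Union>a\<in>Y. N a - ?U)" by auto
      also have "card \<dots> \<le> card ?U + card (\<Union>a\<in>Y. N a - ?U)" by (rule card_Un_le)
      finally show "card Y \<le> card (\<Union>a\<in>Y. N a - ?U)" using 2 by simp
    qed (use fin finN in auto)
    then obtain g where g: "inj_on g (A - X)" "\<And>a. a \<in> A - X \<Longrightarrow> g a \<in> N a - ?U" by blast
    let ?h = "\<lambda>a. if a \<in> X then f a else g a"
    have "inj_on ?h A"
    proof (rule inj_onI)
      fix a b assume ab: "a \<in> A" "b \<in> A" "?h a = ?h b"
      have ne: False if "a \<in> X" "b \<in> A - X" "f a = g b" for a b
        using f(2)[OF that(1)] g(2)[OF that(2)] that by auto
      show "a = b"
        using ab f(1) g(1) ne[of a b] ne[of b a] by (auto simp: inj_on_def split: if_splits)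
    qed
    moreover have "\<forall>a\<in>A. ?h a \<in> N a" using f g by auto
    ultimately show ?thesis by blast
  next
    case 3
    then obtain a where a: "a \<in> A" by blast
    have "card {a} \<le> card (\<Union>(N ` {a}))" using a by (intro H) auto
    then have "N a \<noteq> {}" by auto
    then obtain b where b: "b \<in> N a" by blast
    have "\<exists>g. inj_on g (A - {a}) \<and> (\<forall>x\<in>A - {a}. g x \<in> N x - {b})"
    proof (rule less.hyps)
      show "card (A - {a}) < card A" using card_Diff1_less[OF fin a] .
      fix Y assume Y: "Y \<subseteq> A - {a}"
      have eq: "(\<Union>x\<in>Y. N x - {b}) = \<Union>(N ` Y) - {b}" by auto
      show "card Y \<le> card (\<Union>x\<in>Y. N x - {b})"
      proof (cases "Y = {}")
        case False
        then have "card Y < card (\<Union>(N ` Y))" using Y a by (intro 3) auto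
        then show ?thesis unfolding eq
          by (simp add: card_Diff_singleton_if) linarith
      qed simp
    qed (use fin finN in auto)
    then obtain g where g: "inj_on g (A - {a})" "\<And>x. x \<in> A - {a} \<Longrightarrow> g x \<in> N x - {b}" by blast
    have "inj_on (g(a := b)) A"
      using g by (auto simp: inj_on_def)
    moreover have "\<forall>x\<in>A. (g(a := b)) x \<in> N x" using g b by auto
    ultimately show ?thesis by blast
  qed
qed

lemma card_fibers:
  assumes "finite A" "f ` A \<subseteq> B" "finite B"
  shows "card A = (\<Sum>b\<in>B. card {a \<in> A. f a = b})"
  using sum.group[OF assms(1,3,2), of "\<lambda>_. 1::nat"] by (simp add: assms)

text \<open>
  The elements are the edges of a bipartite multigraph with sides \<open>A\<close> and \<open>B\<close>: on the side \<open>A\<close> it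
  is \<open>s\<close>-regular, on the side \<open>B\<close> the degrees are multiples of \<open>s\<close>.
\<close>

lemma regular_transversal:
  fixes f :: "'e \<Rightarrow> 'a" and g :: "'e \<Rightarrow> 'b" and c :: "'b \<Rightarrow> nat"
  assumes fin: "finite M" "finite A" "finite B" and "0 < s"
    and fA: "f ` M \<subseteq> A" and gB: "g ` M \<subseteq> B"
    and fibA: "\<And>a. a \<in> A \<Longrightarrow> card {x \<in> M. f x = a} = s"
    and fibB: "\<And>b. b \<in> B \<Longrightarrow> card {x \<in> M. g x = b} = s * c b"
  shows "\<exists>J\<subseteq>M. (\<forall>a\<in>A. card {x \<in> J. f x = a} = 1) \<and> (\<forall>b\<in>B. card {x \<in> J. g x = b} = c b)"
proof -
  \<comment> \<open>Every \<open>b\<close> is split into \<open>c b\<close> slots, so that a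
    matching of \<open>A\<close> onto all slots selects exactly \<open>c b\<close> elements at
    \<open>b\<close>.\<close>
  define N where "N a = (SIGMA b : {g x |x. x \<in> M \<and> f x = a}. {..<c b})" for a
  have finN: "finite (N a)" for a
    unfolding N_def using fin(1) by auto
  have count: "card {x \<in> M. f x \<in> X} = s * card X" if "X \<subseteq> A" for X
  proof -
    have "finite X" using that fin finite_subset by blast
    then have "card {x \<in> M. f x \<in> X} = (\<Sum>a\<in>X. card {x \<in> {x \<in> M. f x \<in> X}. f x = a})"
      using fin by (intro card_fibers) auto
    also have "\<dots> = (\<Sum>a\<in>X. s)"
    proof (rule sum.cong[OF refl])
      fix a assume "a \<in> X"
      then have "{x \<in> {x \<in> M. f x \<in> X}. f x = a} = {x \<in> M. f x = a}" by auto
      then show "card {x \<in> {x \<in> M. f x \<in> X}. f x = a} = s" using fibA \<open>a \<in> X\<close> that by auto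
    qed
    finally show ?thesis by simp
  qed
  have countB: "card {x \<in> M. g x \<in> Y} = s * card (SIGMA b : Y. {..<c b})" if "Y \<subseteq> B" for Y
  proof -
    have finY: "finite Y" using that fin finite_subset by blast
    then have "card {x \<in> M. g x \<in> Y} = (\<Sum>b\<in>Y. card {x \<in> {x \<in> M. g x \<in> Y}. g x = b})"
      using fin by (intro card_fibers) auto
    also have "\<dots> = (\<Sum>b\<in>Y. s * c b)"
    proof (rule sum.cong[OF refl])
      fix b assume "b \<in> Y"
      then have "{x \<in> {x \<in> M. g x \<in> Y}. g x = b} = {x \<in> M. g x = b}" by auto
      then show "card {x \<in> {x \<in> M. g x \<in> Y}. g x = b} = s * c b" using fibB \<open>b \<in> Y\<close> that by auto
    qed
    finally show ?thesis using finY by (simp add: sum_distrib_left)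
  qed
  have "\<exists>\<phi>. inj_on \<phi> A \<and> (\<forall>a\<in>A. \<phi> a \<in> N a)"
  proof (rule hall)
    fix X assume X: "X \<subseteq> A"
    let ?Y = "{g x |x. x \<in> M \<and> f x \<in> X}"
    have Y: "?Y \<subseteq> B" using gB by auto
    have "s * card X \<le> card {x \<in> M. g x \<in> ?Y}"
      unfolding count[OF X, symmetric] using fin by (intro card_mono) auto
    also have "\<dots> = s * card (SIGMA b : ?Y. {..<c b})" using countB[OF Y] .
    also have "(SIGMA b : ?Y. {..<c b}) = \<Union>(N ` X)" unfolding N_def by auto
    finally show "card X \<le> card (\<Union>(N ` X))" using \<open>0 < s\<close> by simp
  qed (use fin finN in auto)
  then obtain \<phi> where \<phi>: "inj_on \<phi> A" "\<And>a. a \<in> A \<Longrightarrow> \<phi> a \<in> N a" by blast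
  have "\<forall>a\<in>A. \<exists>x. x \<in> M \<and> f x = a \<and> g x = fst (\<phi> a)"
    using \<phi>(2) unfolding N_def by fastforce
  then obtain e where e: "\<And>a. a \<in> A \<Longrightarrow> e a \<in> M \<and> f (e a) = a \<and> g (e a) = fst (\<phi> a)" by metis
  let ?S = "SIGMA b : B. {..<c b}"
  have sub: "\<phi> ` A \<subseteq> ?S"
  proof
    fix y assume "y \<in> \<phi> ` A"
    then obtain a where "a \<in> A" "y \<in> N a" using \<phi> by auto
    then show "y \<in> ?S" unfolding N_def using gB by auto
  qed
  \<comment> \<open>Both sides count \<open>M\<close>. Hence there are as many slots as elements of
    \<open>A\<close>, and the injection uses every slot.\<close>
  have "s * card A = s * card ?S"
  proof -
    have "{x \<in> M. f x \<in> A} = M" "{x \<in> M. g x \<in> B} = M" using fA gB by auto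
    then show ?thesis using count[of A] countB[of B] by simp
  qed
  then have "card (\<phi> ` A) = card ?S" using \<open>0 < s\<close> \<phi>(1) by (simp add: card_image)
  then have im: "\<phi> ` A = ?S" using sub fin by (intro card_subset_eq) auto
  show ?thesis
  proof (intro exI[of _ "e ` A"] conjI ballI)
    show "e ` A \<subseteq> M" using e by auto
    fix a assume a: "a \<in> A"
    then have "{x \<in> e ` A. f x = a} = {e a}" using e by auto
    then show "card {x \<in> e ` A. f x = a} = 1" by simp
  next
    fix b assume b: "b \<in> B"
    have inje: "inj_on e A" using e by (metis inj_onI)
    have "{x \<in> e ` A. g x = b} = e ` {a \<in> A. fst (\<phi> a) = b}" using e by auto
    then have "card {x \<in> e ` A. g x = b} = card {a \<in> A. fst (\<phi> a) = b}"
      using inje by (metis (no_types, lifting) card_image inj_on_subset mem_Collect_eq subsetI)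
    also have "\<dots> = card (\<phi> ` {a \<in> A. fst (\<phi> a) = b})"
      using \<phi>(1) by (intro card_image[symmetric] inj_on_subset[OF \<phi>(1)]) auto
    also have "\<phi> ` {a \<in> A. fst (\<phi> a) = b} = {b} \<times> {..<c b}"
    proof -
      have "\<phi> ` {a \<in> A. fst (\<phi> a) = b} = {y \<in> \<phi> ` A. fst y = b}" by auto
      then show ?thesis unfolding im using b by auto
    qed
    finally show "card {x \<in> e ` A. g x = b} = c b" by simp
  qed
qed

text \<open>
  Padding every block with dummy elements to size \<open>s\<close> reduces this to the regular case; the dummies
  of color \<open>i\<close> are adjacent to a common extra vertex, which absorbs all blocks of color \<open>i\<close> but \<open>r\<close>.
\<close>

lemma balanced_selection:
  fixes \<kappa> :: "'e \<Rightarrow> 'i" and \<nu> :: "'e \<Rightarrow> 'v" and \<mu> :: "'v \<Rightarrow> nat"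
  assumes fin: "finite M" "finite I" "finite W" and s: "0 < s"
    and \<kappa>: "\<kappa> ` M \<subseteq> I" and \<nu>: "\<nu> ` M \<subseteq> W"
    and col: "\<And>i. i \<in> I \<Longrightarrow> card {x \<in> M. \<kappa> x = i} = s * r"
    and ver: "\<And>v. v \<in> W \<Longrightarrow> card {x \<in> M. \<nu> x = v} = s * \<mu> v"
    and PP: "disjoint PP" "\<And>P. P \<in> PP \<Longrightarrow> P \<subseteq> M \<and> card P \<le> s \<and> (\<exists>i. \<kappa> ` P \<subseteq> {i})"
  shows "\<exists>J\<subseteq>M. (\<forall>i\<in>I. card {x \<in> J. \<kappa> x = i} = r) \<and> (\<forall>v\<in>W. card {x \<in> J. \<nu> x = v} = \<mu> v) \<and>
    (\<forall>P\<in>PP. card (J \<inter> P) \<le> 1)"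
proof -
  \<comment> \<open>Elements outside all members of \<open>PP\<close> become singleton blocks, so
    that the blocks partition \<open>M\<close>.\<close>
  define blk where "blk x = (if \<exists>P\<in>PP. x \<in> P then THE P. P \<in> PP \<and> x \<in> P else {x})" for x
  have blk_PP: "blk x = P" if "P \<in> PP" "x \<in> P" for x P
  proof -
    have "(THE P. P \<in> PP \<and> x \<in> P) = P"
      using that PP(1) by (intro the_equality) (auto simp: disjoint_def)
    then show ?thesis using that by (auto simp: blk_def)
  qed
  have blk_single: "blk x = {x}" if "\<not> (\<exists>P\<in>PP. x \<in> P)" for x
    using that by (simp add: blk_def)
  have blk_self: "x \<in> blk x" for x
    by (cases "\<exists>P\<in>PP. x \<in> P") (use blk_PP blk_single in auto)
  have blk_eq: "blk y = blk x" if "y \<in> blk x" for x y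
    using that by (cases "\<exists>P\<in>PP. x \<in> P") (use blk_PP blk_single in force)+
  have blk_cases: "blk x = {x} \<or> blk x \<in> PP" if "x \<in> M" for x
    using blk_PP blk_single by metis
  have blk_sub: "blk x \<subseteq> M" "card (blk x) \<le> s" "\<kappa> ` blk x \<subseteq> {\<kappa> x}" if "x \<in> M" for x
  proof -
    have "blk x \<subseteq> M \<and> card (blk x) \<le> s \<and> (\<exists>i. \<kappa> ` blk x \<subseteq> {i})"
      using blk_cases[OF that]
    proof
      assume "blk x = {x}" then show ?thesis using that s by auto
    qed (rule PP(2))
    then show "blk x \<subseteq> M" "card (blk x) \<le> s" "\<kappa> ` blk x \<subseteq> {\<kappa> x}"
      using blk_self[of x] by auto
  qed
  define Q where "Q = blk ` M"
  define qc where "qc q = \<kappa> (SOME x. x \<in> q)" for q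
  have qc: "qc (blk x) = \<kappa> x" if "x \<in> M" for x
  proof -
    have "(SOME y. y \<in> blk x) \<in> blk x" using blk_self by (rule someI)
    then show ?thesis unfolding qc_def using blk_sub(3)[OF that] by auto
  qed
  have finQ: "finite Q" unfolding Q_def using fin by simp
  define n where "n i = card {q \<in> Q. qc q = i}" for i
  define D where "D = (SIGMA q : Q. {..<s - card q})"
  define M' :: "('e + 'e set \<times> nat) set" where "M' = Inl ` M \<union> Inr ` D"
  define f where "f = (case_sum blk fst :: 'e + 'e set \<times> nat \<Rightarrow> 'e set)"
  define g where "g = (case_sum (Inl \<circ> \<nu>) (Inr \<circ> qc \<circ> fst) :: 'e + 'e set \<times> nat \<Rightarrow> 'v + 'i)"
  define c where "c = (case_sum \<mu> (\<lambda>i. n i - r) :: 'v + 'i \<Rightarrow> nat)"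
  have fib_blk: "{x \<in> M. blk x = q} = q" if "q \<in> Q" for q
    using that blk_self blk_eq blk_sub(1) unfolding Q_def by blast
  have Q_card: "card q \<le> s" if "q \<in> Q" for q
    using that blk_sub unfolding Q_def by auto
  have finD: "finite D" unfolding D_def using finQ by auto
  have Mi: "s * r = (\<Sum>q\<in>{q \<in> Q. qc q = i}. card q)" if "i \<in> I" for i
  proof -
    have "s * r = card {x \<in> M. \<kappa> x = i}" using col that by simp
    also have "\<dots> = (\<Sum>q\<in>{q \<in> Q. qc q = i}. card {x \<in> {x \<in> M. \<kappa> x = i}. blk x = q})"
      using fin finQ qc by (intro card_fibers) (auto simp: Q_def)
    also have "\<dots> = (\<Sum>q\<in>{q \<in> Q. qc q = i}. card q)"
    proof (rule sum.cong[OF refl])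
      fix q assume q: "q \<in> {q \<in> Q. qc q = i}"
      have "{x \<in> {x \<in> M. \<kappa> x = i}. blk x = q} = {x \<in> M. blk x = q}" using q qc by auto
      then show "card {x \<in> {x \<in> M. \<kappa> x = i}. blk x = q} = card q" using fib_blk q by auto
    qed
    finally show ?thesis .
  qed
  \<comment> \<open>The \<open>n i\<close> blocks of color \<open>i\<close> have
    \<open>s * n i\<close> places, of which \<open>s * r\<close> are taken by real elements; so the
    number of dummies is again a multiple of \<open>s\<close>, as the degree condition on the extra
    vertex demands.\<close>
  have Di: "card {d \<in> D. qc (fst d) = i} = s * (n i - r)" if "i \<in> I" for i
  proof -
    have "{d \<in> D. qc (fst d) = i} = (SIGMA q : {q \<in> Q. qc q = i}. {..<s - card q})"
      unfolding D_def by auto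
    then have "card {d \<in> D. qc (fst d) = i} = (\<Sum>q\<in>{q \<in> Q. qc q = i}. s - card q)"
      using finQ by simp
    also have "\<dots> = (\<Sum>q\<in>{q \<in> Q. qc q = i}. s) - (\<Sum>q\<in>{q \<in> Q. qc q = i}. card q)"
      using Q_card by (intro sum_subtractf_nat) auto
    also have "\<dots> = s * (n i - r)"
      unfolding Mi[OF that, symmetric] by (simp add: n_def diff_mult_distrib2 mult.commute)
    finally show ?thesis .
  qed
  have nr: "r \<le> n i" if "i \<in> I" for i
  proof -
    have "s * r \<le> (\<Sum>q\<in>{q \<in> Q. qc q = i}. s)" unfolding Mi[OF that]
      using Q_card by (intro sum_mono) auto
    then show ?thesis using s by (simp add: n_def)
  qed
  have "\<exists>J\<subseteq>M'. (\<forall>q\<in>Q. card {x \<in> J. f x = q} = 1) \<and>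
      (\<forall>b\<in>Inl ` W \<union> Inr ` I. card {x \<in> J. g x = b} = c b)"
  proof (rule regular_transversal[where s = s])
    show "finite M'" "finite Q" "finite (Inl ` W \<union> Inr ` I)" "0 < s"
      using fin finQ finD s by (auto simp: M'_def)
    show "f ` M' \<subseteq> Q" by (auto simp: f_def M'_def D_def Q_def)
    show "g ` M' \<subseteq> Inl ` W \<union> Inr ` I"
      using \<kappa> \<nu> qc by (auto simp: g_def M'_def D_def Q_def)
  next
    fix q assume q: "q \<in> Q"
    have "{x \<in> M'. f x = q} = Inl ` {x \<in> M. blk x = q} \<union> Inr ` ({q} \<times> {..<s - card q})"
      using q by (auto simp: f_def M'_def D_def)
    also have "card \<dots> = card q + (s - card q)"
    proof -
      have "finite q" using fib_blk[OF q] fin(1) by (metis finite_Collect_conjI finite_subset mem_Collect_eq subsetI)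
      then show ?thesis unfolding fib_blk[OF q]
        by (subst card_Un_disjoint) (auto simp: card_image card_cartesian_product_singleton)
    qed
    finally show "card {x \<in> M'. f x = q} = s" using Q_card[OF q] by simp
  next
    fix b :: "'v + 'i" assume "b \<in> Inl ` W \<union> Inr ` I"
    then consider v where "v \<in> W" "b = Inl v" | i where "i \<in> I" "b = Inr i" by blast
    then show "card {x \<in> M'. g x = b} = s * c b"
    proof cases
      case (1 v)
      then have "{x \<in> M'. g x = b} = Inl ` {x \<in> M. \<nu> x = v}" by (auto simp: g_def M'_def)
      then show ?thesis using ver 1 by (simp add: card_image c_def)
    next
      case (2 i)
      then have "{x \<in> M'. g x = b} = Inr ` {d \<in> D. qc (fst d) = i}" by (auto simp: g_def M'_def)
      then show ?thesis using Di 2 by (simp add: card_image c_def)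
    qed
  qed
  then obtain J' where J'0: "J' \<subseteq> M'" "\<forall>q\<in>Q. card {x \<in> J'. f x = q} = 1"
    "\<forall>b\<in>Inl ` W \<union> Inr ` I. card {x \<in> J'. g x = b} = c b" by (elim exE conjE)
  note J' = J'0(1) J'0(2,3)[rule_format]
  define J where "J = {x. Inl x \<in> J'}"
  have JM: "J \<subseteq> M" using J'(1) by (auto simp: J_def M'_def)
  have finJ': "finite J'" using J'(1) fin finD by (auto simp: M'_def intro: finite_subset)
  show ?thesis
  proof (intro exI[of _ J] conjI ballI)
    show "J \<subseteq> M" by (rule JM)
  next
    fix i assume i: "i \<in> I"
    \<comment> \<open>One selected element, real or dummy, for each of the \<open>n i\<close> blocks
      of color \<open>i\<close>; exactly \<open>n i - r\<close> of them are dummies.\<close>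
    let ?T = "{x \<in> J'. qc (f x) = i}"
    have "card ?T = (\<Sum>q\<in>{q \<in> Q. qc q = i}. card {x \<in> ?T. f x = q})"
      using finJ' finQ J'(1) by (intro card_fibers) (auto simp: f_def M'_def D_def Q_def)
    also have "\<dots> = (\<Sum>q\<in>{q \<in> Q. qc q = i}. 1)"
    proof (rule sum.cong[OF refl])
      fix q assume q: "q \<in> {q \<in> Q. qc q = i}"
      have "{x \<in> ?T. f x = q} = {x \<in> J'. f x = q}" using q by auto
      then show "card {x \<in> ?T. f x = q} = 1" using J'(2) q by auto
    qed
    finally have "card ?T = n i" by (simp add: n_def)
    moreover have "?T = Inl ` {x \<in> J. \<kappa> x = i} \<union> {x \<in> J'. g x = Inr i}"
      using J'(1) JM qc by (auto simp: f_def g_def J_def M'_def D_def)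
    moreover have "card (Inl ` {x \<in> J. \<kappa> x = i} \<union> {x \<in> J'. g x = Inr i}) =
        card {x \<in> J. \<kappa> x = i} + (n i - r)"
      using finJ' JM fin J'(3)[of "Inr i"] i finite_subset[OF JM]
      by (subst card_Un_disjoint) (auto simp: card_image g_def c_def)
    ultimately show "card {x \<in> J. \<kappa> x = i} = r" using nr[OF i] by simp
  next
    fix v assume v: "v \<in> W"
    have "{x \<in> J'. g x = Inl v} = Inl ` {x \<in> J. \<nu> x = v}"
      using J'(1) by (auto simp: g_def J_def M'_def)
    then show "card {x \<in> J. \<nu> x = v} = \<mu> v"
      using J'(3)[of "Inl v"] v by (simp add: card_image c_def)
  next
    fix P assume P: "P \<in> PP"
    show "card (J \<inter> P) \<le> 1"
    proof (cases "P = {}")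
      case False
      then have "P \<in> Q" using P PP(2) blk_PP unfolding Q_def by blast
      have "card (J \<inter> P) = card (Inl ` (J \<inter> P) :: ('e + 'e set \<times> nat) set)"
        by (simp add: card_image)
      also have "\<dots> \<le> card {x \<in> J'. f x = P}"
        using P finJ' blk_PP by (intro card_mono) (auto simp: f_def J_def)
      finally show ?thesis using J'(2)[OF \<open>P \<in> Q\<close>] by simp
    qed simp
  qed
qed

section \<open>Cuts\<close>

definition deg :: "'a edge set \<Rightarrow> 'a \<Rightarrow> nat" where
  "deg F v = card {e \<in> F. v \<in> fst e}"

definition inner :: "'a edge set \<Rightarrow> 'a set \<Rightarrow> nat" where
  "inner F S = card {e \<in> F. fst e \<subseteq> S}"

definition cut :: "'a edge set \<Rightarrow> 'a set \<Rightarrow> nat" where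
  "cut F S = card {e \<in> F. fst e \<inter> S \<noteq> {} \<and> \<not> fst e \<subseteq> S}"

definition edges_on :: "'a edge set \<Rightarrow> 'a set \<Rightarrow> bool" where
  "edges_on F V \<longleftrightarrow> finite F \<and> (\<forall>e\<in>F. fst e \<subseteq> V \<and> card (fst e) = 2)"

lemma edges_onD:
  assumes "edges_on F V"
  shows "finite F" "\<And>e. e \<in> F \<Longrightarrow> fst e \<subseteq> V" "\<And>e. e \<in> F \<Longrightarrow> card (fst e) = 2"
  using assms by (auto simp: edges_on_def)

lemma edges_on_subset: "edges_on F V \<Longrightarrow> F' \<subseteq> F \<Longrightarrow> edges_on F' V"
  by (auto simp: edges_on_def intro: finite_subset)

lemma deg_mono: "finite F \<Longrightarrow> F' \<subseteq> F \<Longrightarrow> deg F' v \<le> deg F v"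
  unfolding deg_def by (rule card_mono) auto

lemma inner_mono: "finite F \<Longrightarrow> F' \<subseteq> F \<Longrightarrow> S' \<subseteq> S \<Longrightarrow> inner F' S' \<le> inner F S"
  unfolding inner_def by (rule card_mono) auto

lemma inner_le_card: "finite F \<Longrightarrow> inner F S \<le> card F"
  unfolding inner_def by (rule card_mono) auto

lemma inner_insert:
  "finite F \<Longrightarrow> e \<notin> F \<Longrightarrow> inner (insert e F) S = (if fst e \<subseteq> S then 1 else 0) + inner F S"
proof -
  assume "finite F" "e \<notin> F"
  moreover have "{x \<in> insert e F. fst x \<subseteq> S} =
      (if fst e \<subseteq> S then insert e {x \<in> F. fst x \<subseteq> S} else {x \<in> F. fst x \<subseteq> S})" by auto
  ultimately show ?thesis by (simp add: inner_def)
qed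

lemma deg_insert:
  "finite F \<Longrightarrow> e \<notin> F \<Longrightarrow> deg (insert e F) v = (if v \<in> fst e then 1 else 0) + deg F v"
proof -
  assume "finite F" "e \<notin> F"
  moreover have "{x \<in> insert e F. v \<in> fst x} =
      (if v \<in> fst e then insert e {x \<in> F. v \<in> fst x} else {x \<in> F. v \<in> fst x})" by auto
  ultimately show ?thesis by (simp add: deg_def)
qed

lemma handshake:
  assumes "finite F" "\<And>e. e \<in> F \<Longrightarrow> card (fst e) = 2" "finite S"
  shows "(\<Sum>v\<in>S. deg F v) = 2 * inner F S + cut F S"
proof -
  have "(\<Sum>v\<in>S. deg F v) = (\<Sum>v\<in>S. \<Sum>e\<in>F. if v \<in> fst e then 1 else 0)"
    unfolding deg_def using assms(1) by (simp add: sum.If_cases Int_def)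
  also have "\<dots> = (\<Sum>e\<in>F. \<Sum>v\<in>S. if v \<in> fst e then 1 else 0)" by (rule sum.swap)
  also have "\<dots> = (\<Sum>e\<in>F. (if fst e \<subseteq> S then 2 else 0) +
      (if fst e \<inter> S \<noteq> {} \<and> \<not> fst e \<subseteq> S then 1 else 0))"
  proof (rule sum.cong[OF refl])
    fix e assume "e \<in> F"
    then obtain a b where ab: "fst e = {a, b}" "a \<noteq> b" using assms(2) by (meson card_2_iff)
    have "(\<Sum>v\<in>S. if v \<in> fst e then 1 else 0) = card (S \<inter> {a, b})"
      using assms(3) ab by (simp add: sum.If_cases Int_def)
    also have "\<dots> = (if fst e \<subseteq> S then 2 else 0) +
      (if fst e \<inter> S \<noteq> {} \<and> \<not> fst e \<subseteq> S then 1 else 0)"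
      using ab by (cases "a \<in> S"; cases "b \<in> S") (auto simp: Int_insert_right)
    finally show "(\<Sum>v\<in>S. if v \<in> fst e then 1 else 0) = (if fst e \<subseteq> S then 2 else 0) +
      (if fst e \<inter> S \<noteq> {} \<and> \<not> fst e \<subseteq> S then 1 else 0 :: nat)" .
  qed
  also have "\<dots> = 2 * inner F S + cut F S"
    unfolding inner_def cut_def using assms(1)
    by (simp add: sum.distrib sum.If_cases Int_def)
  finally show ?thesis .
qed

text \<open>An edge inside \<open>A\<close> or inside \<open>B\<close> is inside the union, an edge
  inside both is inside the intersection. Edges between \<open>A - B\<close> and
  \<open>B - A\<close> are the slack.\<close>

lemma inner_supermodular:
  assumes "finite F"
  shows "inner F A + inner F B \<le> inner F (A \<union> B) + inner F (A \<inter> B)"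
proof -
  have "inner F A + inner F B =
      card ({e \<in> F. fst e \<subseteq> A} \<union> {e \<in> F. fst e \<subseteq> B}) + card ({e \<in> F. fst e \<subseteq> A} \<inter> {e \<in> F. fst e \<subseteq> B})"
    unfolding inner_def using assms by (intro card_Un_Int) auto
  also have "\<dots> \<le> inner F (A \<union> B) + inner F (A \<inter> B)"
    unfolding inner_def using assms by (intro add_mono card_mono) auto
  finally show ?thesis .
qed

lemma cut_submodular:
  assumes F: "finite F" "\<And>e. e \<in> F \<Longrightarrow> card (fst e) = 2" and fin: "finite A" "finite B"
  shows "cut F (A \<inter> B) + cut F (A \<union> B) \<le> cut F A + cut F B"
proof -
  have "(\<Sum>v\<in>A. deg F v) + (\<Sum>v\<in>B. deg F v) =
      (\<Sum>v\<in>A \<union> B. deg F v) + (\<Sum>v\<in>A \<inter> B. deg F v)"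
    using fin by (rule sum.union_inter[symmetric])
  then show ?thesis
    using handshake[OF F, of A] handshake[OF F, of B] handshake[OF F, of "A \<union> B"]
      handshake[OF F, of "A \<inter> B"] inner_supermodular[OF F(1), of A B] fin by simp
qed

text \<open>By \<open>handshake\<close>, a cut is congruent modulo 2 to the degree sum over the set,
  which is additive over disjoint sets.\<close>

lemma cut_parity:
  assumes F: "finite F" "\<And>e. e \<in> F \<Longrightarrow> card (fst e) = 2" and fin: "finite A" "finite B" "A \<inter> B = {}"
  shows "even (cut F A + cut F B + cut F (A \<union> B))"
proof -
  have "2 * inner F (A \<union> B) + cut F (A \<union> B) = 2 * inner F A + cut F A + (2 * inner F B + cut F B)"
    using fin by (simp add: handshake[OF F, symmetric] sum.union_disjoint)
  then have "even (2 * inner F (A \<union> B) + cut F (A \<union> B)) \<longleftrightarrow>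
      even (2 * inner F A + cut F A + (2 * inner F B + cut F B))" by (rule arg_cong)
  then show ?thesis by simp
qed

lemma cut_complement:
  assumes "finite F" "cut F C = 0" "S \<subseteq> C"
  shows "cut F (C - S) = cut F S"
proof -
  have C: "fst e \<inter> C = {} \<or> fst e \<subseteq> C" if "e \<in> F" for e
  proof -
    have "{e \<in> F. fst e \<inter> C \<noteq> {} \<and> \<not> fst e \<subseteq> C} = {}" using assms(1,2) by (simp add: cut_def)
    then show ?thesis using that by blast
  qed
  have "{e \<in> F. fst e \<inter> (C - S) \<noteq> {} \<and> \<not> fst e \<subseteq> C - S} = {e \<in> F. fst e \<inter> S \<noteq> {} \<and> \<not> fst e \<subseteq> S}"
    using C assms(3) by blast
  then show ?thesis by (simp add: cut_def)
qed

lemma uncross: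
  assumes F: "finite F" "\<And>e. e \<in> F \<Longrightarrow> card (fst e) = 2" and "finite C"
    and C: "cut F C = 0" "\<And>S. S \<subseteq> C \<Longrightarrow> S \<noteq> {} \<Longrightarrow> S \<noteq> C \<Longrightarrow> 1 \<le> cut F S"
    and S: "S \<subseteq> C" "cut F S = 1" and T: "T \<subseteq> C" "cut F T = 1"
  shows "S \<inter> T = {} \<or> S \<subseteq> T \<or> T \<subseteq> S \<or> S \<union> T = C"
proof (rule ccontr)
  assume "\<not> ?thesis"
  then have ne: "S \<inter> T \<noteq> {}" "S - T \<noteq> {}" "S \<union> T \<noteq> C" "T - S \<noteq> {}" by auto
  have fin: "finite S" "finite T" using assms finite_subset by auto
  have ST: "S - T = S \<inter> (C - T)" using S T by auto
  have "1 \<le> cut F (S \<inter> T)" "1 \<le> cut F (S \<union> T)" "1 \<le> cut F (S - T)" "1 \<le> cut F (S \<union> (C - T))"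
    by (rule C(2); use ne S T in blast)+
  then have "cut F (S \<inter> T) = 1" "cut F (S - T) = 1"
    using cut_submodular[OF F, of S T] cut_submodular[OF F, of S "C - T"] fin \<open>finite C\<close>
      cut_complement[OF F(1) C(1) T(1)] S(2) T(2) unfolding ST by auto
  moreover have "S \<inter> T \<union> (S - T) = S" by auto
  moreover have "S \<inter> T \<inter> (S - T) = {}" by auto
  ultimately have "even (1 + 1 + 1 :: nat)"
    using cut_parity[OF F, of "S \<inter> T" "S - T"] fin S(2) by simp
  then show False by simp
qed

text \<open>
  Joining every vertex \<open>v\<close> by \<open>r - deg F v\<close> edges to a new vertex leaves \<open>r |S| - 2 inner F S\<close>
  edges between \<open>S\<close> and its complement.
\<close>

definition extendable :: "nat \<Rightarrow> 'a set \<Rightarrow> 'a edge set \<Rightarrow> bool" where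
  "extendable r V F \<longleftrightarrow> (\<forall>v\<in>V. deg F v \<le> r) \<and>
     (\<forall>S. S \<subseteq> V \<and> S \<noteq> {} \<longrightarrow> 2 * inner F S + 2 \<le> r * card S)"

lemma extendableD:
  assumes "extendable r V F"
  shows "\<And>v. v \<in> V \<Longrightarrow> deg F v \<le> r"
    "\<And>S. S \<subseteq> V \<Longrightarrow> S \<noteq> {} \<Longrightarrow> 2 * inner F S + 2 \<le> r * card S"
  using assms by (auto simp: extendable_def)

lemma extendable_mono:
  assumes "extendable r V F" "finite F" "F' \<subseteq> F"
  shows "extendable r V F'"
proof -
  have "deg F' v \<le> deg F v" "inner F' S \<le> inner F S" for v S
    by (rule deg_mono[OF assms(2,3)], rule inner_mono[OF assms(2,3) subset_refl])
  then show ?thesis using assms(1) unfolding extendable_def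
    by (meson add_le_mono le_refl le_trans mult_le_mono)
qed

text \<open>The edges from \<open>S\<close> to the amalgamated vertex, given as an explicit set
  because single edges have to be selected and paired.\<close>

definition stubs :: "nat \<Rightarrow> 'a edge set \<Rightarrow> 'a set \<Rightarrow> ('a \<times> nat) set" where
  "stubs r F S = (SIGMA v : S. {..<r - deg F v})"

lemma finite_stubs: "finite S \<Longrightarrow> finite (stubs r F S)"
  by (simp add: stubs_def)

lemma stubs_mono: "S \<subseteq> T \<Longrightarrow> stubs r F S \<subseteq> stubs r F T"
  by (auto simp: stubs_def)

lemma card_stubs:
  assumes "finite F" "\<And>e. e \<in> F \<Longrightarrow> card (fst e) = 2" "finite S" "\<And>v. v \<in> S \<Longrightarrow> deg F v \<le> r"
  shows "card (stubs r F S) + cut F S + 2 * inner F S = r * card S"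
proof -
  have "card (stubs r F S) + (\<Sum>v\<in>S. deg F v) = (\<Sum>v\<in>S. r - deg F v) + (\<Sum>v\<in>S. deg F v)"
    using assms by (simp add: stubs_def)
  also have "\<dots> = (\<Sum>v\<in>S. r)" unfolding sum.distrib[symmetric]
    using assms(4) by (intro sum.cong) auto
  finally show ?thesis using handshake[OF assms(1,2,3)] by (simp add: mult.commute)
qed

section \<open>Pairs of stubs\<close>

text \<open>Distinct members that overlap cover \<open>M\<close>, so each contains the complement of
  the other. Unless \<open>card M = r + 1\<close>, these complements have at least two elements, and
  a pair in each of two of them serves the whole family. Without overlaps every member gets a pair
  of its own. If \<open>card M = r + 1\<close>, complements are singletons, but then a member misses
  only one element and contains one of any two disjoint pairs; two such pairs exist because
  \<open>r + 1 \<ge> 4\<close>.\<close>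

lemma pairing_family:
  assumes M: "finite M" "2 \<le> card M" and r: "3 \<le> r"
    and sub: "\<And>A. A \<in> \<A> \<Longrightarrow> A \<subseteq> M" and card_r: "\<And>A. A \<in> \<A> \<Longrightarrow> card A = r"
    and cross: "\<And>A B. A \<in> \<A> \<Longrightarrow> B \<in> \<A> \<Longrightarrow> A = B \<or> A \<inter> B = {} \<or> A \<union> B = M"
  shows "\<exists>PP. disjoint PP \<and> PP \<noteq> {} \<and> (\<forall>P\<in>PP. P \<subseteq> M \<and> card P = 2) \<and>
    (\<forall>A\<in>\<A>. \<exists>P\<in>PP. P \<subseteq> A) \<and> (card M = r + 1 \<longrightarrow> (\<exists>P\<in>PP. \<exists>Q\<in>PP. P \<noteq> Q))"
proof -
  have pair: "\<exists>P. P \<subseteq> X \<and> card P = 2" if "2 \<le> card X" for X :: "'a set"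
    using obtain_subset_with_card_n[OF that] by metis
  have two: ?thesis
    if P: "P \<subseteq> M" "card P = 2" and Q: "Q \<subseteq> M" "card Q = 2" and "P \<inter> Q = {}"
      and A: "\<And>A. A \<in> \<A> \<Longrightarrow> P \<subseteq> A \<or> Q \<subseteq> A" for P Q
  proof (intro exI[of _ "{P, Q}"] conjI)
    have "P \<noteq> Q" using that by auto
    then show "card M = r + 1 \<longrightarrow> (\<exists>P'\<in>{P, Q}. \<exists>Q'\<in>{P, Q}. P' \<noteq> Q')" by blast
    show "disjoint {P, Q}" using \<open>P \<inter> Q = {}\<close> by (auto simp: disjoint_def)
  qed (use that in auto)
  show ?thesis
  proof (cases "card M = r + 1")
    case True
    obtain P where P: "P \<subseteq> M" "card P = 2" using pair M by blast
    then have "card (M - P) = r + 1 - 2" using True M by (simp add: card_Diff_subset finite_subset)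
    then obtain Q where Q: "Q \<subseteq> M - P" "card Q = 2" using pair[of "M - P"] r by force
    show ?thesis
    proof (rule two[of P Q])
      fix A assume A: "A \<in> \<A>"
      have "card (M - A) = 1"
        using True A sub[OF A] card_r[OF A] M by (simp add: card_Diff_subset finite_subset)
      then obtain z where "M - A = {z}" using card_1_singletonE by blast
      then have "X \<subseteq> A" if "X \<subseteq> M" "z \<notin> X" for X using that by auto
      then show "P \<subseteq> A \<or> Q \<subseteq> A" using P(1) Q(1) by blast
    qed (use P Q in auto)
  next
    case False
    show ?thesis
    proof (cases "\<exists>A\<in>\<A>. \<exists>B\<in>\<A>. A \<noteq> B \<and> A \<inter> B \<noteq> {}")
      case True
      then obtain A B where AB: "A \<in> \<A>" "B \<in> \<A>" "A \<noteq> B" "A \<inter> B \<noteq> {}" by blast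
      have un: "A \<union> B = M" using cross AB by blast
      have cM: "card (M - X) = card M - r" "finite X" if "X \<in> \<A>" for X
        using sub[OF that] card_r[OF that] M by (simp_all add: card_Diff_subset finite_subset)
      have "A \<noteq> M" 
      proof
        assume "A = M"
        then have "card B = card M" "B \<subseteq> M" using AB card_r sub by auto
        then have "B = M" using M by (simp add: card_subset_eq)
        then show False using AB \<open>A = M\<close> by simp
      qed
      then have "r < card M" using AB sub card_r M by (metis psubset_card_mono psubsetI)
      then have "2 \<le> card M - r" using False by simp
      then obtain P Q where P: "P \<subseteq> M - A" "card P = 2" and Q: "Q \<subseteq> M - B" "card Q = 2"
        using pair cM(1) AB by metis
      show ?thesis
      proof (rule two[of P Q])
        show "P \<inter> Q = {}" using P Q un by blast
        fix X assume X: "X \<in> \<A>"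
        show "P \<subseteq> X \<or> Q \<subseteq> X"
        proof (cases "X = A \<or> X = B")
          case True then show ?thesis using P Q un by blast
        next
          case ne: False
          show ?thesis
          \<comment> \<open>If \<open>X\<close> avoided \<open>A\<close>, it would lie inside
            \<open>B\<close> and meet it, which forces \<open>B = M\<close>; so \<open>X\<close> and
            \<open>A\<close> cover \<open>M\<close>, and \<open>X\<close> contains
            \<open>P\<close>.\<close>
          proof (cases "X \<inter> A = {}")
            case True
            have "X \<noteq> {}" using card_r[OF X] r by auto
            moreover have "X \<subseteq> B" using True un sub[OF X] by blast
            ultimately have "X \<union> B = M" using cross[OF X AB(2)] ne by blast
            then have "M - B = {}" using \<open>X \<subseteq> B\<close> by blast
            then have "card (M - B) = 0" by (simp only: card.empty)
            then show ?thesis using cM(1)[OF AB(2)] \<open>2 \<le> card M - r\<close> by linarith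
          next
            case False
            then have "X \<union> A = M" using cross[OF X AB(1)] ne by blast
            then show ?thesis using P by blast
          qed
        qed
      qed (use P Q in auto)
    next
      case disj: False
      show ?thesis
      proof (cases "\<A> = {}")
        case True
        obtain P where "P \<subseteq> M" "card P = 2" using pair M by blast
        then show ?thesis using False True by (intro exI[of _ "{P}"]) (auto simp: disjoint_def)
      next
        case nonempty: False
        have "\<forall>A\<in>\<A>. \<exists>P. P \<subseteq> A \<and> card P = 2" using pair card_r r by simp
        then obtain p where p: "\<And>A. A \<in> \<A> \<Longrightarrow> p A \<subseteq> A \<and> card (p A) = 2" by metis
        show ?thesis
        proof (intro exI[of _ "p ` \<A>"] conjI ballI impI)
          show "disjoint (p ` \<A>)"
          proof (rule disjointI)
            fix P Q assume "P \<in> p ` \<A>" "Q \<in> p ` \<A>" "P \<noteq> Q"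
            then obtain A B where AB: "A \<in> \<A>" "B \<in> \<A>" "A \<noteq> B" "P = p A" "Q = p B" by blast
            then have "A \<inter> B = {}" using disj by blast
            then show "P \<inter> Q = {}" using AB p[of A] p[of B] by blast
          qed
          show "P \<subseteq> M" if "P \<in> p ` \<A>" for P using that p sub by fastforce
          show "card P = 2" if "P \<in> p ` \<A>" for P using that p by blast
          show "\<exists>P\<in>p ` \<A>. P \<subseteq> A" if "A \<in> \<A>" for A using that p by blast
        qed (use False nonempty in auto)
      qed
    qed
  qed
qed

lemma cut_eq_0_iff:
  "finite F \<Longrightarrow> cut F S = 0 \<longleftrightarrow> (\<forall>e\<in>F. fst e \<inter> S = {} \<or> fst e \<subseteq> S)"
proof -
  assume "finite F"
  then have "cut F S = 0 \<longleftrightarrow> {e \<in> F. fst e \<inter> S \<noteq> {} \<and> \<not> fst e \<subseteq> S} = {}"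
    unfolding cut_def by (intro card_0_eq) simp
  then show ?thesis by blast
qed

text \<open>
  The stubs in \<open>J\<close> are those that move to a new vertex \<open>w\<close>, and the conclusion bounds the cut of
  \<open>S \<union> {w}\<close> from below. It can only fail if almost all stubs of \<open>S\<close> and almost all of the \<open>r\<close>
  edges at \<open>w\<close> are in \<open>J\<close> at \<open>S\<close>. A pair in every component excludes this unless \<open>r\<close> is odd and
  either \<open>S\<close> is a component with \<open>r + 1\<close> stubs, which then gets two pairs, or \<open>S\<close> is the side of a
  cutedge and has exactly \<open>r\<close> stubs. Such sides pairwise do not cross, hence
  \<open>pairing_family\<close> supplies a pair in each of them.
\<close>

lemma stub_pairs:
  assumes V: "finite V" and F: "edges_on F V" and ext: "extendable r V F" and r: "2 \<le> r"
  shows "\<exists>PP. disjoint PP \<and> (\<forall>P\<in>PP. P \<subseteq> stubs r F V \<and> card P = 2) \<and>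
    (\<forall>J. J \<subseteq> stubs r F V \<and> card J \<le> r \<and> (\<forall>P\<in>PP. card (J \<inter> P) \<le> 1) \<longrightarrow>
      (\<forall>S. S \<subseteq> V \<and> S \<noteq> {} \<longrightarrow>
        2 * card (J \<inter> stubs r F S) + 2 * inner F S + 2 \<le> r * card S + r))"
proof -
  note finF = edges_onD(1)[OF F] and F2 = edges_onD(3)[OF F]
  note zero = cut_eq_0_iff[OF finF]
  have finV: "finite S" if "S \<subseteq> V" for S using that V finite_subset by blast
  have b: "card (stubs r F S) + cut F S + 2 * inner F S = r * card S" if "S \<subseteq> V" for S
    using that finV[OF that] finF F2 extendableD(1)[OF ext] by (intro card_stubs) auto
  have b2: "2 \<le> card (stubs r F S) + cut F S" if "S \<subseteq> V" "S \<noteq> {}" for S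
    using b[OF that(1)] extendableD(2)[OF ext that] by simp
  \<comment> \<open>The vertex sets of the connected components, described as minimal nonempty sets
    without leaving edges, so that no paths are needed.\<close>
  define \<C> where "\<C> = {C. C \<subseteq> V \<and> C \<noteq> {} \<and> cut F C = 0 \<and>
    (\<forall>T. T \<subseteq> C \<and> T \<noteq> {} \<and> cut F T = 0 \<longrightarrow> T = C)}"
  have C_D: "C \<subseteq> V" "C \<noteq> {}" "cut F C = 0" "\<And>T. T \<subseteq> C \<Longrightarrow> T \<noteq> {} \<Longrightarrow> T \<noteq> C \<Longrightarrow> 1 \<le> cut F T"
    if "C \<in> \<C>" for C
    using that unfolding \<C>_def by (auto simp: Suc_le_eq)
  have C_sub: "C \<subseteq> T" if "C \<in> \<C>" "C \<inter> T \<noteq> {}" "cut F T = 0" for C T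
  proof -
    have "cut F (C \<inter> T) = 0" using C_D(3)[OF that(1)] that(3) unfolding zero by blast
    then have "C \<inter> T = C" using that(1,2) unfolding \<C>_def by blast
    then show ?thesis by blast
  qed
  have C_disj: "C \<inter> C' = {}" if "C \<in> \<C>" "C' \<in> \<C>" "C \<noteq> C'" for C C'
    using that C_sub[of C C'] C_sub[of C' C] C_D(3) by (metis Int_commute subset_antisym)
  have C_ex: "\<exists>C\<in>\<C>. C \<subseteq> T" if "T \<subseteq> V" "T \<noteq> {}" "cut F T = 0" for T
    using that
  proof (induction "card T" arbitrary: T rule: less_induct)
    case less
    show ?case
    proof (cases "T \<in> \<C>")
      case False
      then obtain T' where T': "T' \<subset> T" "T' \<noteq> {}" "cut F T' = 0"
        using less.prems unfolding \<C>_def by blast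
      then have "\<exists>C\<in>\<C>. C \<subseteq> T'"
        using less.prems finV by (intro less.hyps psubset_card_mono) auto
      then show ?thesis using T' by blast
    qed blast
  qed
  have C_cover: "\<exists>C\<in>\<C>. v \<in> C" if "v \<in> V" for v
  proof (rule ccontr)
    assume v: "\<not> ?thesis"
    have "cut F (\<Union>\<C>) = 0" unfolding zero
    proof
      fix e assume "e \<in> F"
      then have "fst e \<inter> C = {} \<or> fst e \<subseteq> C" if "C \<in> \<C>" for C
        using C_D(3)[OF that] unfolding zero by blast
      then show "fst e \<inter> \<Union>\<C> = {} \<or> fst e \<subseteq> \<Union>\<C>" by blast
    qed
    then have "cut F (V - \<Union>\<C>) = 0"
      using edges_onD(2)[OF F] unfolding zero by blast
    moreover have "V - \<Union>\<C> \<noteq> {}" using v that by blast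
    ultimately obtain C where C: "C \<in> \<C>" "C \<subseteq> V - \<Union>\<C>"
      using C_ex[of "V - \<Union>\<C>"] by (meson Diff_subset)
    then have "C \<subseteq> C - C" by blast
    then show False using C_D(2)[OF C(1)] by blast
  qed
  \<comment> \<open>The last two conditions concern odd \<open>r\<close> only: the number of stubs
    of \<open>S\<close> plus its cut is congruent to \<open>r * card S\<close> modulo 2, and in both
    critical cases it equals \<open>r + 1\<close>.\<close>
  define good_pairs where "good_pairs C PP \<longleftrightarrow> disjoint (PP) \<and> PP \<noteq> {} \<and> (\<forall>P\<in>PP. P \<subseteq> stubs r F C \<and> card P = 2) \<and>
      (odd r \<longrightarrow> (\<forall>S. S \<subseteq> C \<and> cut F S = 1 \<and> card (stubs r F S) = r \<longrightarrow> (\<exists>P\<in>PP. P \<subseteq> stubs r F S)) \<and>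
        (card (stubs r F C) = r + 1 \<longrightarrow> (\<exists>P\<in>PP. \<exists>Q\<in>PP. P \<noteq> Q)))" for C PP
  have "\<exists>PP. good_pairs C PP" if C: "C \<in> \<C>" for C
  proof -
    have fin: "finite (stubs r F S)" if "S \<subseteq> C" for S
      using that C_D(1)[OF C] finV by (intro finite_stubs) auto
    have card2: "2 \<le> card (stubs r F C)" using b2[of C] C_D[OF C] by simp
    show ?thesis
    proof (cases "odd r")
      case False
      obtain P where "P \<subseteq> stubs r F C" "card P = 2"
        using obtain_subset_with_card_n[OF card2] by metis
      then show ?thesis
        using False by (intro exI[of _ "{P}"]) (auto simp: disjoint_def good_pairs_def)
    next
      case True
      then have r3: "3 \<le> r" using r by (cases "r = 2") auto
      let ?A = "{stubs r F S |S. S \<subseteq> C \<and> cut F S = 1 \<and> card (stubs r F S) = r}"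
      have "\<exists>PP. disjoint PP \<and> PP \<noteq> {} \<and> (\<forall>P\<in>PP. P \<subseteq> stubs r F C \<and> card P = 2) \<and>
        (\<forall>A\<in>?A. \<exists>P\<in>PP. P \<subseteq> A) \<and>
        (card (stubs r F C) = r + 1 \<longrightarrow> (\<exists>P\<in>PP. \<exists>Q\<in>PP. P \<noteq> Q))"
      proof (rule pairing_family)
        show "finite (stubs r F C)" by (rule fin) simp
        show "2 \<le> card (stubs r F C)" "3 \<le> r" by fact+
        fix A assume "A \<in> ?A"
        then obtain S where S: "A = stubs r F S" "S \<subseteq> C" "cut F S = 1" "card (stubs r F S) = r"
          by blast
        then show "A \<subseteq> stubs r F C" "card A = r" using stubs_mono[OF S(2)] by simp_all
        fix B assume "B \<in> ?A"
        then obtain T where T: "B = stubs r F T" "T \<subseteq> C" "cut F T = 1" "card (stubs r F T) = r"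
          by blast
        \<comment> \<open>Nested sides with \<open>r\<close> stubs each have the same stubs. This
          turns the alternatives of \<open>uncross\<close> into those required by
          \<open>pairing_family\<close>.\<close>
        have eq: "stubs r F X = stubs r F Y"
          if "X \<subseteq> Y" "Y \<subseteq> C" "card (stubs r F X) = r" "card (stubs r F Y) = r" for X Y
          using that fin stubs_mono[OF that(1)] by (intro card_subset_eq) simp_all
        have "finite C" using C_D(1)[OF C] finV by blast
        then have "S \<inter> T = {} \<or> S \<subseteq> T \<or> T \<subseteq> S \<or> S \<union> T = C"
          using S T C_D[OF C] finF F2 by (intro uncross[of F]) auto
        moreover have "stubs r F S \<inter> stubs r F T = {}" if "S \<inter> T = {}"
          using that by (auto simp: stubs_def)
        moreover have "stubs r F S \<union> stubs r F T = stubs r F C" if "S \<union> T = C"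
          using that by (auto simp: stubs_def)
        ultimately show "A = B \<or> A \<inter> B = {} \<or> A \<union> B = stubs r F C"
          using S T eq[of S T] eq[of T S] by auto
      qed
      then obtain PP where PP: "disjoint PP" "PP \<noteq> {}" "\<forall>P\<in>PP. P \<subseteq> stubs r F C \<and> card P = 2"
        "\<forall>A\<in>?A. \<exists>P\<in>PP. P \<subseteq> A" "card (stubs r F C) = r + 1 \<longrightarrow> (\<exists>P\<in>PP. \<exists>Q\<in>PP. P \<noteq> Q)"
        by (elim exE conjE)
      have "\<exists>P\<in>PP. P \<subseteq> stubs r F S"
        if "S \<subseteq> C \<and> cut F S = 1 \<and> card (stubs r F S) = r" for S
        using that by (intro bspec[OF PP(4)]) blast
      then have "good_pairs C PP" unfolding good_pairs_def using PP(1,2,3,5) by blast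
      then show ?thesis ..
    qed
  qed
  then obtain pp where pp0: "\<And>C. C \<in> \<C> \<Longrightarrow> good_pairs C (pp C)" by metis
  have pp: "\<And>C. C \<in> \<C> \<Longrightarrow> disjoint (pp C)" "\<And>C. C \<in> \<C> \<Longrightarrow> pp C \<noteq> {}"
    "\<And>C P. C \<in> \<C> \<Longrightarrow> P \<in> pp C \<Longrightarrow> P \<subseteq> stubs r F C \<and> card P = 2"
    "\<And>C S. C \<in> \<C> \<Longrightarrow> odd r \<Longrightarrow> S \<subseteq> C \<Longrightarrow> cut F S = 1 \<Longrightarrow> card (stubs r F S) = r \<Longrightarrow>
      \<exists>P\<in>pp C. P \<subseteq> stubs r F S"
    "\<And>C. C \<in> \<C> \<Longrightarrow> odd r \<Longrightarrow> card (stubs r F C) = r + 1 \<Longrightarrow> \<exists>P\<in>pp C. \<exists>Q\<in>pp C. P \<noteq> Q"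
    using pp0 unfolding good_pairs_def by simp_all
  let ?PP = "\<Union>(pp ` \<C>)"
  have stubs_disj: "stubs r F S \<inter> stubs r F T = {}" if "S \<inter> T = {}" for S T
    using that by (auto simp: stubs_def)
  have disj: "disjoint ?PP"
  proof (rule disjointI)
    fix P Q assume "P \<in> ?PP" "Q \<in> ?PP" "P \<noteq> Q"
    then obtain C C' where *: "C \<in> \<C>" "P \<in> pp C" "C' \<in> \<C>" "Q \<in> pp C'" by blast
    show "P \<inter> Q = {}"
    proof (cases "C = C'")
      case True
      then show ?thesis using * pp(1)[of C] \<open>P \<noteq> Q\<close> by (auto simp: disjoint_def)
    next
      case False
      then show ?thesis using pp(3)[OF *(1,2)] pp(3)[OF *(3,4)] stubs_disj[OF C_disj[OF *(1,3)]] by blast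
    qed
  qed
  show ?thesis
  proof (intro exI[of _ ?PP] conjI allI impI)
    show "disjoint ?PP" by (rule disj)
    show "\<forall>P\<in>?PP. P \<subseteq> stubs r F V \<and> card P = 2"
      using pp(3) C_D(1) stubs_mono by (metis UN_E subset_trans)
  next
    fix J S
    assume "J \<subseteq> stubs r F V \<and> card J \<le> r \<and> (\<forall>P\<in>?PP. card (J \<inter> P) \<le> 1)" and "S \<subseteq> V \<and> S \<noteq> {}"
    then have J: "J \<subseteq> stubs r F V" "card J \<le> r" "\<And>P. P \<in> ?PP \<Longrightarrow> card (J \<inter> P) \<le> 1"
      and S: "S \<subseteq> V" "S \<noteq> {}" by blast+
    let ?b = "card (stubs r F S)" and ?y = "card (J \<inter> stubs r F S)"
    have finS: "finite (stubs r F S)" and finJ: "finite J"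
      using finV[OF S(1)] J(1) finite_stubs[OF V] finite_stubs finite_subset by blast+
    have yr: "?y \<le> r" using J(2) card_mono[of J "J \<inter> stubs r F S"] finJ by simp
    have yb: "?y \<le> ?b" using finS by (intro card_mono) auto
    have miss: "\<exists>z\<in>P. z \<notin> J" if "P \<in> ?PP" for P
    proof (rule ccontr)
      assume "\<not> ?thesis"
      then have "J \<inter> P = P" by blast
      moreover have "card P = 2" using that pp(3) by blast
      ultimately show False using J(3)[OF that] by simp
    qed
    have one: "?y + 1 \<le> ?b" if P: "P \<in> ?PP" "P \<subseteq> stubs r F S" for P
    proof -
      obtain z where "z \<in> P" "z \<notin> J" using miss[OF P(1)] by blast
      then have "J \<inter> stubs r F S \<subset> stubs r F S" using P by blast
      from psubset_card_mono[OF finS this] show ?thesis by simp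
    qed
    have two: "?y + 2 \<le> ?b"
      if PQ: "P \<in> ?PP" "P \<subseteq> stubs r F S" "Q \<in> ?PP" "Q \<subseteq> stubs r F S" "P \<noteq> Q" for P Q
    proof -
      obtain z w where zw: "z \<in> P" "z \<notin> J" "w \<in> Q" "w \<notin> J"
        using miss[OF PQ(1)] miss[OF PQ(3)] by blast
      have "P \<inter> Q = {}" using disjointD[OF disj PQ(1,3,5)] .
      then have "z \<noteq> w" using zw by blast
      have "J \<inter> stubs r F S \<subseteq> stubs r F S - {z, w}" using zw by blast
      then have "?y \<le> card (stubs r F S - {z, w})" using finS by (intro card_mono) auto
      moreover have "card (stubs r F S - {z, w}) = ?b - card {z, w}"
        using zw that by (intro card_Diff_subset) auto
      moreover have "card {z, w} \<le> ?b" using zw that finS by (intro card_mono) auto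
      ultimately show ?thesis using \<open>z \<noteq> w\<close> by simp
    qed
    have par: "odd r" if "?b + cut F S = r + 1"
    proof
      assume "even r"
      then have "even (?b + cut F S + 2 * inner F S)" unfolding b[OF S(1)] by simp
      then show False using that \<open>even r\<close> by simp
    qed
    have "2 * ?y + 2 \<le> ?b + cut F S + r"
    proof (rule ccontr)
      assume neg: "\<not> ?thesis"
      \<comment> \<open>Since \<open>?y\<close> is at most \<open>?b\<close> and at most
        \<open>r\<close>, a cut of 2 or more would give the bound at once.\<close>
      then consider "cut F S = 0" | "cut F S = 1" using yr yb by linarith
      then show False
      proof cases
        case 1
        then obtain C where C: "C \<in> \<C>" "C \<subseteq> S" using C_ex S by blast
        then obtain P where P: "P \<in> pp C" using pp(2) by blast
        then have PS: "P \<in> ?PP" "P \<subseteq> stubs r F S"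
          using C pp(3)[OF C(1) P] stubs_mono[OF C(2)] by blast+
        have yb': "?b = r + 1" "?y = r" using one[OF PS] neg 1 yr by linarith+
        then have "odd r" using par 1 by simp
        \<comment> \<open>One pair inside \<open>S\<close> already made everything tight, so a
          second one is contradictory. If \<open>S\<close> is a single component, it was given two
          pairs because of its \<open>r + 1\<close> stubs; otherwise another component inside
          \<open>S\<close> contributes its own.\<close>
        have "\<exists>Q\<in>?PP. Q \<subseteq> stubs r F S \<and> (\<exists>P\<in>?PP. P \<subseteq> stubs r F S \<and> P \<noteq> Q)"
        proof (cases "S = C")
          case True
          then obtain P Q where "P \<in> pp C" "Q \<in> pp C" "P \<noteq> Q"
            using pp(5)[OF C(1) \<open>odd r\<close>] yb' by blast
          then show ?thesis using pp(3)[OF C(1)] C(1) True by blast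
        next
          case False
          have "cut F (S - C) = 0" using cut_complement[OF finF 1 C(2)] C_D(3)[OF C(1)] by simp
          then obtain C' where C': "C' \<in> \<C>" "C' \<subseteq> S - C" using C_ex[of "S - C"] False C S by blast
          then obtain Q where Q: "Q \<in> pp C'" using pp(2) by blast
          have QS: "Q \<subseteq> stubs r F C'" "card Q = 2" using pp(3)[OF C'(1) Q] by auto
          have "stubs r F C \<inter> stubs r F C' = {}" using C' by (intro stubs_disj) auto
          moreover have "Q \<noteq> {}" using QS by auto
          ultimately have "P \<noteq> Q" using pp(3)[OF C(1) P] QS(1) by blast
          moreover have "Q \<subseteq> stubs r F S" using QS stubs_mono[of C' S r F] C' by blast
          ultimately show ?thesis using PS Q C' by blast
        qed
        then show False using two yb' by fastforce
      next
        case 2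
        then have yb': "?b = r" "?y = r" using neg yr yb by linarith+
        then have "odd r" using par 2 by simp
        have "\<exists>P\<in>?PP. P \<subseteq> stubs r F S"
        proof (cases "\<exists>C\<in>\<C>. C \<subseteq> S")
          case True
          then obtain C where C: "C \<in> \<C>" "C \<subseteq> S" by blast
          then obtain P where P: "P \<in> pp C" using pp(2) by blast
          have "P \<in> ?PP" using C P by blast
          moreover have "P \<subseteq> stubs r F S" using pp(3)[OF C(1) P] stubs_mono[OF C(2)] by blast
          ultimately show ?thesis by blast
        next
          case False
          obtain e where e: "{e \<in> F. fst e \<inter> S \<noteq> {} \<and> \<not> fst e \<subseteq> S} = {e}"
            using 2 unfolding cut_def by (rule card_1_singletonE)
          then obtain a where a: "a \<in> fst e" "a \<in> S" by blast
          obtain C where C: "C \<in> \<C>" "a \<in> C" using C_cover a S by blast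
          have Ccl: "fst e' \<inter> C = {} \<or> fst e' \<subseteq> C" if "e' \<in> F" for e'
            using C_D(3)[OF C(1)] that unfolding zero by blast
          \<comment> \<open>The only edge that leaves \<open>S\<close> has its end \<open>a\<close>
            in \<open>C\<close>, so \<open>S - C\<close> is a union of components. As
            \<open>S\<close> contains no component, \<open>S\<close> is one side of a cutedge inside
            \<open>C\<close>.\<close>
          have "cut F (S - C) = 0" unfolding zero
          proof (intro ballI)
            fix e' assume e': "e' \<in> F"
            have "e' = e" if "fst e' \<inter> S \<noteq> {}" "\<not> fst e' \<subseteq> S" using e e' that by blast
            then show "fst e' \<inter> (S - C) = {} \<or> fst e' \<subseteq> S - C"
              using Ccl[OF e'] a C by blast
          qed
          then have "S \<subseteq> C" using C_ex[of "S - C"] False S by blast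
          then show ?thesis using pp(4)[OF C(1) \<open>odd r\<close> _ 2 yb'(1)] C(1) by blast
        qed
        then show False using one yb' by fastforce
      qed
    qed
    then show "2 * ?y + 2 * inner F S + 2 \<le> r * card S + r" using b[OF S(1)] by linarith
  qed
qed

section \<open>Coloring the extra edges\<close>

lemma mem_complete_mgraph:
  "e \<in> edges (complete_mgraph l n) \<longleftrightarrow> fst e \<subseteq> {..<n} \<and> card (fst e) = 2 \<and> snd e < l"
  by (cases e) (auto simp: complete_mgraph_def)

lemma edges_on_complete: "edges_on (edges (complete_mgraph l n)) {..<n}"
proof -
  have "finite ({e. e \<subseteq> {..<n} \<and> card e = 2} \<times> {..<l})"
    by (rule finite_cartesian_product, rule finite_subset[of _ "Pow {..<n}"]) auto
  then have "finite (edges (complete_mgraph l n))" by (simp add: complete_mgraph_def)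
  then show ?thesis by (simp add: edges_on_def mem_complete_mgraph)
qed

lemmas finite_complete = edges_onD(1)[OF edges_on_complete]

lemma card_complete: "card (edges (complete_mgraph l n)) = (n choose 2) * l"
  using n_subsets[of "{..<n}" 2] by (simp add: complete_mgraph_def card_cartesian_product)

lemma inner_complete_pair:
  assumes "u < n" "v < n" "u \<noteq> v"
  shows "inner (edges (complete_mgraph l n)) {u, v} = l"
proof -
  have *: "e = {u, v}" if "e \<subseteq> {u, v}" "card e = 2" for e :: "nat set"
    using that assms(3) by (intro card_subset_eq) auto
  have "{e \<in> edges (complete_mgraph l n). fst e \<subseteq> {u, v}} = {{u, v}} \<times> {..<l}"
    using assms by (auto simp: mem_complete_mgraph dest: *)
  then show ?thesis by (simp add: inner_def card_cartesian_product)
qed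

lemma deg_complete:
  assumes "v < n"
  shows "deg (edges (complete_mgraph l n)) v = l * (n - 1)"
proof -
  let ?f = "\<lambda>(w, t). ({v, w}, t)"
  have "{e \<in> edges (complete_mgraph l n). v \<in> fst e} = ?f ` (({..<n} - {v}) \<times> {..<l})"
  proof (intro equalityI subsetI)
    fix e assume e: "e \<in> {e \<in> edges (complete_mgraph l n). v \<in> fst e}"
    then obtain a b where "fst e = {a, b}" "a \<noteq> b" by (auto simp: mem_complete_mgraph card_2_iff)
    then obtain w where "fst e = {v, w}" "w \<noteq> v" using e by auto
    moreover have "e = (fst e, snd e)" by simp
    ultimately show "e \<in> ?f ` (({..<n} - {v}) \<times> {..<l})"
      using e by (intro image_eqI[of _ _ "(w, snd e)"]) (auto simp: mem_complete_mgraph)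
  qed (use assms in \<open>auto simp: mem_complete_mgraph\<close>)
  moreover have "inj_on ?f (({..<n} - {v}) \<times> {..<l})"
    by (auto simp: inj_on_def doubleton_eq_iff)
  ultimately have "deg (edges (complete_mgraph l n)) v = card (({..<n} - {v}) \<times> {..<l})"
    by (simp add: deg_def card_image)
  then show ?thesis using assms by (simp add: card_cartesian_product)
qed

definition touching :: "'a edge set \<Rightarrow> 'a set \<Rightarrow> nat" where
  "touching F S = card {e \<in> F. fst e \<inter> S \<noteq> {}}"

lemma touching_eq:
  assumes "finite F" "\<And>e. e \<in> F \<Longrightarrow> card (fst e) = 2"
  shows "touching F S = inner F S + cut F S"
proof -
  have "fst e \<noteq> {}" if "e \<in> F" for e using assms(2)[OF that] by auto
  then have "{e \<in> F. fst e \<inter> S \<noteq> {}} =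
      {e \<in> F. fst e \<subseteq> S} \<union> {e \<in> F. fst e \<inter> S \<noteq> {} \<and> \<not> fst e \<subseteq> S}" by blast
  moreover have "card ({e \<in> F. fst e \<subseteq> S} \<union> {e \<in> F. fst e \<inter> S \<noteq> {} \<and> \<not> fst e \<subseteq> S}) =
      inner F S + cut F S"
    unfolding inner_def cut_def using assms(1) by (intro card_Un_disjoint) auto
  ultimately show ?thesis by (simp add: touching_def)
qed

lemma touching_complete:
  assumes "u < n" "v < n" "u \<noteq> v"
  shows "touching (edges (complete_mgraph l n)) {u, v} + l = 2 * (l * (n - 1))"
proof -
  let ?E = "edges (complete_mgraph l n)"
  note E = edges_onD(1,3)[OF edges_on_complete[of l n]]
  have "deg ?E u + deg ?E v = 2 * inner ?E {u, v} + cut ?E {u, v}"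
    using handshake[OF E(1) E(2), of "{u, v}"] assms by simp
  then show ?thesis
    using touching_eq[OF E(1) E(2), of "{u, v}"] assms
    by (simp add: inner_complete_pair deg_complete)
qed

lemma deg_le_touching: "finite F \<Longrightarrow> v \<in> S \<Longrightarrow> deg F v \<le> touching F S"
  unfolding deg_def touching_def by (rule card_mono) auto

lemma inner_le_touching:
  assumes "finite F" "S' \<subseteq> S"
  shows "inner F S \<le> inner F (S - S') + touching F S'"
proof -
  have "inner F S \<le> card ({e \<in> F. fst e \<subseteq> S - S'} \<union> {e \<in> F. fst e \<inter> S' \<noteq> {}})"
    unfolding inner_def using assms by (intro card_mono) auto
  also have "\<dots> \<le> inner F (S - S') + touching F S'"
    unfolding inner_def touching_def by (rule card_Un_le)
  finally show ?thesis .
qed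

lemma inner_pair_le_deg: "finite F \<Longrightarrow> (\<And>e. e \<in> F \<Longrightarrow> card (fst e) = 2) \<Longrightarrow> inner F {u, v} \<le> deg F u"
proof -
  assume F: "finite F" "\<And>e. e \<in> F \<Longrightarrow> card (fst e) = 2"
  have "u \<in> fst e" if "e \<in> F" "fst e \<subseteq> {u, v}" for e
  proof (rule ccontr)
    assume "u \<notin> fst e"
    then have "fst e \<subseteq> {v}" using that by auto
    then have "card (fst e) \<le> 1" using card_mono[of "{v}" "fst e"] by simp
    then show False using F(2)[OF that(1)] by simp
  qed
  then show ?thesis unfolding inner_def deg_def using F(1) by (intro card_mono) auto
qed

lemma extendable_insert:
  assumes "extendable r V F" "finite F" "e \<notin> F" "\<And>v. v \<in> fst e \<Longrightarrow> deg F v < r"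
    and "\<And>S. S \<subseteq> V \<Longrightarrow> fst e \<subseteq> S \<Longrightarrow> 2 * inner F S + 4 \<le> r * card S"
  shows "extendable r V (insert e F)"
  unfolding extendable_def
proof (intro conjI ballI allI impI)
  fix v assume "v \<in> V"
  then show "deg (insert e F) v \<le> r"
    using assms(4)[of v] extendableD(1)[OF assms(1), of v] by (auto simp: deg_insert[OF assms(2,3)])
next
  fix S assume "S \<subseteq> V \<and> S \<noteq> {}"
  then show "2 * inner (insert e F) S + 2 \<le> r * card S"
    using assms(5)[of S] extendableD(2)[OF assms(1), of S] by (auto simp: inner_insert[OF assms(2,3)])
qed

text \<open>At most \<open>r\<close> edges cannot violate the bound on three or more vertices, as
  \<open>2 r + 2 \<le> 3 r\<close>, and single vertices span no edge. Only the pairs remain to be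
  checked.\<close>

lemma extendable_small:
  assumes "finite V" "edges_on F V" "2 \<le> r" "card F \<le> r"
    and pairs: "\<And>u v. u \<noteq> v \<Longrightarrow> inner F {u, v} < r"
  shows "extendable r V F"
  unfolding extendable_def
proof (intro conjI ballI allI impI)
  note F = edges_onD[OF assms(2)]
  fix v
  have "deg F v \<le> card F" unfolding deg_def using F(1) by (intro card_mono) auto
  then show "deg F v \<le> r" using assms(4) by simp
next
  note F = edges_onD[OF assms(2)]
  fix S assume S: "S \<subseteq> V \<and> S \<noteq> {}"
  then have "finite S" using assms(1) finite_subset by blast
  then have "card S \<noteq> 0" using S by simp
  then consider "card S = 1" | "card S = 2" | "3 \<le> card S" by linarith
  then show "2 * inner F S + 2 \<le> r * card S"
  proof cases
    case 1
    have "\<not> fst e \<subseteq> S" if "e \<in> F" for e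
      using F(3)[OF that] 1 card_mono[OF \<open>finite S\<close>, of "fst e"] by auto
    then have "{e \<in> F. fst e \<subseteq> S} = {}" by blast
    then have "inner F S = 0" unfolding inner_def by (simp only: card.empty)
    then show ?thesis using 1 assms(3) by simp
  next
    case 2
    then obtain u v where "S = {u, v}" "u \<noteq> v" by (auto simp: card_2_iff)
    then show ?thesis using pairs[of u v] by simp
  next
    case 3
    have "2 * inner F S + 2 \<le> r * 3" using inner_le_card[OF F(1), of S] assms(3,4) by simp
    also have "\<dots> \<le> r * card S" using 3 by simp
    finally show ?thesis .
  qed
qed

text \<open>
  The only situation in which fewer than \<open>r\<close> edges of a color that does not accept \<open>uv\<close> touch
  \<open>{u, v}\<close>: one more edge would turn \<open>{u, v}\<close> into a saturated component.
\<close>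

definition isolated_pair :: "nat \<Rightarrow> 'a edge set \<Rightarrow> 'a \<Rightarrow> 'a \<Rightarrow> bool" where
  "isolated_pair r F u v \<longleftrightarrow> inner F {u, v} = r - 1 \<and> deg F u = r - 1 \<and> deg F v = r - 1"

text \<open>If neither end is saturated, \<open>e\<close> is blocked by a tight set \<open>S\<close>
  containing \<open>u\<close> and \<open>v\<close>. Comparing its tightness with the bound for
  \<open>S - {u, v}\<close> shows that at least \<open>r\<close> edges disappear with
  \<open>u\<close> and \<open>v\<close>. This comparison needs \<open>S - {u, v}\<close> to be
  nonempty; \<open>S = {u, v}\<close> leads to the isolated pair.\<close>

lemma blocked_touching:
  assumes V: "finite V" and F: "edges_on F V" and ext: "extendable r V F"
    and e: "e \<notin> F" "fst e = {u, v}" "u \<noteq> v" "u \<in> V" "v \<in> V"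
    and blocked: "\<not> extendable r V (insert e F)" and iso: "\<not> isolated_pair r F u v"
  shows "r \<le> touching F {u, v}"
proof (cases "deg F u < r \<and> deg F v < r")
  case False
  then show ?thesis
    using deg_le_touching[OF edges_onD(1)[OF F], of u "{u, v}"]
      deg_le_touching[OF edges_onD(1)[OF F], of v "{u, v}"] by auto
next
  case True
  note F' = edges_onD[OF F]
  have "\<exists>S. S \<subseteq> V \<and> fst e \<subseteq> S \<and> \<not> 2 * inner F S + 4 \<le> r * card S"
  proof (rule ccontr)
    assume "\<not> ?thesis"
    then have "extendable r V (insert e F)"
      using True e(2) by (intro extendable_insert[OF ext F'(1) e(1)]) auto
    then show False using blocked by simp
  qed
  then obtain S where S: "S \<subseteq> V" "{u, v} \<subseteq> S" "r * card S < 2 * inner F S + 4"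
    unfolding e(2) by (auto simp: not_le)
  have "finite S" using S(1) V finite_subset by blast
  then have card: "card S = card (S - {u, v}) + 2"
    using S(2) e(3) card_mono[of S "{u, v}"] by (simp add: card_Diff_subset)
  show ?thesis
  proof (cases "S - {u, v} = {}")
    case False
    then have "2 * inner F (S - {u, v}) + 2 \<le> r * card (S - {u, v})"
      using S(1) by (intro extendableD(2)[OF ext]) auto
    then show ?thesis
      using S(3) inner_le_touching[OF F'(1) S(2)] unfolding card by (simp add: algebra_simps)
  next
    case empty: True
    then have "S = {u, v}" using S(2) by blast
    then have "r - 1 \<le> inner F {u, v}" using S(3) e(3) by simp
    moreover have "inner F {u, v} \<le> deg F u" "inner F {u, v} \<le> deg F v"
      using inner_pair_le_deg[OF F'(1,3), of u v] inner_pair_le_deg[OF F'(1,3), of v u]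
      by (simp_all add: insert_commute)
    moreover have "deg F u < r" "deg F v < r" using True by auto
    ultimately have "isolated_pair r F u v" unfolding isolated_pair_def by (intro conjI; linarith)
    then show ?thesis using iso by simp
  qed
qed

section \<open>Partial colorings of the edges inside \<open>V\<close>\<close>

definition color_class :: "'a edge set \<Rightarrow> ('a edge \<Rightarrow> nat) \<Rightarrow> nat \<Rightarrow> 'a edge set" where
  "color_class E c i = {e \<in> E. c e = i}"

lemma mem_color_class: "e \<in> color_class E c i \<longleftrightarrow> e \<in> E \<and> c e = i"
  by (simp add: color_class_def)

lemma color_class_upd:
  "e \<in> E \<Longrightarrow> color_class E (c(e := i)) j =
    (if j = i then insert e (color_class E c j) else color_class E c j - {e})"
  by (auto simp: color_class_def)

lemma color_class_subset: "color_class E c i \<subseteq> E"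
  by (auto simp: color_class_def)

lemma disjoint_sum_le:
  assumes "finite A" and "\<And>i. i \<in> I \<Longrightarrow> B i \<subseteq> A" and "\<And>i j. i \<in> I \<Longrightarrow> j \<in> I \<Longrightarrow> i \<noteq> j \<Longrightarrow> B i \<inter> B j = {}"
    and "finite I"
  shows "(\<Sum>i\<in>I. card (B i)) \<le> card A"
proof -
  have "(\<Sum>i\<in>I. card (B i)) = card (\<Union>(B ` I))"
    using assms finite_subset by (intro card_UN_disjoint[symmetric]) blast+
  also have "\<dots> \<le> card A" using assms by (intro card_mono) auto
  finally show ?thesis .
qed

locale enclosing_params =
  fixes lam mu k r n :: nat
  assumes lam: "0 < lam" "lam < mu" and mu: "mu \<le> 2 * (r - 1)" and r: "2 \<le> r" and n: "3 \<le> n"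
    and rk: "r * k = mu * (2 * n - 3)"
begin

abbreviation "E \<equiv> edges (complete_mgraph mu n)"

text \<open>Color \<open>0\<close> marks edges that are not colored yet. The lower bound
  \<open>r\<close> on the class sizes keeps the number of loops at the amalgamated vertex
  nonnegative.\<close>

definition valid :: "(nat edge \<Rightarrow> nat) \<Rightarrow> bool" where
  "valid c \<longleftrightarrow> (\<forall>e\<in>E. c e \<le> k) \<and>
    (\<forall>i\<in>{1..k}. extendable r {..<n} (color_class E c i) \<and> r \<le> card (color_class E c i))"

lemmas E = edges_onD[OF edges_on_complete[of mu n]]

lemma cls: "edges_on (color_class E c i) {..<n}"
  using edges_on_complete color_class_subset by (rule edges_on_subset)

lemmas cls_D = edges_onD[OF cls]

text \<open>Losing an edge never destroys \<open>extendable\<close>, so the old color of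
  \<open>e\<close> only has to keep \<open>r\<close> edges; this is what \<open>old\<close>
  ensures.\<close>

lemma valid_upd:
  assumes c: "valid c" and e: "e \<in> E" and i: "i \<in> {1..k}"
    and ext: "extendable r {..<n} (insert e (color_class E c i))"
    and old: "c e = 0 \<or> c e = i \<or> r < card (color_class E c (c e))"
  shows "valid (c(e := i))"
  unfolding valid_def
proof (intro conjI ballI)
  fix e' assume "e' \<in> E"
  then show "(c(e := i)) e' \<le> k" using c i by (auto simp: valid_def)
next
  fix j assume j: "j \<in> {1..k}"
  have cj: "extendable r {..<n} (color_class E c j)" "r \<le> card (color_class E c j)"
    using c j by (auto simp: valid_def)
  show "extendable r {..<n} (color_class E (c(e := i)) j)"
    using ext extendable_mono[OF cj(1) cls_D(1)] by (auto simp: color_class_upd[OF e])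
  show "r \<le> card (color_class E (c(e := i)) j)"
  proof (cases "j = i")
    case True
    then show ?thesis
      using cj(2) card_insert_le[of "color_class E c i" e] by (auto simp: color_class_upd[OF e])
  next
    case False
    then show ?thesis
      using cj(2) old j cls_D(1)[of c j] e
      by (cases "c e = j") (auto simp: color_class_upd[OF e] card_Diff_singleton_if mem_color_class)
  qed
qed

text \<open>The two colors and \<open>e\<close> would use \<open>2 (r - 1) + 1\<close> edges between
  \<open>u\<close> and \<open>v\<close>, more than \<open>mu\<close>. The statement is about
  \<open>inner\<close> and not about \<open>isolated_pair\<close> because it also has to bound the
  class that receives \<open>e\<close> in exchange for another edge.\<close>

lemma unique_rich_color:
  assumes e: "e \<in> E" "c e = 0" "fst e = {u, v}" and ij: "0 < i" "0 < j" "i \<noteq> j"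
    and "r - 1 \<le> inner (color_class E c i) {u, v}" "r - 1 \<le> inner (color_class E c j) {u, v}"
  shows False
proof -
  have uv: "u < n" "v < n" "u \<noteq> v" using e(1,3) by (auto simp: mem_complete_mgraph card_2_iff)
  let ?B = "\<lambda>i. {f \<in> color_class E c i. fst f \<subseteq> {u, v}}"
  have "(\<Sum>i\<in>{0, i, j}. card (?B i)) \<le> card {f \<in> E. fst f \<subseteq> {u, v}}"
    using E(1) by (intro disjoint_sum_le) (auto simp: mem_color_class)
  then have "card (?B 0) + (inner (color_class E c i) {u, v} + inner (color_class E c j) {u, v}) \<le> mu"
    using ij inner_complete_pair[OF uv, of mu] by (simp add: inner_def)
  moreover have "0 < card (?B 0)"
  proof -
    have "e \<in> ?B 0" using e by (simp add: mem_color_class)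
    moreover have "finite (?B 0)" using cls_D(1)[of c 0] by simp
    ultimately show ?thesis using card_gt_0_iff by blast
  qed
  ultimately show False using assms(7,8) mu r by linarith
qed

text \<open>
  If no color accepted \<open>e = uv\<close>, each of the \<open>k\<close> colors would have at least \<open>r\<close> edges touching
  \<open>{u, v}\<close>; but only \<open>r k\<close> edges touch \<open>{u, v}\<close>, and \<open>e\<close> itself is not colored yet.
\<close>

lemma color_available:
  assumes c: "valid c" and e: "e \<in> E" "c e = 0" "fst e = {u, v}"
    and iso: "\<And>i. i \<in> {1..k} \<Longrightarrow> \<not> isolated_pair r (color_class E c i) u v"
  shows "\<exists>i\<in>{1..k}. extendable r {..<n} (insert e (color_class E c i))"
proof (rule ccontr)
  assume neg: "\<not> ?thesis"
  have uv: "u < n" "v < n" "u \<noteq> v" using e(1,3) by (auto simp: mem_complete_mgraph card_2_iff)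
  have "r \<le> touching (color_class E c i) {u, v}" if i: "i \<in> {1..k}" for i
  proof (rule blocked_touching[OF _ cls])
    show "extendable r {..<n} (color_class E c i)" using c i by (simp add: valid_def)
    show "e \<notin> color_class E c i" using e i by (simp add: mem_color_class)
    show "\<not> extendable r {..<n} (insert e (color_class E c i))" using neg i by blast
  qed (use uv e iso[OF i] in auto)
  then have "(\<Sum>i\<in>{1..k}. r) \<le> (\<Sum>i\<in>{1..k}. touching (color_class E c i) {u, v})"
    by (intro sum_mono)
  also have "\<dots> \<le> card ({f \<in> E. fst f \<inter> {u, v} \<noteq> {}} - {e})"
    unfolding touching_def using E(1) e
    by (intro disjoint_sum_le) (auto simp: mem_color_class)
  also have "\<dots> = touching E {u, v} - 1"
    unfolding touching_def using e E(1) by (subst card_Diff_singleton) auto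
  finally have "r * k \<le> touching E {u, v} - 1" by (simp add: mult.commute)
  \<comment> \<open>Hence \<open>mu * (2 n - 3)\<close> edges touch \<open>{u, v}\<close>, and this
    is \<open>r k\<close> because \<open>m - 1 = 2 n - 3\<close>.\<close>
  moreover have "touching E {u, v} + mu = 2 * (mu * (n - 1))" using touching_complete[OF uv] .
  moreover have "2 * (mu * (n - 1)) = mu * (2 * n - 3) + mu"
  proof -
    obtain p where "n = p + 3" using n by (metis le_add_diff_inverse2)
    then show ?thesis by (simp add: algebra_simps)
  qed
  moreover have "0 < r * k" using rk lam n by simp
  ultimately show False using rk by linarith
qed

text \<open>
  As \<open>mu \<le> 2 * (r - 1)\<close>, at most one color has \<open>{u, v}\<close> as an isolated pair. If there is one,
  recoloring an extra edge between \<open>u\<close> and an unsaturated vertex \<open>a\<close> with it destroys the isolated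
  pair; if this leaves the old color of that edge with fewer than \<open>r\<close> edges, then \<open>uv\<close> replaces it.
\<close>

lemma color_one_more:
  assumes c: "valid c" and old: "\<And>e. e \<in> E \<Longrightarrow> snd e < lam \<Longrightarrow> c e \<noteq> 0"
    and e: "e \<in> E" "c e = 0"
  shows "\<exists>c'. valid c' \<and> (\<forall>f\<in>E. snd f < lam \<longrightarrow> c' f = c f) \<and>
    card (color_class E c' 0) < card (color_class E c 0)"
proof -
  have e_new: "\<not> snd e < lam" using old e by blast
  have fewer: "card (color_class E c' 0) < card (color_class E c 0)"
    if "color_class E c' 0 = color_class E c 0 - {e}" for c'
    unfolding that using e cls_D(1) by (intro card_Diff1_less) (auto simp: mem_color_class)
  obtain u v where uv: "fst e = {u, v}" "u \<noteq> v" using E(3)[OF e(1)] by (auto simp: card_2_iff)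
  have uvn: "u < n" "v < n" using e(1) uv by (auto simp: mem_complete_mgraph)
  have simple: ?thesis if iso: "\<And>i. i \<in> {1..k} \<Longrightarrow> \<not> isolated_pair r (color_class E c i) u v"
  proof -
    obtain i where i: "i \<in> {1..k}" "extendable r {..<n} (insert e (color_class E c i))"
      using color_available[OF c e uv(1) iso] by blast
    then have "valid (c(e := i))" using c e by (intro valid_upd) auto
    moreover have "color_class E (c(e := i)) 0 = color_class E c 0 - {e}"
      using i e by (simp add: color_class_upd)
    ultimately show ?thesis using fewer e_new by (intro exI[of _ "c(e := i)"]) auto
  qed
  show ?thesis
  proof (cases "\<exists>i\<in>{1..k}. isolated_pair r (color_class E c i) u v")
    case False then show ?thesis using simple by blast
  next
    case True
    then obtain i where i: "i \<in> {1..k}" and "isolated_pair r (color_class E c i) u v" by blast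
    then have iso: "inner (color_class E c i) {u, v} = r - 1" "deg (color_class E c i) u = r - 1"
      "deg (color_class E c i) v = r - 1" by (auto simp: isolated_pair_def)
    let ?F = "color_class E c i" and ?S = "{..<n} - {u, v}"
    have extF: "extendable r {..<n} ?F" using c i by (simp add: valid_def)
    \<comment> \<open>The \<open>r - 1\<close> parallel edges use up the degrees of \<open>u\<close>
      and \<open>v\<close>, so no edge of this color leaves \<open>{u, v}\<close>.\<close>
    have inF: "fst f \<subseteq> {u, v}" if "f \<in> ?F" "fst f \<inter> {u, v} \<noteq> {}" for f
    proof -
      have "(\<Sum>w\<in>{u, v}. deg ?F w) = 2 * inner ?F {u, v} + cut ?F {u, v}"
        using cls_D(1,3) by (intro handshake) auto
      then have "cut ?F {u, v} = 0" using iso uv(2) by simp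
      then have "{f \<in> ?F. fst f \<inter> {u, v} \<noteq> {} \<and> \<not> fst f \<subseteq> {u, v}} = {}"
        using cls_D(1)[of c i] by (simp add: cut_def)
      then show ?thesis using that by blast
    qed
    have split: "inner ?F T = inner ?F (T - {u, v}) + inner ?F (T \<inter> {u, v})" for T
    proof -
      have ne: "fst f \<noteq> {}" if "f \<in> ?F" for f using cls_D(3)[OF that] by auto
      have "{f \<in> ?F. fst f \<subseteq> T} = {f \<in> ?F. fst f \<subseteq> T - {u, v}} \<union> {f \<in> ?F. fst f \<subseteq> T \<inter> {u, v}}"
        using inF by blast
      moreover have "{f \<in> ?F. fst f \<subseteq> T - {u, v}} \<inter> {f \<in> ?F. fst f \<subseteq> T \<inter> {u, v}} = {}"
        using ne by blast
      ultimately show ?thesis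
        unfolding inner_def using cls_D(1)[of c i] by (simp add: card_Un_disjoint)
    qed
    \<comment> \<open>If all other vertices were saturated, no stub and no edge would leave
      \<open>?S\<close>, which contradicts extendability; \<open>?S\<close> is nonempty because
      \<open>n \<ge> 3\<close>.\<close>
    have "\<exists>a\<in>?S. deg ?F a < r"
    proof (rule ccontr)
      assume "\<not> ?thesis"
      then have "(\<Sum>a\<in>?S. r) \<le> (\<Sum>a\<in>?S. deg ?F a)" by (intro sum_mono) (auto simp: not_less)
      also have "\<dots> = 2 * inner ?F ?S + cut ?F ?S" using cls_D(1,3) by (intro handshake) auto
      also have "cut ?F ?S = 0"
      proof -
        have "fst f \<inter> ?S = {} \<or> fst f \<subseteq> ?S" if "f \<in> ?F" for f
          using inF[OF that] cls_D(2)[OF that] by blast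
        then have "{f \<in> ?F. fst f \<inter> ?S \<noteq> {} \<and> \<not> fst f \<subseteq> ?S} = {}" by blast
        then show ?thesis unfolding cut_def by (simp only: card.empty)
      qed
      finally have "r * card ?S \<le> 2 * inner ?F ?S" by (simp add: mult.commute)
      moreover have "?S \<noteq> {}"
      proof
        assume "?S = {}"
        then have "card {..<n} \<le> card {u, v}" by (intro card_mono) auto
        then show False using n uv(2) by simp
      qed
      ultimately show False using extendableD(2)[OF extF, of ?S] by auto
    qed
    then obtain a where a: "a < n" "a \<noteq> u" "a \<noteq> v" "deg ?F a < r" by auto
    \<comment> \<open>The label \<open>lam\<close> makes \<open>f\<close> an extra edge, whose color
      may be changed; it exists because \<open>lam < mu\<close>.\<close>
    define f where "f = ({u, a}, lam)"
    have fst_f: "fst f = {u, a}" and snd_f: "snd f = lam" by (simp_all add: f_def)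
    have "f \<in> E" unfolding mem_complete_mgraph fst_f snd_f using a uvn lam by simp
    moreover have "fst f \<noteq> fst e" unfolding fst_f uv(1) using a by (simp add: doubleton_eq_iff)
    ultimately have f: "f \<in> E" "fst f = {u, a}" "\<not> snd f < lam" "f \<noteq> e"
      using fst_f snd_f by auto
    have "f \<notin> ?F"
    proof
      assume "f \<in> ?F"
      then have "{u, a} \<subseteq> {u, v}" using inF[of f] unfolding f(2) by simp
      then show False using a by simp
    qed
    have extf: "extendable r {..<n} (insert f ?F)"
    proof (rule extendable_insert[OF extF cls_D(1) \<open>f \<notin> ?F\<close>])
      fix w assume "w \<in> fst f" then show "deg ?F w < r" using f a iso r by auto
    next
      fix T assume T: "T \<subseteq> {..<n}" "fst f \<subseteq> T"
      then have finT: "finite T" using finite_subset by blast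
      have "a \<in> T - {u, v}" using T f a by auto
      then have *: "2 * inner ?F (T - {u, v}) + 2 \<le> r * card (T - {u, v})"
        using T by (intro extendableD(2)[OF extF]) auto
      \<comment> \<open>The nonempty set \<open>T - {u, v}\<close> has slack 2. Another 2 come from
        \<open>u\<close> and \<open>v\<close> together, as \<open>2 r - 2 (r - 1) = 2\<close>, or
        from \<open>u\<close> alone, as \<open>r \<ge> 2\<close> and no edge is gained.\<close>
      show "2 * inner ?F T + 4 \<le> r * card T"
      proof (cases "v \<in> T")
        case True
        then have Tuv: "T \<inter> {u, v} = {u, v}" using T f by auto
        have "{u, v} \<subseteq> T" using T(2) True unfolding f(2) by simp
        then have "card T = card (T - {u, v}) + 2"
          using finT uv(2) card_mono[of T "{u, v}"] by (simp add: card_Diff_subset)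
        then show ?thesis using * split[of T] iso(1) r unfolding Tuv by (simp add: algebra_simps)
      next
        case False
        then have Tu: "T \<inter> {u, v} = {u}" "T - {u, v} = T - {u}" "u \<in> T" using T f by auto
        have "inner ?F {u} = 0"
        proof -
          have "\<not> fst f' \<subseteq> {u}" if "f' \<in> ?F" for f'
            using cls_D(3)[OF that] card_mono[of "{u}" "fst f'"] by auto
          then have "{f' \<in> ?F. fst f' \<subseteq> {u}} = {}" by blast
          then show ?thesis unfolding inner_def by (simp only: card.empty)
        qed
        moreover have "card T = card (T - {u}) + 1"
          using Tu(3) finT by (metis card_Suc_Diff1 Suc_eq_plus1)
        ultimately show ?thesis using * split[of T] r unfolding Tu by (simp add: algebra_simps)
      qed
    qed
    have rich: False if "j \<in> {1..k}" "j \<noteq> i" "r - 1 \<le> inner (color_class E c j) {u, v}" for j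
      using unique_rich_color[of e c u v i j] e uv(1) i iso that by auto
    show ?thesis
    proof (cases "c f = 0")
      case True
      have "valid (c(f := i))" using True f extf by (intro valid_upd[OF c _ i]) auto
      moreover have "card (color_class E (c(f := i)) 0) < card (color_class E c 0)"
      proof -
        have "f \<in> color_class E c 0" using True f by (simp add: mem_color_class)
        moreover have "color_class E (c(f := i)) 0 = color_class E c 0 - {f}"
          using i by (simp add: color_class_upd[OF f(1)])
        ultimately show ?thesis using card_Diff1_less[OF cls_D(1)] by simp
      qed
      ultimately show ?thesis using f by (intro exI[of _ "c(f := i)"]) auto
    next
      case False
      define j where "j = c f"
      have j: "j \<in> {1..k}" "j \<noteq> i"
        using False c f \<open>f \<notin> ?F\<close> by (auto simp: j_def valid_def mem_color_class)
      let ?Fj = "color_class E c j" and ?c = "c(f := i)"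
      have fj: "f \<in> ?Fj" using f by (simp add: mem_color_class j_def)
      have class0: "color_class E ?c 0 = color_class E c 0"
        using f i False by (auto simp: color_class_upd mem_color_class)
      show ?thesis
      proof (cases "card ?Fj = r")
        case True
        let ?c' = "?c(e := j)"
        have cl: "color_class E ?c' l = (if l = j then insert e (?Fj - {f}) else if l = i then insert f ?F
            else color_class E c l)" if "l \<in> {1..k}" for l
          using that j i f e fj by (auto simp: color_class_def j_def)
        have card': "card (insert e (?Fj - {f})) = r"
        proof -
          have "e \<notin> ?Fj - {f}" using e j by (auto simp: mem_color_class)
          then show ?thesis using fj True cls_D(1)[of c j] r by simp
        qed
        have "extendable r {..<n} (insert e (?Fj - {f}))"
        proof (rule extendable_small)
          show "edges_on (insert e (?Fj - {f})) {..<n}"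
            using edges_on_complete by (rule edges_on_subset) (use e in \<open>auto simp: mem_color_class\<close>)
          fix a b :: nat assume "a \<noteq> b"
          have e_notin: "e \<notin> ?Fj - {f}" using e j by (auto simp: mem_color_class)
          have fin: "finite (?Fj - {f})" using cls_D(1) by simp
          have card_j: "card (?Fj - {f}) = r - 1" using True fj cls_D(1) by simp
          show "inner (insert e (?Fj - {f})) {a, b} < r"
          \<comment> \<open>By \<open>rich\<close>, \<open>?Fj\<close> has fewer than
            \<open>r - 1\<close> edges between \<open>u\<close> and \<open>v\<close>, so
            \<open>e\<close> may be added there. Every other pair misses \<open>e\<close> and thus
            spans at most \<open>r - 1\<close> of the \<open>r\<close> edges.\<close>
          proof (cases "{u, v} \<subseteq> {a, b}")
            case True
            then have ab: "{a, b} = {u, v}" using uv(2) by auto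
            have "inner (?Fj - {f}) {u, v} \<le> inner ?Fj {u, v}"
              using cls_D(1) by (intro inner_mono) auto
            then have "inner (?Fj - {f}) {u, v} < r - 1" using rich[OF j] by (metis le_trans not_less)
            then show ?thesis unfolding ab inner_insert[OF fin e_notin] using uv(1) by simp
          next
            case False
            then have "\<not> fst e \<subseteq> {a, b}" unfolding uv(1) .
            then have "inner (insert e (?Fj - {f})) {a, b} = inner (?Fj - {f}) {a, b}"
              unfolding inner_insert[OF fin e_notin] by simp
            then show ?thesis using inner_le_card[OF fin, of "{a, b}"] card_j r by simp
          qed
        qed (use card' r in auto)
        moreover have "r \<le> card (insert f ?F)"
          using c i card_insert_le[of ?F f] by (auto simp: valid_def intro: le_trans)
        ultimately have "valid ?c'"
          unfolding valid_def using cl card' extf c i j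
          by (auto simp: valid_def)
        moreover have "color_class E ?c' 0 = color_class E c 0 - {e}"
          using class0 e(1) j by (simp add: color_class_upd)
        ultimately show ?thesis using fewer f e_new by (intro exI[of _ ?c']) auto
      next
        case False
        moreover have "r \<le> card ?Fj" using c j by (simp add: valid_def)
        ultimately have card_j: "r < card ?Fj" by simp
        have c': "valid ?c" using f extf card_j by (intro valid_upd[OF c _ i]) (auto simp: j_def)
        \<comment> \<open>In color \<open>i\<close> the edge \<open>f\<close> has raised the degree
          of \<open>u\<close> to \<open>r\<close>; in any other color \<open>rich\<close> excludes
          an isolated pair. So \<open>e\<close> can be colored by plain counting.\<close>
        have "\<not> isolated_pair r (color_class E ?c l) u v" if l: "l \<in> {1..k}" for l
        proof (cases "l = i")
          case True
          have "deg (color_class E ?c l) u = r"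
            using True iso f r unfolding color_class_upd[OF f(1)]
            by (simp add: deg_insert[OF cls_D(1) \<open>f \<notin> ?F\<close>])
          then show ?thesis using r unfolding isolated_pair_def by linarith
        next
          case False
          have "inner (color_class E ?c l) {u, v} \<le> inner (color_class E c l) {u, v}"
            using cls_D(1) False unfolding color_class_upd[OF f(1)] by (intro inner_mono) auto
          then show ?thesis using rich[OF l False] by (fastforce simp: isolated_pair_def)
        qed
        moreover have "?c e = 0" using e f by auto
        ultimately obtain l where l: "l \<in> {1..k}" "extendable r {..<n} (insert e (color_class E ?c l))"
          using color_available[OF c' e(1) _ uv(1)] by blast
        have "valid (?c(e := l))" using l \<open>?c e = 0\<close> e by (intro valid_upd[OF c']) auto
        moreover have "color_class E (?c(e := l)) 0 = color_class E c 0 - {e}"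
          using class0 e(1) l by (simp add: color_class_upd)
        ultimately show ?thesis using fewer f e_new by (intro exI[of _ "?c(e := l)"]) auto
      qed
    qed
  qed
qed

lemma color_all:
  assumes "valid c" and "\<And>e. e \<in> E \<Longrightarrow> snd e < lam \<Longrightarrow> c e \<noteq> 0"
  shows "\<exists>c'. valid c' \<and> (\<forall>e\<in>E. snd e < lam \<longrightarrow> c' e = c e) \<and> (\<forall>e\<in>E. c' e \<noteq> 0)"
  using assms
proof (induction "card (color_class E c 0)" arbitrary: c rule: less_induct)
  case less
  show ?case
  proof (cases "\<exists>e\<in>E. c e = 0")
    case False then show ?thesis using less.prems(1) by (intro exI[of _ c]) auto
  next
    case True
    then obtain c' where c': "valid c'" "\<forall>f\<in>E. snd f < lam \<longrightarrow> c' f = c f"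
      "card (color_class E c' 0) < card (color_class E c 0)"
      using color_one_more[OF less.prems] by blast
    then have "\<exists>c''. valid c'' \<and> (\<forall>e\<in>E. snd e < lam \<longrightarrow> c'' e = c' e) \<and> (\<forall>e\<in>E. c'' e \<noteq> 0)"
      using less.prems(2) by (intro less.hyps) auto
    then show ?thesis using c'(2) by auto
  qed
qed
end

section \<open>Filling up small color classes\<close>

lemma distribute:
  assumes "finite I" "finite X" "(\<Sum>i\<in>I. w i) \<le> card X" "z \<notin> I"
  shows "\<exists>g. (\<forall>x. g x \<in> insert z I) \<and> (\<forall>i\<in>I. card {x \<in> X. g x = i} = w i)"
  using assms
proof (induction I arbitrary: X rule: finite_induct)
  case empty
  then show ?case by (intro exI[of _ "\<lambda>_. z"]) auto
next
  case (insert j I)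
  then have sum: "w j + (\<Sum>i\<in>I. w i) \<le> card X" by simp
  then obtain Y where Y: "Y \<subseteq> X" "card Y = w j"
    using obtain_subset_with_card_n[of "w j" X] by auto
  have "(\<Sum>i\<in>I. w i) \<le> card (X - Y)"
    using sum Y insert.prems by (simp add: card_Diff_subset finite_subset)
  then obtain g where g: "\<And>x. g x \<in> insert z I" "\<And>i. i \<in> I \<Longrightarrow> card {x \<in> X - Y. g x = i} = w i"
    using insert.IH[of "X - Y"] insert.prems by auto
  let ?g = "\<lambda>x. if x \<in> Y then j else g x"
  have "{x \<in> X. ?g x = j} = Y"
  proof -
    have "g x \<noteq> j" for x using g(1)[of x] insert by auto
    then show ?thesis using Y by auto
  qed
  moreover have "{x \<in> X. ?g x = i} = {x \<in> X - Y. g x = i}" if "i \<in> I" for i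
    using that insert.hyps by auto
  ultimately have "\<forall>i\<in>insert j I. card {x \<in> X. ?g x = i} = w i" using Y g(2) by simp
  moreover have "\<forall>x. ?g x \<in> insert z (insert j I)" using g(1) by auto
  ultimately show ?case by (intro exI[of _ ?g] conjI)
qed

lemma card_exchange: "finite S \<Longrightarrow> y \<in> S \<Longrightarrow> x \<notin> S \<Longrightarrow> card (insert x (S - {y})) = card S"
  using card_Suc_Diff1[of S y] by simp

context enclosing_params
begin

abbreviation "E\<^sub>0 \<equiv> edges (complete_mgraph lam n)"

lemma E0_subset: "E\<^sub>0 \<subseteq> E"
  using lam by (auto simp: mem_complete_mgraph)

lemma E0_iff: "e \<in> E\<^sub>0 \<longleftrightarrow> e \<in> E \<and> snd e < lam"
  using lam by (auto simp: mem_complete_mgraph)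

text \<open>
  Colors with fewer than \<open>r\<close> edges are filled up to exactly \<open>r\<close> edges; such a color is extendable
  unless its edges are all parallel. Filling with the least number of all-parallel colors, an
  exchange of two extra edges shows that by the second counting condition there is none.
\<close>

lemma fill_colors:
  assumes col: "\<And>e. e \<in> E\<^sub>0 \<Longrightarrow> c e \<in> {1..k}"
    and ext: "\<And>i. i \<in> {1..k} \<Longrightarrow> extendable r {..<n} (color_class E\<^sub>0 c i)"
    and few: "(\<Sum>i\<in>{1..k}. r - card (color_class E\<^sub>0 c i)) \<le> card (E - E\<^sub>0)"
    and par: "\<And>u v. u < n \<Longrightarrow> v < n \<Longrightarrow> u \<noteq> v \<Longrightarrow>
      card {i \<in> {1..k}. card (color_class E\<^sub>0 c i) < r \<and> (\<forall>e\<in>color_class E\<^sub>0 c i. fst e = {u, v})}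
        \<le> card {e \<in> E - E\<^sub>0. fst e \<noteq> {u, v}}"
  shows "\<exists>c'. valid c' \<and> (\<forall>e\<in>E\<^sub>0. c' e = c e)"
proof -
  let ?A = "color_class E\<^sub>0 c" and ?X = "E - E\<^sub>0"
  note finE = E(1)
  have finE0: "finite E\<^sub>0" using finE E0_subset finite_subset by blast
  \<comment> \<open>By truncated subtraction, colors with at least \<open>r\<close> edges receive no
    extra edge; the extra edges left over keep color \<open>0\<close>. Accordingly
    \<open>bad\<close> looks at short colors only, since the other classes are unchanged and covered
    by \<open>ext\<close>.\<close>
  define admits where "admits d \<longleftrightarrow> (\<forall>e\<in>E\<^sub>0. d e = c e) \<and> (\<forall>e\<in>E. d e \<le> k) \<and>
    (\<forall>i\<in>{1..k}. card {e \<in> ?X. d e = i} = r - card (?A i))" for d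
  define bad where "bad d = {i \<in> {1..k}. card (?A i) < r \<and> (\<exists>P. \<forall>e\<in>color_class E d i. fst e = P)}" for d
  have fin_bad: "finite (bad d)" for d by (simp add: bad_def)
  have "\<exists>d. admits d"
  proof -
    have "\<exists>g. (\<forall>e. g e \<in> insert 0 {1..k}) \<and>
        (\<forall>i\<in>{1..k}. card {e \<in> ?X. g e = i} = r - card (?A i))"
      using few finE by (intro distribute) auto
    then obtain g where "\<forall>e. g e \<in> insert 0 {1..k}"
      "\<forall>i\<in>{1..k}. card {e \<in> ?X. g e = i} = r - card (?A i)" by (elim exE conjE)
    note g = this(1)[rule_format] this(2)[rule_format]
    have "{e \<in> ?X. (if e \<in> E\<^sub>0 then c e else g e) = i} = {e \<in> ?X. g e = i}" for i by auto
    moreover have "g e \<le> k" for e using g(1)[of e] by auto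
    moreover have "c e \<le> k" if "e \<in> E\<^sub>0" for e using col[OF that] by simp
    ultimately have "admits (\<lambda>e. if e \<in> E\<^sub>0 then c e else g e)"
      unfolding admits_def using g(2) by auto
    then show ?thesis by (rule exI[of admits])
  qed
  then obtain d where d: "admits d" and least: "\<And>d'. admits d' \<Longrightarrow> card (bad d) \<le> card (bad d')"
    using ex_has_least_nat[of admits _ "\<lambda>d. card (bad d)"] by blast
  have dE0: "d e = c e" if "e \<in> E\<^sub>0" for e using d that by (simp add: admits_def)
  have dk: "d e \<le> k" if "e \<in> E" for e using d that by (simp add: admits_def)
  have dX: "card {e \<in> ?X. d e = i} = r - card (?A i)" if "i \<in> {1..k}" for i
    using d that by (simp add: admits_def)
  have split: "color_class E d i = ?A i \<union> {e \<in> ?X. d e = i}" for i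
    using dE0 E0_subset by (auto simp: color_class_def)
  have card_class: "card (color_class E d i) = card (?A i) + (r - card (?A i))" if "i \<in> {1..k}" for i
    unfolding split dX[OF that, symmetric]
    using finE finE0 by (intro card_Un_disjoint) (auto simp: color_class_def)
  have short: "card (?A i) < r" if "i \<in> {1..k}" "e \<in> ?X" "d e = i" for i e
  proof -
    have "{e \<in> ?X. d e = i} \<noteq> {}" using that by blast
    then have "card {e \<in> ?X. d e = i} \<noteq> 0" using finE by simp
    then show ?thesis using dX[OF that(1)] by linarith
  qed
  have no_bad: "bad d = {}"
  proof (rule ccontr)
    assume "bad d \<noteq> {}"
    then obtain i P where i: "i \<in> {1..k}" "card (?A i) < r" and P: "\<And>e. e \<in> color_class E d i \<Longrightarrow> fst e = P"
      unfolding bad_def by blast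
    have ibad: "i \<in> bad d" using i P unfolding bad_def by blast
    have "{e \<in> ?X. d e = i} \<noteq> {}"
    proof
      assume "{e \<in> ?X. d e = i} = {}"
      then have "r - card (?A i) = 0" using dX[OF i(1)] by (simp only: card.empty)
      then show False using i(2) by simp
    qed
    then obtain e where e: "e \<in> ?X" "d e = i" by blast
    then have eP: "fst e = P" using P by (simp add: mem_color_class)
    obtain u v where uv: "P = {u, v}" "u \<noteq> v" using E(3)[of e] e eP by (auto simp: card_2_iff)
    have uvn: "u < n" "v < n" using E(2)[of e] e eP uv by auto
    let ?T = "{j \<in> {1..k}. card (?A j) < r \<and> (\<forall>e\<in>?A j. fst e = P)}"
    \<comment> \<open>Exchange the colors of \<open>e\<close> and \<open>f\<close>: color
      \<open>i\<close> now contains \<open>f\<close> next to an edge parallel to \<open>e\<close>,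
      so it is no longer bad. By minimality the old color of \<open>f\<close> must have become bad,
      so it is not \<open>0\<close> and all its edges other than \<open>f\<close> are parallel to
      \<open>e\<close>.\<close>
    have key: "d f \<in> ?T - {i} \<and> (\<forall>f'\<in>color_class E d (d f) - {f}. fst f' = P)"
      if f: "f \<in> ?X" "fst f \<noteq> P" for f
    proof -
      define j where "j = d f"
      have "j \<noteq> i" using P[of f] f by (auto simp: j_def mem_color_class)
      have "f \<noteq> e" using f eP by auto
      define d' where "d' = d(e := j, f := i)"
      have cl: "color_class E d' l = (if l = i then insert f (color_class E d i - {e})
          else if l = j then insert e (color_class E d j - {f}) else color_class E d l)" for l
        using e f \<open>j \<noteq> i\<close> \<open>f \<noteq> e\<close> by (auto simp: d'_def color_class_def j_def)
      have "admits d'" unfolding admits_def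
      proof (intro conjI ballI)
        fix e' assume "e' \<in> E\<^sub>0" then show "d' e' = c e'" using dE0 e f by (auto simp: d'_def)
      next
        fix e' assume "e' \<in> E" then show "d' e' \<le> k"
          using dk[of e'] dk[of f] i f by (auto simp: d'_def j_def)
      next
        fix l assume l: "l \<in> {1..k}"
        have "{e' \<in> ?X. d' e' = l} = (if l = i then insert f ({e' \<in> ?X. d e' = i} - {e})
          else if l = j then insert e ({e' \<in> ?X. d e' = j} - {f}) else {e' \<in> ?X. d e' = l})"
          using e f \<open>j \<noteq> i\<close> \<open>f \<noteq> e\<close> by (auto simp: d'_def j_def)
        moreover have "card (insert f ({e' \<in> ?X. d e' = i} - {e})) = card {e' \<in> ?X. d e' = i}"
          using e f \<open>j \<noteq> i\<close> finE by (intro card_exchange) (auto simp: j_def)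
        moreover have "card (insert e ({e' \<in> ?X. d e' = j} - {f})) = card {e' \<in> ?X. d e' = j}"
          using e f \<open>j \<noteq> i\<close> finE by (intro card_exchange) (auto simp: j_def)
        ultimately have "card {e' \<in> ?X. d' e' = l} = card {e' \<in> ?X. d e' = l}" by simp
        then show "card {e' \<in> ?X. d' e' = l} = r - card (?A l)" using dX[OF l] by simp
      qed
      then have le: "card (bad d) \<le> card (bad d')" by (rule least)
      have "i \<notin> bad d'"
      proof
        assume "i \<in> bad d'"
        then obtain Q where Q0: "\<forall>e'\<in>color_class E d' i. fst e' = Q" unfolding bad_def by blast
        have Q: "fst e' = Q" if "e' \<in> insert f (color_class E d i - {e})" for e'
          by (rule bspec[OF Q0]) (use that cl[of i] in simp)
        have "card (color_class E d i - {e}) = r - 1"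
          using card_class[OF i(1)] i e cls_D(1) by (subst card_Diff_singleton) (auto simp: mem_color_class)
        then have "color_class E d i - {e} \<noteq> {}" using r by (metis One_nat_def card.empty diff_is_0_eq not_less_eq_eq numeral_2_eq_2)
        then obtain g where "g \<in> color_class E d i - {e}" by blast
        then show False using P[of g] Q[of g] Q[of f] f by auto
      qed
      have "j \<in> bad d'"
      proof (rule ccontr)
        assume "j \<notin> bad d'"
        have "l \<in> bad d - {i}" if "l \<in> bad d'" for l
        proof -
          have "l \<noteq> i" "l \<noteq> j" using that \<open>i \<notin> bad d'\<close> \<open>j \<notin> bad d'\<close> by auto
          then show ?thesis using that cl[of l] by (simp add: bad_def)
        qed
        then have "bad d' \<subseteq> bad d - {i}" by blast
        then have "card (bad d') \<le> card (bad d - {i})" using fin_bad by (intro card_mono) auto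
        then show False using le ibad card_Diff1_less[OF fin_bad ibad] by linarith
      qed
      then obtain Q where j: "j \<in> {1..k}" and Q0: "\<forall>e'\<in>color_class E d' j. fst e' = Q"
        unfolding bad_def by blast
      have Q: "fst e' = Q" if "e' \<in> insert e (color_class E d j - {f})" for e'
        by (rule bspec[OF Q0]) (use that cl[of j] \<open>j \<noteq> i\<close> in simp)
      then have "Q = P" using eP by blast
      moreover have "?A j \<subseteq> color_class E d j - {f}" using f split[of j] by (auto simp: mem_color_class)
      ultimately show ?thesis using Q j short[OF j f(1)] \<open>j \<noteq> i\<close> unfolding j_def by blast
    qed
    \<comment> \<open>By \<open>key\<close>, a color contains at most one extra edge that is not
      parallel to \<open>P\<close>. So all these edges have different colors in \<open>?T\<close>,
      none of them \<open>i\<close>, and there are fewer of them than \<open>par\<close>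
      demands.\<close>
    have "inj_on d {f \<in> ?X. fst f \<noteq> P}"
    proof (rule inj_onI)
      fix f g assume fg: "f \<in> {f \<in> ?X. fst f \<noteq> P}" "g \<in> {f \<in> ?X. fst f \<noteq> P}" "d f = d g"
      show "f = g"
      proof (rule ccontr)
        assume "f \<noteq> g"
        then have "g \<in> color_class E d (d f) - {f}" using fg by (auto simp: mem_color_class)
        then show False using key[of f] fg by blast
      qed
    qed
    moreover have "d ` {f \<in> ?X. fst f \<noteq> P} \<subseteq> ?T - {i}" using key by blast
    ultimately have "card {f \<in> ?X. fst f \<noteq> P} \<le> card (?T - {i})" by (rule card_inj_on_le) simp
    also have "\<dots> < card ?T"
    proof (rule card_Diff1_less)
      have "?A i \<subseteq> color_class E d i" using split[of i] by blast
      then show "i \<in> ?T" using i P by blast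
    qed simp
    also have "\<dots> \<le> card {f \<in> ?X. fst f \<noteq> P}" using par[OF uvn uv(2)] unfolding uv(1) .
    finally show False by simp
  qed
  have "valid d" unfolding valid_def
  proof (intro conjI ballI)
    fix e assume "e \<in> E" then show "d e \<le> k" by (rule dk)
  next
    fix i assume i: "i \<in> {1..k}"
    show "r \<le> card (color_class E d i)" using card_class[OF i] by simp
    show "extendable r {..<n} (color_class E d i)"
    proof (cases "card (?A i) < r")
      case True
      then have card_r: "card (color_class E d i) = r" using card_class[OF i] by simp
      show ?thesis
      proof (rule extendable_small)
        fix u v :: nat assume "u \<noteq> v"
        show "inner (color_class E d i) {u, v} < r"
        proof (rule ccontr)
          assume "\<not> ?thesis"
          then have "card {e \<in> color_class E d i. fst e \<subseteq> {u, v}} \<ge> card (color_class E d i)"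
            using card_r by (simp add: inner_def)
          then have "{e \<in> color_class E d i. fst e \<subseteq> {u, v}} = color_class E d i"
            using cls_D(1)[of d i] by (intro card_seteq) auto
          then have "fst e = {u, v}" if "e \<in> color_class E d i" for e
            using that cls_D(3)[OF that] \<open>u \<noteq> v\<close> by (intro card_subset_eq) auto
          then have "i \<in> bad d" using i True unfolding bad_def by blast
          then show False using no_bad by simp
        qed
      qed (use cls card_r r in auto)
    next
      case False
      have "{e \<in> ?X. d e = i} = {}" using short[OF i] False by blast
      then have "color_class E d i = ?A i" unfolding split by (simp only: Un_empty_right)
      then show ?thesis using ext[OF i] by simp
    qed
  qed
  then show ?thesis using dE0 by blast
qed
end

section \<open>Adding the missing vertices\<close>

lemma card_SIGMA_fst: "card {x \<in> (SIGMA i : I. B i). fst x = i} = (if i \<in> I then card (B i) else 0)"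
proof -
  have "{x \<in> (SIGMA i : I. B i). fst x = i} = (if i \<in> I then Pair i ` B i else {})" by auto
  then show ?thesis by (simp add: card_image inj_on_def)
qed

lemma inner_empty:
  assumes "\<And>e. e \<in> F \<Longrightarrow> card (fst e) = 2"
  shows "inner F {} = 0"
proof -
  have "fst e \<noteq> {}" if "e \<in> F" for e using assms[OF that] by auto
  then have "{e \<in> F. fst e \<subseteq> {}} = {}" by blast
  then show ?thesis unfolding inner_def by (simp only: card.empty)
qed

lemma edges_on_whole:
  assumes "edges_on F V"
  shows "cut F V = 0" "inner F V = card F"
proof -
  have "{e \<in> F. fst e \<inter> V \<noteq> {} \<and> \<not> fst e \<subseteq> V} = {}" using edges_onD(2)[OF assms] by blast
  then show "cut F V = 0" unfolding cut_def by (simp only: card.empty)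
  have "{e \<in> F. fst e \<subseteq> V} = F" using edges_onD(2)[OF assms] by blast
  then show "inner F V = card F" by (simp add: inner_def)
qed

text \<open>The elements of \<open>J\<close> turn into the edges at the new vertex \<open>p\<close>,
  where \<open>\<nu>\<close> gives the other end and \<open>\<kappa>\<close> the color. The
  \<open>mu\<close> elements with a common end are numbered arbitrarily to obtain the labels; from
  then on only the listed counts matter.\<close>

lemma add_vertex:
  fixes J :: "'x set" and \<kappa> \<nu> :: "'x \<Rightarrow> nat" and mu :: nat
  defines "F' \<equiv> \<lambda>c p i. color_class (edges (complete_mgraph mu p)) c i"
  assumes J: "finite J" "\<And>x. x \<in> J \<Longrightarrow> \<nu> x < p" "\<And>v. v < p \<Longrightarrow> card {x \<in> J. \<nu> x = v} = mu"
  shows "\<exists>c'. (\<forall>e\<in>edges (complete_mgraph mu p). c' e = c e) \<and>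
    (\<forall>e\<in>edges (complete_mgraph mu (Suc p)) - edges (complete_mgraph mu p). c' e \<in> \<kappa> ` J) \<and>
    (\<forall>i. card (F' c' (Suc p) i) = card (F' c p i) + card {x \<in> J. \<kappa> x = i} \<and>
      (\<forall>v<p. deg (F' c' (Suc p) i) v = deg (F' c p i) v + card {x \<in> J. \<kappa> x = i \<and> \<nu> x = v}) \<and>
      deg (F' c' (Suc p) i) p = card {x \<in> J. \<kappa> x = i} \<and>
      (\<forall>S. S \<subseteq> {..<p} \<longrightarrow> inner (F' c' (Suc p) i) S = inner (F' c p i) S \<and>
        inner (F' c' (Suc p) i) (insert p S) =
          inner (F' c p i) S + card {x \<in> J. \<kappa> x = i \<and> \<nu> x \<in> S}))"
proof -
  let ?E = "edges (complete_mgraph mu p)" and ?E' = "edges (complete_mgraph mu (Suc p))"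
  have "\<forall>v. \<exists>f. v < p \<longrightarrow> bij_betw f {x \<in> J. \<nu> x = v} {..<mu}"
  proof
    fix v
    show "\<exists>f. v < p \<longrightarrow> bij_betw f {x \<in> J. \<nu> x = v} {..<mu}"
      using J(1) J(3)[of v] ex_bij_betw_finite_nat[of "{x \<in> J. \<nu> x = v}"]
      by (cases "v < p") (auto simp: atLeast0LessThan)
  qed
  then obtain idx where idx: "\<And>v. v < p \<Longrightarrow> bij_betw (idx v) {x \<in> J. \<nu> x = v} {..<mu}" by metis
  define \<psi> where "\<psi> x = ({\<nu> x, p}, idx (\<nu> x) x)" for x
  have inj: "inj_on \<psi> J"
  proof (rule inj_onI)
    fix x y assume xy: "x \<in> J" "y \<in> J" "\<psi> x = \<psi> y"
    then have "\<nu> x = \<nu> y" using J(2)[of x] J(2)[of y] by (auto simp: \<psi>_def doubleton_eq_iff)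
    then show "x = y"
      using xy idx[OF J(2)[OF xy(1)]] by (auto simp: \<psi>_def bij_betw_def inj_on_def)
  qed
  have new: "?E' = ?E \<union> \<psi> ` J"
  proof (intro equalityI subsetI)
    fix e assume e: "e \<in> ?E'"
    show "e \<in> ?E \<union> \<psi> ` J"
    proof (cases "p \<in> fst e")
      case True
      obtain a b where ab: "fst e = {a, b}" "a \<noteq> b"
        using e by (auto simp: mem_complete_mgraph card_2_iff)
      then obtain v where v: "fst e = {v, p}" "v \<noteq> p" using True by auto
      have "v < p" using e v by (auto simp: mem_complete_mgraph)
      moreover have "snd e \<in> {..<mu}" using e by (simp add: mem_complete_mgraph)
      ultimately have "snd e \<in> idx v ` {x \<in> J. \<nu> x = v}"
        using idx[of v] by (simp add: bij_betw_def)
      then obtain x where "x \<in> J" "\<nu> x = v" "idx v x = snd e" by auto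
      then have "\<psi> x = e" "x \<in> J" using v by (auto simp: \<psi>_def prod_eq_iff)
      then show ?thesis by blast
    next
      case False
      then have "fst e \<subseteq> {..<p}" using e by (auto simp: mem_complete_mgraph less_Suc_eq)
      then show ?thesis using e by (simp add: mem_complete_mgraph)
    qed
  next
    fix e assume "e \<in> ?E \<union> \<psi> ` J"
    then show "e \<in> ?E'"
    proof
      assume "e \<in> ?E" then show ?thesis by (auto simp: mem_complete_mgraph)
    next
      assume "e \<in> \<psi> ` J"
      then obtain x where x: "x \<in> J" "e = \<psi> x" by blast
      have "idx (\<nu> x) x \<in> {..<mu}" using idx[OF J(2)[OF x(1)]] x(1) by (auto simp: bij_betw_def)
      then show ?thesis using x J(2)[OF x(1)] by (auto simp: mem_complete_mgraph \<psi>_def)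
    qed
  qed
  have old: "e \<notin> \<psi> ` J" if "e \<in> ?E" for e
    using that by (auto simp: mem_complete_mgraph \<psi>_def)
  define c' where "c' e = (if e \<in> \<psi> ` J then \<kappa> (the_inv_into J \<psi> e) else c e)" for e
  have c'_new: "c' (\<psi> x) = \<kappa> x" if "x \<in> J" for x
    using that inj by (simp add: c'_def the_inv_into_f_f)
  have c'_old: "c' e = c e" if "e \<in> ?E" for e using old[OF that] by (simp add: c'_def)
  have cl: "F' c' (Suc p) i = F' c p i \<union> \<psi> ` {x \<in> J. \<kappa> x = i}" for i
    unfolding F'_def color_class_def new using c'_new c'_old by auto
  have finF: "finite (F' c p i)" for i
    unfolding F'_def by (rule finite_subset[OF color_class_subset finite_complete])
  have count: "card {e \<in> F' c' (Suc p) i. Q e} =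
      card {e \<in> F' c p i. Q e} + card {x \<in> J. \<kappa> x = i \<and> Q (\<psi> x)}" for i Q
  proof -
    have "{e \<in> F' c' (Suc p) i. Q e} = {e \<in> F' c p i. Q e} \<union> \<psi> ` {x \<in> J. \<kappa> x = i \<and> Q (\<psi> x)}"
      unfolding cl by auto
    also have "card \<dots> = card {e \<in> F' c p i. Q e} + card (\<psi> ` {x \<in> J. \<kappa> x = i \<and> Q (\<psi> x)})"
    proof (intro card_Un_disjoint)
      show "finite {e \<in> F' c p i. Q e}" using finF by simp
      show "{e \<in> F' c p i. Q e} \<inter> \<psi> ` {x \<in> J. \<kappa> x = i \<and> Q (\<psi> x)} = {}"
        using old by (auto simp: F'_def color_class_def)
    qed (use J(1) in simp)
    also have "card (\<psi> ` {x \<in> J. \<kappa> x = i \<and> Q (\<psi> x)}) = card {x \<in> J. \<kappa> x = i \<and> Q (\<psi> x)}"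
      by (intro card_image inj_on_subset[OF inj]) auto
    finally show ?thesis .
  qed
  have F_sub: "fst e \<subseteq> {..<p}" if "e \<in> F' c p i" for e i
    using that by (auto simp: F'_def color_class_def mem_complete_mgraph)
  have fst_\<psi>: "fst (\<psi> x) = {\<nu> x, p}" for x by (simp add: \<psi>_def)
  show ?thesis
  proof (intro exI[of _ c'] conjI allI impI ballI)
    show "c' e = c e" if "e \<in> ?E" for e using that by (rule c'_old)
    show "c' e \<in> \<kappa> ` J" if "e \<in> ?E' - ?E" for e using that c'_new unfolding new by auto
  next
    fix i
    show "card (F' c' (Suc p) i) = card (F' c p i) + card {x \<in> J. \<kappa> x = i}"
      using count[of i "\<lambda>_. True"] by simp
    have "{x \<in> J. \<kappa> x = i \<and> p \<in> fst (\<psi> x)} = {x \<in> J. \<kappa> x = i}"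
      by (auto simp: fst_\<psi>)
    moreover have "{e \<in> F' c p i. p \<in> fst e} = {}" using F_sub by fastforce
    ultimately show "deg (F' c' (Suc p) i) p = card {x \<in> J. \<kappa> x = i}"
      unfolding deg_def count by (simp only: card.empty add_0)
  next
    fix i v assume "v < p"
    then have "{x \<in> J. \<kappa> x = i \<and> v \<in> fst (\<psi> x)} = {x \<in> J. \<kappa> x = i \<and> \<nu> x = v}"
      by (auto simp: fst_\<psi>)
    then show "deg (F' c' (Suc p) i) v = deg (F' c p i) v + card {x \<in> J. \<kappa> x = i \<and> \<nu> x = v}"
      unfolding deg_def count by simp
  next
    fix i S assume S: "S \<subseteq> {..<p}"
    then have "{x \<in> J. \<kappa> x = i \<and> fst (\<psi> x) \<subseteq> S} = {}" by (auto simp: fst_\<psi>)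
    then show "inner (F' c' (Suc p) i) S = inner (F' c p i) S"
      unfolding inner_def count by (simp only: card.empty)
    have "{x \<in> J. \<kappa> x = i \<and> fst (\<psi> x) \<subseteq> insert p S} = {x \<in> J. \<kappa> x = i \<and> \<nu> x \<in> S}"
      using J(2) by (auto simp: fst_\<psi>)
    moreover have "{e \<in> F' c p i. fst e \<subseteq> insert p S} = {e \<in> F' c p i. fst e \<subseteq> S}"
      using F_sub by blast
    ultimately show "inner (F' c' (Suc p) i) (insert p S) =
        inner (F' c p i) S + card {x \<in> J. \<kappa> x = i \<and> \<nu> x \<in> S}"
      unfolding inner_def count by simp
  qed
qed

text \<open>The final graph has \<open>2 * h\<close> vertices, where \<open>h = n - 1\<close>; so
  each color has \<open>r * h\<close> edges in the end.\<close>

locale detach_params =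
  fixes mu k r h :: nat
  assumes r: "2 \<le> r" and rk: "r * k = mu * (2 * h - 1)" and h: "2 \<le> h"
begin

abbreviation "K p \<equiv> edges (complete_mgraph mu p)"
abbreviation "F p c i \<equiv> color_class (K p) c i"

lemma on: "edges_on (F p c i) {..<p}"
  using edges_on_complete color_class_subset by (rule edges_on_subset)

text \<open>
  The last inequality says that the vertex into which the \<open>2 * h - p\<close> missing vertices are
  amalgamated carries \<open>loops p c i \<ge> 0\<close> loops of color \<open>i\<close>.
\<close>

definition outline :: "nat \<Rightarrow> (nat edge \<Rightarrow> nat) \<Rightarrow> bool" where
  "outline p c \<longleftrightarrow> (\<forall>e\<in>K p. c e \<in> {1..k}) \<and>
    (\<forall>i\<in>{1..k}. extendable r {..<p} (F p c i) \<and> r * p \<le> card (F p c i) + r * h)"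

text \<open>Of the final \<open>r * h\<close> edges of color \<open>i\<close>,
  \<open>card (F p c i)\<close> join old vertices and \<open>r * p - 2 * card (F p c i)\<close> join
  an old vertex to a missing one; the rest must become loops.\<close>

definition loops :: "nat \<Rightarrow> (nat edge \<Rightarrow> nat) \<Rightarrow> nat \<Rightarrow> nat" where
  "loops p c i = card (F p c i) + r * h - r * p"

lemma class_sum:
  assumes "\<And>e. e \<in> K p \<Longrightarrow> c e \<in> {1..k}"
  shows "(\<Sum>i\<in>{1..k}. card {e \<in> F p c i. Q e}) = card {e \<in> K p. Q e}"
proof -
  have "card {e \<in> K p. Q e} = (\<Sum>i\<in>{1..k}. card {e \<in> {e \<in> K p. Q e}. c e = i})"
    using assms finite_complete by (intro card_fibers) auto
  moreover have "{e \<in> {e \<in> K p. Q e}. c e = i} = {e \<in> F p c i. Q e}" for i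
    by (auto simp: color_class_def)
  ultimately show ?thesis by simp
qed

text \<open>This and the next two lemmas provide the divisibility by \<open>s = 2 * h - p\<close>
  that \<open>balanced_selection\<close> asks for. The amalgamated vertex stands for
  \<open>s\<close> vertices of degree \<open>r\<close> in each color, each joined to every old
  vertex by \<open>mu\<close> edges, with \<open>mu * s * (s - 1)\<close> edge ends among
  themselves.\<close>

lemma color_stubs:
  assumes c: "outline p c" and i: "i \<in> {1..k}" and p: "p \<le> 2 * h"
  shows "(\<Sum>v<p. r - deg (F p c i) v) + 2 * loops p c i = (2 * h - p) * r"
proof -
  have le: "deg (F p c i) v \<le> r" if "v < p" for v
    using c i that by (auto simp: outline_def extendable_def)
  have "(\<Sum>v<p. r - deg (F p c i) v) + (\<Sum>v<p. deg (F p c i) v) = (\<Sum>v<p. r)"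
    unfolding sum.distrib[symmetric] using le by (intro sum.cong) auto
  moreover have "(\<Sum>v<p. deg (F p c i) v) = 2 * card (F p c i)"
    using handshake[OF edges_onD(1,3)[OF on[of p c i]], of "{..<p}"] edges_on_whole[OF on[of p c i]]
    by simp
  moreover have "loops p c i + r * p = card (F p c i) + r * h"
    using c i by (simp add: loops_def outline_def)
  ultimately have "(\<Sum>v<p. r - deg (F p c i) v) + 2 * loops p c i + r * p = 2 * (r * h)"
    by (simp add: mult.commute)
  then show ?thesis using p by (simp add: diff_mult_distrib algebra_simps)
qed

lemma vertex_stubs:
  assumes c: "outline p c" and v: "v < p" and p: "p \<le> 2 * h"
  shows "(\<Sum>i\<in>{1..k}. r - deg (F p c i) v) = (2 * h - p) * mu"
proof -
  have le: "deg (F p c i) v \<le> r" if "i \<in> {1..k}" for i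
    using c v that by (auto simp: outline_def extendable_def)
  have "(\<Sum>i\<in>{1..k}. r - deg (F p c i) v) + (\<Sum>i\<in>{1..k}. deg (F p c i) v) = (\<Sum>i\<in>{1..k}. r)"
    unfolding sum.distrib[symmetric] using le by (intro sum.cong) auto
  moreover have "(\<Sum>i\<in>{1..k}. deg (F p c i) v) = mu * (p - 1)"
    using class_sum[of p c "\<lambda>e. v \<in> fst e"] c deg_complete[OF v, of mu]
    by (simp add: outline_def deg_def)
  moreover obtain q where "p = Suc q" using v by (cases p) auto
  ultimately have "(\<Sum>i\<in>{1..k}. r - deg (F p c i) v) + mu * q = mu * (2 * h - 1)"
    using rk by (simp add: mult.commute)
  moreover have "2 * h - 1 = (2 * h - p) + q" using p \<open>p = Suc q\<close> by simp
  then have "mu * (2 * h - 1) = (2 * h - p) * mu + mu * q" by (simp only: distrib_left mult.commute)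
  ultimately show ?thesis by linarith
qed

lemma loop_stubs:
  assumes c: "outline p c" and p: "p < 2 * h"
  shows "(\<Sum>i\<in>{1..k}. 2 * loops p c i) = (2 * h - p) * (mu * (2 * h - p - 1))"
proof -
  have "(\<Sum>i\<in>{1..k}. loops p c i) + (\<Sum>i\<in>{1..k}. r * p) =
      (\<Sum>i\<in>{1..k}. card (F p c i)) + (\<Sum>i\<in>{1..k}. r * h)"
    unfolding sum.distrib[symmetric] using c by (intro sum.cong) (auto simp: loops_def outline_def)
  moreover have "(\<Sum>i\<in>{1..k}. card (F p c i)) = (p choose 2) * mu"
    using class_sum[of p c "\<lambda>_. True"] c by (simp add: outline_def card_complete)
  ultimately have "(\<Sum>i\<in>{1..k}. loops p c i) + r * k * p = (p choose 2) * mu + r * k * h"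
    by (simp add: algebra_simps)
  then have "2 * (\<Sum>i\<in>{1..k}. loops p c i) + 2 * (mu * (2 * h - 1)) * p =
      2 * (p choose 2) * mu + 2 * (mu * (2 * h - 1)) * h"
    unfolding rk by simp
  moreover have "2 * (p choose 2) = p * (p - 1)"
  proof -
    have "even (p * (p - 1))" by (cases p) auto
    then show ?thesis by (simp add: choose_two)
  qed
  ultimately have *: "2 * (\<Sum>i\<in>{1..k}. loops p c i) + 2 * (mu * (2 * h - 1)) * p =
      p * (p - 1) * mu + 2 * (mu * (2 * h - 1)) * h" by simp
  obtain s where s: "2 * h = p + Suc s" using p by (metis less_imp_Suc_add add_Suc_right)
  have "2 * (mu * (2 * h - 1)) * h = mu * (2 * h - 1) * (2 * h)" by (simp only: ac_simps)
  then have h_eq: "2 * (mu * (2 * h - 1)) * h = mu * (p + s) * (p + Suc s)" using s by simp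
  have "2 * (\<Sum>i\<in>{1..k}. loops p c i) + 2 * (mu * (p + s)) * p =
      p * (p - 1) * mu + mu * (p + s) * (p + Suc s)"
    using * unfolding h_eq using s by simp
  then have "2 * (\<Sum>i\<in>{1..k}. loops p c i) = Suc s * (mu * s)"
    by (cases p) (simp_all add: algebra_simps)
  moreover have "2 * h - p = Suc s" using s by simp
  ultimately show ?thesis by (simp add: sum_distrib_left)
qed

text \<open>
  A half-edge at the amalgamated vertex is a triple of its color, the vertex at which the edge ends
  and a counter; \<open>p\<close> as vertex marks the halves of loops, where \<open>2 * q\<close> and \<open>2 * q + 1\<close> belong to the
  same loop.
\<close>

definition halves :: "nat \<Rightarrow> (nat edge \<Rightarrow> nat) \<Rightarrow> (nat \<times> nat \<times> nat) set" where
  "halves p c = (SIGMA i : {1..k}. (stubs r (F p c i) {..<p} \<union> {p} \<times> {..<2 * loops p c i}))"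

lemma finite_halves: "finite (halves p c)"
  by (simp add: halves_def finite_stubs)

lemma halves_color:
  assumes "i \<in> {1..k}"
  shows "card {x \<in> halves p c. fst x = i} = (\<Sum>v<p. r - deg (F p c i) v) + 2 * loops p c i"
proof -
  have "card (stubs r (F p c i) {..<p} \<union> {p} \<times> {..<2 * loops p c i}) =
      card (stubs r (F p c i) {..<p}) + card ({p} \<times> {..<2 * loops p c i})"
    by (intro card_Un_disjoint) (auto simp: finite_stubs stubs_def)
  then show ?thesis
    unfolding halves_def card_SIGMA_fst using assms by (simp add: stubs_def card_cartesian_product)
qed

lemma halves_vertex:
  assumes "v \<le> p"
  shows "card {x \<in> halves p c. fst (snd x) = v} =
    (\<Sum>i\<in>{1..k}. if v < p then r - deg (F p c i) v else 2 * loops p c i)"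
proof -
  have "{x \<in> halves p c. fst (snd x) = v} = (SIGMA i : {1..k}.
      {v} \<times> {..<if v < p then r - deg (F p c i) v else 2 * loops p c i})"
    using assms unfolding halves_def stubs_def by (auto split: if_splits)
  then show ?thesis by (simp add: card_cartesian_product)
qed

text \<open>The blocks are the pairs of \<open>stub_pairs\<close> and the two halves of each loop;
  \<open>p + 2 \<le> 2 * h\<close> allows blocks of size 2. Since the halves of a loop are never
  both selected, the new vertex gets no loop, and at most as many loop halves move as there are
  loops.\<close>

lemma selection:
  assumes c: "outline p c" and p: "p + 2 \<le> 2 * h"
  shows "\<exists>J\<subseteq>halves p c. (\<forall>i\<in>{1..k}. card {x \<in> J. fst x = i} = r) \<and>
    (\<forall>v<p. card {x \<in> J. fst (snd x) = v} = mu) \<and>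
    (\<forall>i\<in>{1..k}. card {x \<in> J. fst x = i \<and> fst (snd x) = p} \<le> loops p c i) \<and>
    (\<forall>i\<in>{1..k}. \<forall>S. S \<subseteq> {..<p} \<and> S \<noteq> {} \<longrightarrow>
      2 * card {x \<in> J. fst x = i \<and> fst (snd x) \<in> S} + 2 * inner (F p c i) S + 2 \<le> r * card S + r)"
proof -
  let ?s = "2 * h - p"
  define fine where "fine i PP \<longleftrightarrow> disjoint PP \<and>
      (\<forall>P\<in>PP. P \<subseteq> stubs r (F p c i) {..<p} \<and> card P = 2) \<and>
      (\<forall>J. J \<subseteq> stubs r (F p c i) {..<p} \<and> card J \<le> r \<and> (\<forall>P\<in>PP. card (J \<inter> P) \<le> 1) \<longrightarrow>
        (\<forall>S. S \<subseteq> {..<p} \<and> S \<noteq> {} \<longrightarrow>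
          2 * card (J \<inter> stubs r (F p c i) S) + 2 * inner (F p c i) S + 2 \<le> r * card S + r))" for i PP
  have "\<exists>PP. fine i PP" if "i \<in> {1..k}" for i
    unfolding fine_def using c that by (intro stub_pairs[OF _ on _ r]) (auto simp: outline_def)
  then obtain PP where PP: "\<And>i. i \<in> {1..k} \<Longrightarrow> fine i (PP i)" by metis
  have PP_disj: "disjoint (PP i)" if "i \<in> {1..k}" for i using PP[OF that] by (simp add: fine_def)
  have PP_sub: "P \<subseteq> stubs r (F p c i) {..<p}" "card P = 2" if "i \<in> {1..k}" "P \<in> PP i" for i P
    using PP[OF that(1)] that(2) by (auto simp: fine_def)
  define Q1 where "Q1 = (\<Union>i\<in>{1..k}. (image (Pair i)) ` PP i)"
  define lp where "lp = (\<lambda>(i :: nat, q). {(i, p, 2 * q), (i, p, 2 * q + 1 :: nat)})"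
  define Q2 where "Q2 = lp ` (SIGMA i : {1..k}. {..<loops p c i})"
  have Q1_v: "fst (snd x) < p" if "P \<in> Q1" "x \<in> P" for P x
    using that PP_sub(1) unfolding Q1_def stubs_def by fastforce
  have Q1_D: "\<exists>i\<in>{1..k}. \<exists>P'\<in>PP i. P = Pair i ` P'" if "P \<in> Q1" for P
    using that unfolding Q1_def by blast
  have "disjoint (Q1 \<union> Q2)"
  proof (rule disjointI)
    fix P Q assume PQ: "P \<in> Q1 \<union> Q2" "Q \<in> Q1 \<union> Q2" "P \<noteq> Q"
    have 11: "P \<inter> Q = {}" if Q: "P \<in> Q1" "Q \<in> Q1"
    proof -
      obtain i P' j Q' where *: "i \<in> {1..k}" "P' \<in> PP i" "P = Pair i ` P'"
        "j \<in> {1..k}" "Q' \<in> PP j" "Q = Pair j ` Q'"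
        using Q1_D[OF Q(1)] Q1_D[OF Q(2)] by blast
      show "P \<inter> Q = {}"
      proof (cases "i = j")
        case True
        then have "P' \<inter> Q' = {}" using * PQ(3) disjointD[OF PP_disj[OF *(1)] *(2)] by blast
        then show ?thesis using * True by blast
      qed (use * in blast)
    qed
    have 12: "A \<inter> B = {}" if "A \<in> Q1" "B \<in> Q2" for A B
      using Q1_v[OF that(1)] that(2) unfolding Q2_def lp_def by fastforce
    have 22: "P \<inter> Q = {}" if Q: "P \<in> Q2" "Q \<in> Q2"
    proof -
      obtain i q j q' where *: "P = lp (i, q)" "Q = lp (j, q')"
        using Q unfolding Q2_def by blast
      then have "(i, q) \<noteq> (j, q')" using PQ(3) by auto
      moreover have "2 * q \<noteq> 2 * q' + 1" "2 * q + 1 \<noteq> 2 * q'" by presburger+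
      ultimately show "P \<inter> Q = {}" unfolding * lp_def by auto
    qed
    show "P \<inter> Q = {}" using PQ(1,2) 11 12[of P Q] 12[of Q P] 22 by blast
  qed
  moreover have "P \<subseteq> halves p c \<and> card P \<le> ?s \<and> (\<exists>i. fst ` P \<subseteq> {i})" if "P \<in> Q1 \<union> Q2" for P
    using that
  proof
    assume "P \<in> Q1"
    then obtain i P' where *: "i \<in> {1..k}" "P' \<in> PP i" "P = Pair i ` P'"
      using Q1_D by blast
    have "card P = 2" using PP_sub(2)[OF *(1,2)] * by (simp add: card_image inj_on_def)
    moreover have "P \<subseteq> halves p c" using PP_sub(1)[OF *(1,2)] * unfolding halves_def by auto
    ultimately show ?thesis using * p by auto
  next
    assume "P \<in> Q2"
    then obtain i q where *: "i \<in> {1..k}" "q < loops p c i" "P = {(i, p, 2 * q), (i, p, 2 * q + 1)}"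
      unfolding Q2_def lp_def by blast
    then have "P \<subseteq> halves p c" unfolding halves_def by auto
    moreover have "card P \<le> 2" unfolding * by (simp add: card_insert_if)
    ultimately show ?thesis using * p by auto
  qed
  \<comment> \<open>\<open>mu * (?s - 1)\<close> is the number of edges between the new vertex and
    the vertices that are still missing.\<close>
  ultimately have "\<exists>J\<subseteq>halves p c. (\<forall>i\<in>{1..k}. card {x \<in> J. fst x = i} = r) \<and>
      (\<forall>v\<in>{..p}. card {x \<in> J. (fst \<circ> snd) x = v} = (if v < p then mu else mu * (?s - 1))) \<and>
      (\<forall>P\<in>Q1 \<union> Q2. card (J \<inter> P) \<le> 1)"
  proof (intro balanced_selection[where s = ?s])
    show "fst ` halves p c \<subseteq> {1..k}" "(fst \<circ> snd) ` halves p c \<subseteq> {..p}"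
      by (auto simp: halves_def stubs_def)
    show "card {x \<in> halves p c. fst x = i} = ?s * r" if "i \<in> {1..k}" for i
      using halves_color[OF that] color_stubs[OF c that] p by simp
    show "card {x \<in> halves p c. (fst \<circ> snd) x = v} = ?s * (if v < p then mu else mu * (?s - 1))"
      if "v \<in> {..p}" for v
      using halves_vertex[of v p c] vertex_stubs[OF c, of v] loop_stubs[OF c] that p by auto
  qed (use p finite_halves in auto)
  then obtain J where J: "J \<subseteq> halves p c" "\<forall>i\<in>{1..k}. card {x \<in> J. fst x = i} = r"
    "\<forall>v\<in>{..p}. card {x \<in> J. (fst \<circ> snd) x = v} = (if v < p then mu else mu * (?s - 1))"
    "\<forall>P\<in>Q1 \<union> Q2. card (J \<inter> P) \<le> 1" by (elim exE conjE)
  have finJ: "finite J" using J(1) finite_halves finite_subset by blast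
  show ?thesis
  proof (intro exI[of _ J] conjI ballI allI impI)
    show "J \<subseteq> halves p c" by (rule J(1))
    show "card {x \<in> J. fst x = i} = r" if "i \<in> {1..k}" for i using J(2) that by blast
    show "card {x \<in> J. fst (snd x) = v} = mu" if "v < p" for v using bspec[OF J(3), of v] that by simp
  next
    fix i assume i: "i \<in> {1..k}"
    let ?L = "{x \<in> J. fst x = i \<and> fst (snd x) = p}"
    have "inj_on (\<lambda>x. snd (snd x) div 2) ?L"
    proof (rule inj_onI, rule ccontr)
      fix x y assume x: "x \<in> ?L" and y: "y \<in> ?L" and eq: "snd (snd x) div 2 = snd (snd y) div 2"
        and ne: "x \<noteq> y"
      define q where "q = snd (snd x) div 2"
      have in_lp: "z \<in> lp (i, q)" if "z \<in> ?L" "snd (snd z) div 2 = q" for z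
      proof -
        have "z = (i, p, snd (snd z))" using that by (auto simp: prod_eq_iff)
        moreover have "snd (snd z) = 2 * q \<or> snd (snd z) = 2 * q + 1" using that(2) by presburger
        ultimately show ?thesis unfolding lp_def by (metis (no_types, lifting) case_prod_conv insertCI)
      qed
      have "x \<in> halves p c" using x J(1) by blast
      then have "snd (snd x) < 2 * loops p c i" using x by (auto simp: halves_def stubs_def)
      then have "q < loops p c i" unfolding q_def by simp
      then have "lp (i, q) \<in> Q2" unfolding Q2_def using i by blast
      then have "card (J \<inter> lp (i, q)) \<le> 1" using J(4) by blast
      moreover have "{x, y} \<subseteq> J \<inter> lp (i, q)" using in_lp x y eq q_def by auto
      then have "card {x, y} \<le> card (J \<inter> lp (i, q))" using finJ by (intro card_mono) auto
      ultimately show False using ne by simp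
    qed
    moreover have "(\<lambda>x. snd (snd x) div 2) ` ?L \<subseteq> {..<loops p c i}"
    proof
      fix q assume "q \<in> (\<lambda>x. snd (snd x) div 2) ` ?L"
      then obtain x where x: "x \<in> ?L" "q = snd (snd x) div 2" by blast
      then have "x \<in> halves p c" using J(1) by blast
      then have "snd (snd x) < 2 * loops p c i" using x(1) by (auto simp: halves_def stubs_def)
      then show "q \<in> {..<loops p c i}" using x(2) by simp
    qed
    ultimately show "card ?L \<le> loops p c i" using card_inj_on_le[of _ ?L "{..<loops p c i}"] by simp
  next
    fix i S assume i: "i \<in> {1..k}" and S: "S \<subseteq> {..<p} \<and> S \<noteq> {}"
    define Ji where "Ji = {y. (i, y) \<in> J \<and> fst y < p}"
    have Ji_halves: "y \<in> stubs r (F p c i) {..<p}" if "y \<in> Ji" for y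
      using that J(1) unfolding Ji_def halves_def by auto
    have finJi: "finite Ji"
      using Ji_halves finite_stubs[of "{..<p}"] finite_subset by (metis finite_lessThan subsetI)
    have "card Ji \<le> r"
    proof -
      have "card Ji = card (Pair i ` Ji)" by (simp add: card_image inj_on_def)
      also have "\<dots> \<le> card {x \<in> J. fst x = i}" using finJ by (intro card_mono) (auto simp: Ji_def)
      finally show ?thesis using J(2) i by simp
    qed
    moreover have "card (Ji \<inter> P) \<le> 1" if "P \<in> PP i" for P
    proof -
      have "card (Ji \<inter> P) = card (Pair i ` (Ji \<inter> P))" by (simp add: card_image inj_on_def)
      also have "\<dots> \<le> card (J \<inter> Pair i ` P)" using finJ by (intro card_mono) (auto simp: Ji_def)
      also have "Pair i ` P \<in> Q1" unfolding Q1_def using i that by blast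
      then have "card (J \<inter> Pair i ` P) \<le> 1" using J(4) by blast
      finally show ?thesis .
    qed
    ultimately have "2 * card (Ji \<inter> stubs r (F p c i) S) + 2 * inner (F p c i) S + 2 \<le> r * card S + r"
      using PP[OF i] Ji_halves S unfolding fine_def by (meson subsetI)
    moreover have "{x \<in> J. fst x = i \<and> fst (snd x) \<in> S} = Pair i ` (Ji \<inter> stubs r (F p c i) S)"
      using Ji_halves S by (auto simp: Ji_def stubs_def)
    ultimately show "2 * card {x \<in> J. fst x = i \<and> fst (snd x) \<in> S} + 2 * inner (F p c i) S + 2
        \<le> r * card S + r"
      by (simp add: card_image inj_on_def)
  qed
qed

lemma outline_step:
  assumes c: "outline p c" and p: "p + 2 \<le> 2 * h"
  shows "\<exists>c'. outline (Suc p) c' \<and> (\<forall>e\<in>K p. c' e = c e)"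
proof -
  obtain J where J: "J \<subseteq> halves p c" "\<forall>i\<in>{1..k}. card {x \<in> J. fst x = i} = r"
    "\<forall>v<p. card {x \<in> J. fst (snd x) = v} = mu"
    "\<forall>i\<in>{1..k}. card {x \<in> J. fst x = i \<and> fst (snd x) = p} \<le> loops p c i"
    "\<forall>i\<in>{1..k}. \<forall>S. S \<subseteq> {..<p} \<and> S \<noteq> {} \<longrightarrow>
      2 * card {x \<in> J. fst x = i \<and> fst (snd x) \<in> S} + 2 * inner (F p c i) S + 2 \<le> r * card S + r"
    using selection[OF c p] by (elim exE conjE)
  have finJ: "finite J" using J(1) finite_halves finite_subset by blast
  \<comment> \<open>Only half-edges that end at an old vertex become edges now. The selected halves
    of loops become stubs of \<open>p\<close>, which join it to the remaining amalgamated
    vertex.\<close>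
  let ?J = "{x \<in> J. fst (snd x) < p}"
  have Jv: "{x \<in> ?J. fst (snd x) = v} = {x \<in> J. fst (snd x) = v}" if "v < p" for v using that by auto
  have Js: "{x \<in> ?J. fst x = i \<and> fst (snd x) \<in> S} = {x \<in> J. fst x = i \<and> fst (snd x) \<in> S}"
    if "S \<subseteq> {..<p}" for i S using that by auto
  have Jc: "card {x \<in> ?J. fst x = i} + card {x \<in> J. fst x = i \<and> fst (snd x) = p} = r"
    if "i \<in> {1..k}" for i
  proof -
    have "fst (snd x) \<le> p" if "x \<in> J" for x using that J(1) by (auto simp: halves_def stubs_def)
    then have un: "{x \<in> J. fst x = i} = {x \<in> ?J. fst x = i} \<union> {x \<in> J. fst x = i \<and> fst (snd x) = p}"
      by (auto simp: le_less)
    have "card ({x \<in> ?J. fst x = i} \<union> {x \<in> J. fst x = i \<and> fst (snd x) = p}) =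
        card {x \<in> ?J. fst x = i} + card {x \<in> J. fst x = i \<and> fst (snd x) = p}"
      using finJ by (intro card_Un_disjoint) auto
    moreover have "card {x \<in> J. fst x = i} = r" using J(2) that by blast
    ultimately show ?thesis unfolding un by (rule trans[OF sym])
  qed
  have "\<exists>c'. (\<forall>e\<in>K p. c' e = c e) \<and> (\<forall>e\<in>K (Suc p) - K p. c' e \<in> fst ` ?J) \<and>
    (\<forall>i. card (F (Suc p) c' i) = card (F p c i) + card {x \<in> ?J. fst x = i} \<and>
      (\<forall>v<p. deg (F (Suc p) c' i) v = deg (F p c i) v + card {x \<in> ?J. fst x = i \<and> fst (snd x) = v}) \<and>
      deg (F (Suc p) c' i) p = card {x \<in> ?J. fst x = i} \<and>
      (\<forall>S. S \<subseteq> {..<p} \<longrightarrow> inner (F (Suc p) c' i) S = inner (F p c i) S \<and>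
        inner (F (Suc p) c' i) (insert p S) =
          inner (F p c i) S + card {x \<in> ?J. fst x = i \<and> fst (snd x) \<in> S}))"
  proof (intro add_vertex)
    show "card {x \<in> ?J. fst (snd x) = v} = mu" if "v < p" for v
      unfolding Jv[OF that] using J(3) that by blast
  qed (use finJ in auto)
  then obtain c' where old: "\<forall>e\<in>K p. c' e = c e" and new: "\<forall>e\<in>K (Suc p) - K p. c' e \<in> fst ` ?J"
    and all: "\<forall>i. card (F (Suc p) c' i) = card (F p c i) + card {x \<in> ?J. fst x = i} \<and>
      (\<forall>v<p. deg (F (Suc p) c' i) v = deg (F p c i) v + card {x \<in> ?J. fst x = i \<and> fst (snd x) = v}) \<and>
      deg (F (Suc p) c' i) p = card {x \<in> ?J. fst x = i} \<and>
      (\<forall>S. S \<subseteq> {..<p} \<longrightarrow> inner (F (Suc p) c' i) S = inner (F p c i) S \<and>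
        inner (F (Suc p) c' i) (insert p S) =
          inner (F p c i) S + card {x \<in> ?J. fst x = i \<and> fst (snd x) \<in> S})"
    by (elim exE conjE)
  have "outline (Suc p) c'" unfolding outline_def
  proof (intro conjI ballI)
    fix e assume "e \<in> K (Suc p)"
    show "c' e \<in> {1..k}"
    proof (cases "e \<in> K p")
      case True
      then show ?thesis using old c by (simp add: outline_def)
    next
      case False
      then have "c' e \<in> fst ` ?J" using new \<open>e \<in> K (Suc p)\<close> by blast
      then show ?thesis using J(1) by (auto simp: halves_def)
    qed
  next
    fix i assume i: "i \<in> {1..k}"
    have ext: "extendable r {..<p} (F p c i)" and lo: "r * p \<le> card (F p c i) + r * h"
      using c i by (auto simp: outline_def)
    have cl: "card {x \<in> J. fst x = i \<and> fst (snd x) = p} \<le> loops p c i" using J(4) i by blast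
    \<comment> \<open>Each selected half uses up one loop, so the number of remaining loops stays
      nonnegative.\<close>
    show "r * Suc p \<le> card (F (Suc p) c' i) + r * h"
      using all[rule_format, of i] Jc[OF i] cl lo unfolding loops_def by auto
    show "extendable r {..<Suc p} (F (Suc p) c' i)" unfolding extendable_def
    proof (intro conjI ballI allI impI)
      fix v assume "v \<in> {..<Suc p}"
      then consider "v < p" | "v = p" by force
      then show "deg (F (Suc p) c' i) v \<le> r"
      proof cases
        case 1
        have "{x \<in> ?J. fst x = i \<and> fst (snd x) = v} \<subseteq> (\<lambda>t. (i, v, t)) ` {..<r - deg (F p c i) v}"
          using J(1) 1 by (auto simp: halves_def stubs_def)
        then have "card {x \<in> ?J. fst x = i \<and> fst (snd x) = v} \<le> r - deg (F p c i) v"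
          using surj_card_le[of "{..<r - deg (F p c i) v}"] by simp
        then show ?thesis
          using all[rule_format, of i] 1 extendableD(1)[OF ext, of v] by simp
      next
        case 2
        then show ?thesis using all[rule_format, of i] Jc[OF i] by simp
      qed
    next
      fix S assume S: "S \<subseteq> {..<Suc p} \<and> S \<noteq> {}"
      have all_S: "inner (F (Suc p) c' i) T = inner (F p c i) T \<and>
        inner (F (Suc p) c' i) (insert p T) =
          inner (F p c i) T + card {x \<in> ?J. fst x = i \<and> fst (snd x) \<in> T}" if "T \<subseteq> {..<p}" for T
        using all[rule_format, of i] that by blast
      show "2 * inner (F (Suc p) c' i) S + 2 \<le> r * card S"
      proof (cases "p \<in> S")
        case False
        then have "S \<subseteq> {..<p}" using S by (auto simp: less_Suc_eq)
        then show ?thesis using all_S extendableD(2)[OF ext] S by simp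
      next
        case True
        define T where "T = S - {p}"
        have T: "S = insert p T" "T \<subseteq> {..<p}" "p \<notin> T" using True S by (auto simp: T_def less_Suc_eq)
        then have "finite T" using finite_subset by blast
        show ?thesis
        proof (cases "T = {}")
          case True
          then show ?thesis
            using all_S[of "{}"] inner_empty[OF edges_onD(3)[OF on[of p c i]]] r T by simp
        next
          case False
          \<comment> \<open>As \<open>r * card T + r = r * card S\<close>, this is the bound wanted
            for \<open>S = insert p T\<close>.\<close>
          then have "2 * card {x \<in> J. fst x = i \<and> fst (snd x) \<in> T} + 2 * inner (F p c i) T + 2
              \<le> r * card T + r" using J(5) i T(2) by blast
          then show ?thesis
            using all_S[OF T(2)] Js[OF T(2)] T(1,3) \<open>finite T\<close> by simp
        qed
      qed
    qed
  qed
  then show ?thesis using old by blast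
qed

text \<open>Only one vertex is missing, so it is the amalgamated vertex itself: there are no loops
  by \<open>loop_stubs\<close>, all half-edges become edges, and nothing has to be selected. For
  sets without \<open>p\<close>, extendability now is the cut condition; sets with \<open>p\<close>
  are handled by complements.\<close>

lemma outline_last:
  assumes c: "outline p c" and p: "p + 1 = 2 * h"
  shows "\<exists>c'. (\<forall>e\<in>K (2 * h). c' e \<in> {1..k}) \<and> (\<forall>e\<in>K p. c' e = c e) \<and>
    (\<forall>i\<in>{1..k}. (\<forall>v<2 * h. deg (F (2 * h) c' i) v = r) \<and>
      (\<forall>S. S \<subseteq> {..<2 * h} \<and> S \<noteq> {} \<and> S \<noteq> {..<2 * h} \<longrightarrow> 2 \<le> cut (F (2 * h) c' i) S))"
proof -
  have s: "2 * h - p = 1" "p < 2 * h" "Suc p = 2 * h" using p by simp_all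
  have no_loops: "loops p c i = 0" if "i \<in> {1..k}" for i
    using loop_stubs[OF c s(2)] that by (auto simp: s(1))
  let ?J = "halves p c"
  have Jp: "fst (snd x) < p" if "x \<in> ?J" for x
    using that no_loops by (auto simp: halves_def stubs_def)
  have "\<exists>c'. (\<forall>e\<in>K p. c' e = c e) \<and> (\<forall>e\<in>K (Suc p) - K p. c' e \<in> fst ` ?J) \<and>
    (\<forall>i. card (F (Suc p) c' i) = card (F p c i) + card {x \<in> ?J. fst x = i} \<and>
      (\<forall>v<p. deg (F (Suc p) c' i) v = deg (F p c i) v + card {x \<in> ?J. fst x = i \<and> fst (snd x) = v}) \<and>
      deg (F (Suc p) c' i) p = card {x \<in> ?J. fst x = i} \<and>
      (\<forall>S. S \<subseteq> {..<p} \<longrightarrow> inner (F (Suc p) c' i) S = inner (F p c i) S \<and>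
        inner (F (Suc p) c' i) (insert p S) =
          inner (F p c i) S + card {x \<in> ?J. fst x = i \<and> fst (snd x) \<in> S}))"
  proof (intro add_vertex)
    show "card {x \<in> ?J. fst (snd x) = v} = mu" if "v < p" for v
      using halves_vertex[of v p c] vertex_stubs[OF c that] that s by simp
  qed (use finite_halves Jp in auto)
  then obtain c' where old: "\<forall>e\<in>K p. c' e = c e" and new: "\<forall>e\<in>K (Suc p) - K p. c' e \<in> fst ` ?J"
    and all: "\<forall>i. card (F (Suc p) c' i) = card (F p c i) + card {x \<in> ?J. fst x = i} \<and>
      (\<forall>v<p. deg (F (Suc p) c' i) v = deg (F p c i) v + card {x \<in> ?J. fst x = i \<and> fst (snd x) = v}) \<and>
      deg (F (Suc p) c' i) p = card {x \<in> ?J. fst x = i} \<and>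
      (\<forall>S. S \<subseteq> {..<p} \<longrightarrow> inner (F (Suc p) c' i) S = inner (F p c i) S \<and>
        inner (F (Suc p) c' i) (insert p S) =
          inner (F p c i) S + card {x \<in> ?J. fst x = i \<and> fst (snd x) \<in> S})"
    by (elim exE conjE)
  show ?thesis unfolding s(3)[symmetric]
  proof (intro exI[of _ c'] conjI ballI allI impI)
    show "c' e = c e" if "e \<in> K p" for e using old that by blast
    fix e assume "e \<in> K (Suc p)"
    show "c' e \<in> {1..k}"
    proof (cases "e \<in> K p")
      case True
      then show ?thesis using old c by (simp add: outline_def)
    next
      case False
      then have "c' e \<in> fst ` ?J" using new \<open>e \<in> K (Suc p)\<close> by blast
      then show ?thesis by (auto simp: halves_def)
    qed
  next
    fix i assume i: "i \<in> {1..k}"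
    have ext: "extendable r {..<p} (F p c i)" using c i by (auto simp: outline_def)
    have reg: "deg (F (Suc p) c' i) v = r" if "v < Suc p" for v
    proof (cases "v = p")
      case True
      then show ?thesis
        using all[rule_format, of i] halves_color[OF i, of p c] color_stubs[OF c i] s by simp
    next
      case False
      then have "v < p" using that by simp
      have "{x \<in> ?J. fst x = i \<and> fst (snd x) = v} = (\<lambda>t. (i, v, t)) ` {..<r - deg (F p c i) v}"
        using i \<open>v < p\<close> by (auto simp: halves_def stubs_def)
      then have "card {x \<in> ?J. fst x = i \<and> fst (snd x) = v} = r - deg (F p c i) v"
        by (simp add: card_image inj_on_def)
      then show ?thesis
        using all[rule_format, of i] \<open>v < p\<close> extendableD(1)[OF ext, of v] by simp
    qed
    show "deg (F (Suc p) c' i) v = r" if "v < Suc p" for v using that by (rule reg)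
    note F' = edges_onD[OF on[of "Suc p" c' i]]
    have main: "2 \<le> cut (F (Suc p) c' i) T" if T: "T \<subseteq> {..<p}" "T \<noteq> {}" for T
    proof -
      have "finite T" using T finite_subset by blast
      have "(\<Sum>v\<in>T. deg (F (Suc p) c' i) v) = (\<Sum>v\<in>T. r)"
        using T reg by (intro sum.cong) auto
      then have "r * card T = 2 * inner (F (Suc p) c' i) T + cut (F (Suc p) c' i) T"
        using handshake[OF F'(1,3) \<open>finite T\<close>] by (simp add: mult.commute)
      moreover have "inner (F (Suc p) c' i) T = inner (F p c i) T" using all T by blast
      ultimately show ?thesis using extendableD(2)[OF ext T] by simp
    qed
    fix S assume S: "S \<subseteq> {..<Suc p} \<and> S \<noteq> {} \<and> S \<noteq> {..<Suc p}"
    show "2 \<le> cut (F (Suc p) c' i) S"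
    proof (cases "p \<in> S")
      case True
      have "cut (F (Suc p) c' i) ({..<Suc p} - S) = cut (F (Suc p) c' i) S"
        using F'(1) edges_on_whole(1)[OF on] S by (intro cut_complement) auto
      moreover have "{..<Suc p} - S \<subseteq> {..<p}" "{..<Suc p} - S \<noteq> {}"
        using True S by (auto simp: less_Suc_eq)
      ultimately show ?thesis using main by metis
    next
      case False
      then show ?thesis using S by (intro main) (auto simp: less_Suc_eq)
    qed
  qed
qed

theorem outline_extends:
  assumes c: "outline p c" and p: "p + 1 \<le> 2 * h"
  shows "\<exists>c'. (\<forall>e\<in>K (2 * h). c' e \<in> {1..k}) \<and> (\<forall>e\<in>K p. c' e = c e) \<and>
    (\<forall>i\<in>{1..k}. (\<forall>v<2 * h. deg (F (2 * h) c' i) v = r) \<and>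
      (\<forall>S. S \<subseteq> {..<2 * h} \<and> S \<noteq> {} \<and> S \<noteq> {..<2 * h} \<longrightarrow> 2 \<le> cut (F (2 * h) c' i) S))"
  using assms
proof (induction "2 * h - p" arbitrary: p c rule: less_induct)
  case less
  show ?case
  proof (cases "p + 1 = 2 * h")
    case True
    then show ?thesis using less.prems outline_last by blast
  next
    case False
    then have p: "p + 2 \<le> 2 * h" using less.prems by simp
    obtain c' where c': "outline (Suc p) c'" "\<forall>e\<in>K p. c' e = c e"
      using outline_step[OF less.prems(1) p] by blast
    have sub: "K p \<subseteq> K (Suc p)"
      by (auto simp: mem_complete_mgraph) (metis lessThan_iff less_SucI subsetD)
    have "\<exists>c''. (\<forall>e\<in>K (2 * h). c'' e \<in> {1..k}) \<and> (\<forall>e\<in>K (Suc p). c'' e = c' e) \<and>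
      (\<forall>i\<in>{1..k}. (\<forall>v<2 * h. deg (F (2 * h) c'' i) v = r) \<and>
        (\<forall>S. S \<subseteq> {..<2 * h} \<and> S \<noteq> {} \<and> S \<noteq> {..<2 * h} \<longrightarrow> 2 \<le> cut (F (2 * h) c'' i) S))"
      using p by (intro less.hyps c'(1)) auto
    then obtain c'' where "\<forall>e\<in>K (2 * h). c'' e \<in> {1..k}" "\<forall>e\<in>K (Suc p). c'' e = c' e"
      "\<forall>i\<in>{1..k}. (\<forall>v<2 * h. deg (F (2 * h) c'' i) v = r) \<and>
        (\<forall>S. S \<subseteq> {..<2 * h} \<and> S \<noteq> {} \<and> S \<noteq> {..<2 * h} \<longrightarrow> 2 \<le> cut (F (2 * h) c'' i) S)"
      by (elim exE conjE)
    then show ?thesis using sub c'(2) by (intro exI[of _ c''] conjI) auto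
  qed
qed
end

section \<open>Components and cuts\<close>

lemma degree_eq_deg: "degree G v = deg (edges G) v"
  by (simp add: degree_def deg_def)

definition reach :: "'a mgraph \<Rightarrow> 'a \<Rightarrow> 'a set" where
  "reach G v = {u \<in> verts G. (adjacent G)\<^sup>*\<^sup>* v u}"

lemma components_reach: "components G = (\<lambda>v. induced_subgraph G (reach G v)) ` verts G"
  by (simp add: components_def reach_def)

lemma verts_induced [simp]: "verts (induced_subgraph G W) = W"
  by (simp add: induced_subgraph_def)

lemma verts_delete [simp]: "verts (delete_edge G e) = verts G"
  and edges_delete [simp]: "edges (delete_edge G e) = edges G - {e}"
  by (simp_all add: delete_edge_def)

lemma reach_self: "v \<in> verts G \<Longrightarrow> v \<in> reach G v"
  by (simp add: reach_def)

lemma reach_subset: "reach G v \<subseteq> verts G"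
  by (auto simp: reach_def)

lemma cut_reach:
  assumes "edges_on (edges G) (verts G)"
  shows "cut (edges G) (reach G v) = 0"
  unfolding cut_eq_0_iff[OF edges_onD(1)[OF assms]]
proof
  fix e assume e: "e \<in> edges G"
  obtain a b where ab: "fst e = {a, b}" using edges_onD(3)[OF assms e] by (auto simp: card_2_iff)
  have "a \<in> verts G" "b \<in> verts G" using edges_onD(2)[OF assms e] ab by auto
  moreover have "adjacent G a b" "adjacent G b a"
    unfolding adjacent_def using e ab by (auto simp: insert_commute intro!: bexI[OF _ e])
  ultimately show "fst e \<inter> reach G v = {} \<or> fst e \<subseteq> reach G v"
    unfolding ab reach_def by (auto intro: rtranclp.rtrancl_into_rtrancl)
qed

lemma reach_in_closed:
  assumes "finite (edges G)" "cut (edges G) S = 0" "v \<in> S"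
  shows "reach G v \<subseteq> S"
proof
  fix u assume "u \<in> reach G v"
  then have "(adjacent G)\<^sup>*\<^sup>* v u" by (simp add: reach_def)
  then show "u \<in> S"
  proof (induction rule: rtranclp_induct)
    case (step y z)
    then obtain e where e: "e \<in> edges G" "fst e = {y, z}" unfolding adjacent_def by blast
    then have "fst e \<inter> S = {} \<or> fst e \<subseteq> S" using assms(2) cut_eq_0_iff[OF assms(1)] by blast
    then show ?case using e step by auto
  qed (rule assms(3))
qed

lemma cut_delete: "finite F \<Longrightarrow> cut F S \<le> cut (F - {e}) S + 1"
proof -
  assume F: "finite F"
  let ?A = "{e \<in> F. fst e \<inter> S \<noteq> {} \<and> \<not> fst e \<subseteq> S}"
  have "{e' \<in> F - {e}. fst e' \<inter> S \<noteq> {} \<and> \<not> fst e' \<subseteq> S} = ?A - {e}" by blast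
  then show ?thesis unfolding cut_def using F card_Suc_Diff1[of ?A e]
    by (cases "e \<in> ?A") auto
qed

lemma connected_reach: "connected_graph G \<Longrightarrow> v \<in> verts G \<Longrightarrow> reach G v = verts G"
  by (auto simp: connected_graph_def reach_def)

lemma connected_by_cuts:
  assumes G: "edges_on (edges G) (verts G)" and "verts G \<noteq> {}"
    and cuts: "\<And>S. S \<subseteq> verts G \<Longrightarrow> S \<noteq> {} \<Longrightarrow> S \<noteq> verts G \<Longrightarrow> 1 \<le> cut (edges G) S"
  shows "connected_graph G"
proof -
  have "reach G v = verts G" if "v \<in> verts G" for v
    using cuts[OF reach_subset, of v] cut_reach[OF G, of v] reach_self[OF that] by force
  then show ?thesis using assms(2) unfolding connected_graph_def reach_def by blast
qed

lemma components_connected: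
  assumes "verts G \<noteq> {}" "\<And>v. v \<in> verts G \<Longrightarrow> reach G v = verts G"
  shows "card (components G) = 1"
proof -
  have "components G = {induced_subgraph G (verts G)}"
    unfolding components_reach using assms by auto
  then show ?thesis by simp
qed

text \<open>Deleting one edge lowers a cut by at most 1, so the graph stays connected and the number
  of components does not grow.\<close>

lemma two_edge_connected_by_cuts:
  assumes G: "edges_on (edges G) (verts G)" and ne: "verts G \<noteq> {}"
    and cuts: "\<And>S. S \<subseteq> verts G \<Longrightarrow> S \<noteq> {} \<Longrightarrow> S \<noteq> verts G \<Longrightarrow> 2 \<le> cut (edges G) S"
  shows "two_edge_connected G"
proof -
  have con: "connected_graph G" by (rule connected_by_cuts[OF G ne]) (drule (2) cuts, simp)
  have "card (components (delete_edge G e)) = 1" for e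
  proof (rule components_connected)
    fix v assume "v \<in> verts (delete_edge G e)"
    then have v: "v \<in> reach (delete_edge G e) v" by (rule reach_self)
    have "edges_on (edges (delete_edge G e)) (verts (delete_edge G e))"
      using edges_on_subset[OF G, of "edges G - {e}"] by auto
    then have "cut (edges G - {e}) (reach (delete_edge G e) v) = 0" using cut_reach by fastforce
    then have "cut (edges G) (reach (delete_edge G e) v) \<le> 1"
      using cut_delete[OF edges_onD(1)[OF G], of "reach (delete_edge G e) v" e] by simp
    then show "reach (delete_edge G e) v = verts (delete_edge G e)"
      using cuts[of "reach (delete_edge G e) v"] v reach_subset[of "delete_edge G e" v] by force
  qed (use ne in simp)
  then show ?thesis
    unfolding two_edge_connected_def cutedge_def
    using con components_connected[OF ne connected_reach[OF con]] by simp
qed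

text \<open>Without \<open>e\<close> nothing leaves \<open>S\<close>, so the ends of
  \<open>e\<close> are in different components. Since \<open>cutedge\<close> compares numbers of
  components, two distinct ones are exhibited against the single one before.\<close>

lemma cutedge_if_single_cut:
  assumes G: "edges_on (edges G) (verts G)" and fin: "finite (verts G)" and con: "connected_graph G"
    and e: "{f \<in> edges G. fst f \<inter> S \<noteq> {} \<and> \<not> fst f \<subseteq> S} = {e}"
  shows "cutedge G e"
proof -
  let ?G = "delete_edge G e"
  have eG: "e \<in> edges G" using e by blast
  obtain a b where ab: "a \<in> fst e" "a \<in> S" "b \<in> fst e" "b \<notin> S" using e by blast
  then have V: "a \<in> verts G" "b \<in> verts G" using edges_onD(2)[OF G eG] by auto
  have "{f \<in> edges ?G. fst f \<inter> S \<noteq> {} \<and> \<not> fst f \<subseteq> S} = {}"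
    unfolding edges_delete using e by blast
  then have "cut (edges ?G) S = 0" unfolding cut_def by (simp only: card.empty)
  then have "reach ?G a \<subseteq> S" using edges_onD(1)[OF G] ab by (intro reach_in_closed) auto
  then have "reach ?G a \<noteq> reach ?G b" using ab V reach_self[of b ?G] by auto
  then have "induced_subgraph ?G (reach ?G a) \<noteq> induced_subgraph ?G (reach ?G b)"
    by (metis verts_induced)
  moreover have "{induced_subgraph ?G (reach ?G a), induced_subgraph ?G (reach ?G b)} \<subseteq> components ?G"
    unfolding components_reach using V by simp
  moreover have "finite (components ?G)" unfolding components_reach using fin by simp
  ultimately have "2 \<le> card (components ?G)" by (metis card_2_iff card_mono)
  moreover have "card (components G) = 1"
    using V connected_reach[OF con] by (intro components_connected) auto
  ultimately show ?thesis unfolding cutedge_def using eG by simp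
qed

lemma two_edge_connected_cuts:
  assumes G: "edges_on (edges G) (verts G)" "finite (verts G)" and "two_edge_connected G"
    and S: "S \<subseteq> verts G" "S \<noteq> {}" "S \<noteq> verts G"
  shows "2 \<le> cut (edges G) S"
proof (rule ccontr)
  have con: "connected_graph G" and no: "\<And>e. \<not> cutedge G e"
    using assms(3) by (auto simp: two_edge_connected_def)
  assume "\<not> ?thesis"
  then consider "cut (edges G) S = 0" | "cut (edges G) S = 1" by linarith
  then show False
  proof cases
    case 1
    obtain v where v: "v \<in> S" using S(2) by blast
    then have "reach G v \<subseteq> S" using edges_onD(1)[OF G(1)] 1 by (intro reach_in_closed)
    then show False using connected_reach[OF con, of v] v S by auto
  next
    case 2
    then obtain e where "{f \<in> edges G. fst f \<inter> S \<noteq> {} \<and> \<not> fst f \<subseteq> S} = {e}"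
      unfolding cut_def using card_1_singletonE by blast
    then show False using cutedge_if_single_cut[OF G con] no by blast
  qed
qed

section \<open>Admissibility as a condition on cuts\<close>

lemma component_cases:
  assumes "C \<in> components G"
  obtains v where "v \<in> verts G" "verts C = reach G v" "edges C = {e \<in> edges G. fst e \<subseteq> reach G v}"
  using assms unfolding components_reach induced_subgraph_def by auto

text \<open>This translates condition (2) of admissibility: the two stubs are at the same vertex or
  at two different ones.\<close>

lemma unsaturated_if_two_stubs:
  assumes "2 \<le> card (stubs r F S)"
  shows "(\<exists>v\<in>S. deg F v + 2 \<le> r) \<or> (\<exists>u\<in>S. \<exists>v\<in>S. u \<noteq> v \<and> deg F u + 1 \<le> r \<and> deg F v + 1 \<le> r)"
proof -
  obtain T where "T \<subseteq> stubs r F S" "card T = 2" using obtain_subset_with_card_n[OF assms] by metis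
  then obtain x y where xy: "x \<in> stubs r F S" "y \<in> stubs r F S" "x \<noteq> y" by (auto simp: card_2_iff)
  show ?thesis
  proof (cases "fst x = fst y")
    case True
    then have "snd x \<noteq> snd y" using xy(3) by (simp add: prod_eq_iff)
    then have "deg F (fst x) + 2 \<le> r" using xy True by (auto simp: stubs_def)
    then show ?thesis using xy by (auto simp: stubs_def)
  next
    case False
    then show ?thesis using xy by (fastforce simp: stubs_def)
  qed
qed

text \<open>Extendability says that stubs and cut of any nonempty set add up to at least 2. A
  component has cut 0 and so at least two stubs; a side of a cutedge has cut at most 1 and so at
  least one stub.\<close>

lemma extendable_admissible:
  assumes D: "\<And>i. i \<in> {1..k} \<Longrightarrow> edges_on (edges (D i)) (verts (D i))"
    and fin: "\<And>i. i \<in> {1..k} \<Longrightarrow> finite (verts (D i))"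
    and ext: "\<And>i. i \<in> {1..k} \<Longrightarrow> extendable r (verts (D i)) (edges (D i))"
  shows "admissible r k D"
  unfolding admissible_def degree_eq_deg
proof (intro ballI conjI allI impI)
  fix i assume i: "i \<in> {1..k}"
  let ?F = "edges (D i)"
  note on = D[OF i] and F = edges_onD[OF D[OF i]]
  have stubs: "2 \<le> card (stubs r ?F S) + cut ?F S" if "S \<subseteq> verts (D i)" "S \<noteq> {}" for S
  proof -
    have finS: "finite S" using that fin[OF i] finite_subset by blast
    have le: "deg ?F v \<le> r" if "v \<in> S" for v
      using extendableD(1)[OF ext[OF i]] that \<open>S \<subseteq> verts (D i)\<close> by blast
    show ?thesis
      using card_stubs[OF F(1,3) finS le] extendableD(2)[OF ext[OF i] that] by linarith
  qed
  show "deg ?F v \<le> r" if "v \<in> verts (D i)" for v using extendableD(1)[OF ext[OF i] that] .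
  fix C assume "C \<in> components (D i)"
  then obtain v where v: "v \<in> verts (D i)" "verts C = reach (D i) v"
    "edges C = {e \<in> ?F. fst e \<subseteq> reach (D i) v}" by (rule component_cases)
  have cut_C: "cut ?F (verts C) = 0" unfolding v(2) by (rule cut_reach[OF on])
  have C_sub: "verts C \<subseteq> verts (D i)" unfolding v(2) by (rule reach_subset)
  have "v \<in> verts C" unfolding v(2) by (rule reach_self[OF v(1)])
  then have "2 \<le> card (stubs r ?F (verts C))" using stubs[OF C_sub] cut_C by auto
  then show "(\<exists>v\<in>verts C. deg ?F v + 2 \<le> r) \<or>
      (\<exists>u\<in>verts C. \<exists>v\<in>verts C. u \<noteq> v \<and> deg ?F u + 1 \<le> r \<and> deg ?F v + 1 \<le> r)"
    by (rule unsaturated_if_two_stubs)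
  fix e B assume "cutedge C e" and "B \<in> components (delete_edge C e)"
  then obtain w where w: "w \<in> verts C" "verts B = reach (delete_edge C e) w"
    by (auto elim: component_cases)
  have B_sub: "verts B \<subseteq> verts C" unfolding w(2) using reach_subset[of "delete_edge C e" w] by simp
  have "w \<in> verts B" unfolding w(2) using w(1) by (intro reach_self) simp
  have "edges_on (edges C - {e}) (verts C)" using F unfolding edges_on_def v by auto
  then have "edges_on (edges (delete_edge C e)) (verts (delete_edge C e))" by simp
  from cut_reach[OF this, of w] have "cut (edges C - {e}) (verts B) = 0" unfolding w(2) by simp
  moreover have "finite (edges C - {e})" using F(1) v(3) by simp
  ultimately have B0: "fst f \<inter> verts B = {} \<or> fst f \<subseteq> verts B" if "f \<in> edges C - {e}" for f
    using that cut_eq_0_iff by blast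
  have "fst f \<inter> verts B = {} \<or> fst f \<subseteq> verts B" if f: "f \<in> ?F - {e}" for f
  proof (cases "fst f \<inter> verts C = {}")
    case True then show ?thesis using B_sub by blast
  next
    case False
    then have "fst f \<subseteq> verts C" using cut_C f cut_eq_0_iff[OF F(1)] by blast
    then have "f \<in> edges C - {e}" using f v by simp
    then show ?thesis by (rule B0)
  qed
  then have "cut (?F - {e}) (verts B) = 0" using F(1) by (subst cut_eq_0_iff) auto
  then have "cut ?F (verts B) \<le> 1" using cut_delete[OF F(1), of "verts B" e] by simp
  then have "1 \<le> card (stubs r ?F (verts B))"
    using stubs[of "verts B"] B_sub C_sub \<open>w \<in> verts B\<close> by fastforce
  then have "stubs r ?F (verts B) \<noteq> {}" by (metis card.empty not_one_le_zero)
  then obtain x where "x \<in> stubs r ?F (verts B)" by blast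
  then show "\<exists>v\<in>verts B. deg ?F v + 1 \<le> r" by (intro bexI[of _ "fst x"]) (auto simp: stubs_def)
qed

text \<open>Admissibility speaks of components and sides of cutedges only, but a set
  \<open>S\<close> that violates the bound has cut 0 or 1. In the first case it contains a component
  with two stubs. In the second case the leaving edge is a cutedge of its component, and the side of
  its end in \<open>S\<close> lies inside \<open>S\<close> and has a stub.\<close>

lemma admissible_extendable:
  assumes adm: "admissible r k D" and i: "i \<in> {1..k}"
    and on: "edges_on (edges (D i)) (verts (D i))" and fin: "finite (verts (D i))"
  shows "extendable r (verts (D i)) (edges (D i))"
proof -
  let ?F = "edges (D i)"
  note F = edges_onD[OF on]
  have le: "deg ?F v \<le> r" if "v \<in> verts (D i)" for v
    using adm i that by (auto simp: admissible_def degree_eq_deg)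
  have "2 * inner ?F S + 2 \<le> r * card S" if S: "S \<subseteq> verts (D i)" "S \<noteq> {}" for S
  proof -
    have finS: "finite S" using S fin finite_subset by blast
    have eq: "(\<Sum>v\<in>S. r - deg ?F v) + cut ?F S + 2 * inner ?F S = r * card S"
      using card_stubs[OF F(1,3) finS] le S by (simp add: stubs_def finS subset_iff)
    have "2 \<le> (\<Sum>v\<in>S. r - deg ?F v) + cut ?F S"
    proof (rule ccontr)
      assume neg: "\<not> ?thesis"
      then consider "cut ?F S = 0" | "cut ?F S = 1" by linarith
      then show False
      proof cases
        case 1
        obtain v where v: "v \<in> S" using S by blast
        let ?C = "induced_subgraph (D i) (reach (D i) v)"
        have CS: "verts ?C \<subseteq> S" using reach_in_closed[OF F(1) 1 v] by simp
        have "?C \<in> components (D i)" unfolding components_reach using v S by blast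
        then have "(\<exists>v\<in>verts ?C. deg ?F v + 2 \<le> r) \<or>
            (\<exists>u\<in>verts ?C. \<exists>v\<in>verts ?C. u \<noteq> v \<and> deg ?F u + 1 \<le> r \<and> deg ?F v + 1 \<le> r)"
          using adm i unfolding admissible_def degree_eq_deg by blast
        then have "2 \<le> (\<Sum>v\<in>S. r - deg ?F v)"
        proof
          assume "\<exists>v\<in>verts ?C. deg ?F v + 2 \<le> r"
          then obtain w where w: "w \<in> S" "deg ?F w + 2 \<le> r" using CS by blast
          then have "r - deg ?F w \<le> (\<Sum>v\<in>S. r - deg ?F v)" using finS by (intro member_le_sum) auto
          then show ?thesis using w by linarith
        next
          assume "\<exists>u\<in>verts ?C. \<exists>v\<in>verts ?C. u \<noteq> v \<and> deg ?F u + 1 \<le> r \<and> deg ?F v + 1 \<le> r"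
          then obtain u w where uw: "u \<in> S" "w \<in> S" "u \<noteq> w" "deg ?F u + 1 \<le> r" "deg ?F w + 1 \<le> r"
            using CS by blast
          then have "(\<Sum>v\<in>{u, w}. r - deg ?F v) \<le> (\<Sum>v\<in>S. r - deg ?F v)"
            using finS by (intro sum_mono2) auto
          then show ?thesis using uw by simp
        qed
        then show False using neg by simp
      next
        case 2
        then obtain e where e: "{f \<in> ?F. fst f \<inter> S \<noteq> {} \<and> \<not> fst f \<subseteq> S} = {e}"
          unfolding cut_def using card_1_singletonE by blast
        have eF: "e \<in> ?F" using e by blast
        obtain a where a: "a \<in> fst e" "a \<in> S" using e by blast
        then have aV: "a \<in> verts (D i)" using S by blast
        let ?C = "induced_subgraph (D i) (reach (D i) a)"
        have edges_C: "edges ?C = {f \<in> ?F. fst f \<subseteq> reach (D i) a}" by (simp add: induced_subgraph_def)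
        have C: "?C \<in> components (D i)" unfolding components_reach using aV by blast
        have on_C: "edges_on (edges ?C) (verts ?C)" using F unfolding edges_on_def edges_C by auto
        have closed: "fst f \<inter> reach (D i) a = {} \<or> fst f \<subseteq> reach (D i) a" if "f \<in> ?F" for f
          using cut_reach[OF on, of a] that cut_eq_0_iff[OF F(1)] by blast
        have a_reach: "a \<in> reach (D i) a" using aV by (rule reach_self)
        \<comment> \<open>Needed to recognize \<open>e\<close> as a cutedge of \<open>?C\<close>. A
          subset of \<open>?C\<close> without leaving edges is closed in \<open>D i\<close> as well,
          and so is the rest of \<open>?C\<close>; one of the two contains \<open>a\<close> and
          hence everything reachable from it.\<close>
        have con: "connected_graph ?C"
        proof (rule connected_by_cuts[OF on_C])
          fix T assume T: "T \<subseteq> verts ?C" "T \<noteq> {}" "T \<noteq> verts ?C"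
          then have T': "T \<subseteq> reach (D i) a" "T \<noteq> reach (D i) a" by auto
          show "1 \<le> cut (edges ?C) T"
          proof (rule ccontr)
            assume "\<not> ?thesis"
            then have "cut (edges ?C) T = 0" by simp
            then have "fst f \<inter> T = {} \<or> fst f \<subseteq> T" if "f \<in> edges ?C" for f
              using that cut_eq_0_iff[OF edges_onD(1)[OF on_C]] by blast
            then have "fst f \<inter> T = {} \<or> fst f \<subseteq> T" if "f \<in> ?F" for f
              using that closed[OF that] T' unfolding edges_C by blast
            then have T0: "cut ?F T = 0" using cut_eq_0_iff[OF F(1)] by blast
            have "cut ?F (reach (D i) a - T) = 0"
              using cut_complement[OF F(1) cut_reach[OF on, of a] T'(1)] T0 by simp
            then show False
              using reach_in_closed[OF F(1), of T a] reach_in_closed[OF F(1), of "reach (D i) a - T" a]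
                T0 T' T(2) a_reach by blast
          qed
        qed (use a_reach in auto)
        have "e \<in> edges ?C" using closed[OF eF] a a_reach eF unfolding edges_C by blast
        then have e_C: "{f \<in> edges ?C. fst f \<inter> S \<noteq> {} \<and> \<not> fst f \<subseteq> S} = {e}"
          using e unfolding edges_C by blast
        have fin_C: "finite (verts ?C)"
          using fin reach_subset[of "D i" a] finite_subset by auto
        have cutedge: "cutedge ?C e" by (rule cutedge_if_single_cut[OF on_C fin_C con e_C])
        let ?G = "delete_edge ?C e"
        let ?B = "induced_subgraph ?G (reach ?G a)"
        have "?B \<in> components ?G" unfolding components_reach using a_reach by simp
        then obtain w where w: "w \<in> reach ?G a" "deg ?F w + 1 \<le> r"
          using adm i C cutedge unfolding admissible_def degree_eq_deg by fastforce
        have "{f \<in> edges ?G. fst f \<inter> S \<noteq> {} \<and> \<not> fst f \<subseteq> S} = {}"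
          unfolding edges_delete using e_C by blast
        then have "cut (edges ?G) S = 0" unfolding cut_def by (simp only: card.empty)
        then have "reach ?G a \<subseteq> S" using edges_onD(1)[OF on_C] a by (intro reach_in_closed) auto
        then have "r - deg ?F w \<le> (\<Sum>v\<in>S. r - deg ?F v)"
          using finS w by (intro member_le_sum) auto
        then show False using neg w 2 by linarith
      qed
    qed
    then show ?thesis using eq by linarith
  qed
  then show ?thesis using le by (auto simp: extendable_def)
qed

lemma decomposition_coloring:
  assumes "decomposition k G D"
  obtains c where "\<And>e. e \<in> edges G \<Longrightarrow> c e \<in> {1..k}"
    "\<And>i. i \<in> {1..k} \<Longrightarrow> edges (D i) = color_class (edges G) c i"
    "\<And>i. i \<in> {1..k} \<Longrightarrow> verts (D i) = verts G"
proof -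
  have un: "(\<Union>i\<in>{1..k}. edges (D i)) = edges G"
    and disj: "disjoint_family_on (\<lambda>i. edges (D i)) {1..k}"
    and V: "\<And>i. i \<in> {1..k} \<Longrightarrow> verts (D i) = verts G"
    using assms by (auto simp: decomposition_def spanning_subgraph_def)
  have "\<forall>e\<in>edges G. \<exists>i. i \<in> {1..k} \<and> e \<in> edges (D i)" using un by blast
  then obtain c where c: "\<And>e. e \<in> edges G \<Longrightarrow> c e \<in> {1..k} \<and> e \<in> edges (D (c e))" by metis
  have "edges (D i) = color_class (edges G) c i" if i: "i \<in> {1..k}" for i
  proof (intro equalityI subsetI)
    fix e assume e: "e \<in> edges (D i)"
    then have "e \<in> edges G" using un i by blast
    then have "c e = i" using c[of e] e i disj unfolding disjoint_family_on_def by blast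
    then show "e \<in> color_class (edges G) c i" using \<open>e \<in> edges G\<close> by (simp add: mem_color_class)
  next
    fix e assume "e \<in> color_class (edges G) c i"
    then show "e \<in> edges (D i)" using c[of e] by (simp add: mem_color_class)
  qed
  then show ?thesis using that c V by blast
qed

section \<open>The enclosing theorem\<close>

lemma two_choose_two: "2 * (n choose 2) = n * (n - 1)"
proof -
  have "even (n * (n - 1))" by (cases n) auto
  then show ?thesis by (simp add: choose_two)
qed

lemma real_choose_two: "real (n choose 2) = real n * (real n - 1) / 2"
proof (cases n)
  case (Suc p)
  have "real (2 * (n choose 2)) = real (n * (n - 1))" by (simp only: two_choose_two)
  then show ?thesis using Suc by (simp add: algebra_simps)
qed (simp add: binomial_eq_0)

lemma card_extra_edges:
  assumes "lam \<le> mu"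
  shows "card (edges (complete_mgraph mu n) - edges (complete_mgraph lam n)) = (n choose 2) * (mu - lam)"
proof -
  have "edges (complete_mgraph lam n) \<subseteq> edges (complete_mgraph mu n)"
    using assms by (auto simp: mem_complete_mgraph)
  then show ?thesis
    by (simp add: card_Diff_subset finite_complete card_complete diff_mult_distrib2)
qed

lemma card_extra_edges_off:
  assumes "lam \<le> mu" "u < n" "v < n" "u \<noteq> v"
  shows "card {e \<in> edges (complete_mgraph mu n) - edges (complete_mgraph lam n). fst e \<noteq> {u, v}} +
    (mu - lam) = (n choose 2) * (mu - lam)"
proof -
  let ?X = "edges (complete_mgraph mu n) - edges (complete_mgraph lam n)"
  have "({u, v}, t) \<in> edges (complete_mgraph l n) \<longleftrightarrow> t < l" for t l
    using assms(2-4) by (simp add: mem_complete_mgraph)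
  then have "{e \<in> ?X. fst e = {u, v}} = {{u, v}} \<times> {lam..<mu}"
    by (auto simp del: insert_iff)
  then have "card {e \<in> ?X. fst e = {u, v}} = mu - lam" by (simp add: card_cartesian_product)
  moreover have "card {e \<in> ?X. fst e \<noteq> {u, v}} + card {e \<in> ?X. fst e = {u, v}} =
      card ({e \<in> ?X. fst e \<noteq> {u, v}} \<union> {e \<in> ?X. fst e = {u, v}})"
    using finite_complete[of mu n] by (intro card_Un_disjoint[symmetric]) auto
  moreover have "{e \<in> ?X. fst e \<noteq> {u, v}} \<union> {e \<in> ?X. fst e = {u, v}} = ?X" by blast
  ultimately show ?thesis using card_extra_edges[OF assms(1), of n] by (simp only:)
qed

text \<open>Group the colors by their numbers of edges; colors with more than \<open>r\<close> edges
  contribute 0 by truncated subtraction.\<close>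

lemma sum_deficits:
  "(\<Sum>i=0..r. (real r - real i) * real (card (classes_of_size k G i))) =
    real (\<Sum>c\<in>{1..k}. r - card (edges (G c)))"
proof -
  let ?A = "{c \<in> {1..k}. card (edges (G c)) \<le> r}"
  have "(\<Sum>c\<in>{1..k}. real (r - card (edges (G c)))) = (\<Sum>c\<in>?A. real (r - card (edges (G c))))"
    by (intro sum.mono_neutral_right) auto
  also have "\<dots> = (\<Sum>i\<in>{0..r}. \<Sum>c\<in>{c \<in> ?A. card (edges (G c)) = i}. real (r - card (edges (G c))))"
    by (intro sum.group[symmetric]) auto
  also have "\<dots> = (\<Sum>i\<in>{0..r}. (real r - real i) * real (card (classes_of_size k G i)))"
  proof (rule sum.cong[OF refl])
    fix i assume i: "i \<in> {0..r}"
    then have "{c \<in> ?A. card (edges (G c)) = i} = classes_of_size k G i"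
      by (auto simp: classes_of_size_def)
    moreover have "(\<Sum>c\<in>classes_of_size k G i. real (r - card (edges (G c)))) =
        (\<Sum>c\<in>classes_of_size k G i. real r - real i)"
      using i by (intro sum.cong) (auto simp: classes_of_size_def of_nat_diff)
    ultimately show "(\<Sum>c\<in>{c \<in> ?A. card (edges (G c)) = i}. real (r - card (edges (G c)))) =
        (real r - real i) * real (card (classes_of_size k G i))" by simp
  qed
  finally show ?thesis by simp
qed

text \<open>An edgeless class satisfies the condition on parallel edges vacuously, so the classes of
  size 0 join those of sizes 1 to \<open>r - 1\<close>.\<close>

lemma sum_parallel_classes:
  assumes "\<And>c. c \<in> {1..k} \<Longrightarrow> finite (edges (G c))" "1 \<le> r"
  shows "card (classes_of_size k G 0) + (\<Sum>i=1..r-1. card (classes_between k G i u v)) =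
    card {c \<in> {1..k}. card (edges (G c)) < r \<and> (\<forall>e\<in>edges (G c). fst e = {u, v})}"
proof -
  let ?T = "{c \<in> {1..k}. card (edges (G c)) < r \<and> (\<forall>e\<in>edges (G c). fst e = {u, v})}"
  have "card ?T = (\<Sum>i\<in>insert 0 {1..r-1}. card {c \<in> ?T. card (edges (G c)) = i})"
    by (intro card_fibers) auto
  also have "\<dots> = card {c \<in> ?T. card (edges (G c)) = 0} +
      (\<Sum>i=1..r-1. card {c \<in> ?T. card (edges (G c)) = i})" by simp
  also have "{c \<in> ?T. card (edges (G c)) = 0} = classes_of_size k G 0"
    using assms by (auto simp: classes_of_size_def)
  also have "(\<Sum>i=1..r-1. card {c \<in> ?T. card (edges (G c)) = i}) =
      (\<Sum>i=1..r-1. card (classes_between k G i u v))"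
  proof (rule sum.cong[OF refl])
    fix i assume "i \<in> {1..r-1}"
    then have "{c \<in> ?T. card (edges (G c)) = i} = classes_between k G i u v"
      by (auto simp: classes_between_def)
    then show "card {c \<in> ?T. card (edges (G c)) = i} = card (classes_between k G i u v)" by simp
  qed
  finally show ?thesis by simp
qed

lemma verts_complete [simp]: "verts (complete_mgraph l n) = {..<n}"
  by (simp add: complete_mgraph_def)

text \<open>Both counting conditions rest on \<open>inner_n\<close>: the \<open>n - 2\<close> outer
  vertices absorb at most \<open>r (n - 2)\<close> of the \<open>r n\<close> edge ends in
  \<open>V\<close>, so each color has at least \<open>r\<close> edges inside \<open>V\<close>. Those
  not in \<open>G\<close> are extra edges, and the sets \<open>N i\<close> of different colors are
  disjoint.\<close>

lemma enclosing_necessary: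
  fixes lam mu k r m n :: nat and G H :: "nat \<Rightarrow> nat mgraph"
  defines "X \<equiv> edges (complete_mgraph mu n) - edges (complete_mgraph lam n)"
  assumes n: "3 \<le> n" and m: "m = 2 * n - 2"
    and G: "decomposition k (complete_mgraph lam n) G"
    and H: "two_edge_connected_factorization r k (complete_mgraph mu m) H" and GH: "enclosed k G H"
  shows "r * k = mu * (m - 1)" and "admissible r k G"
    and "(\<Sum>c\<in>{1..k}. r - card (edges (G c))) \<le> card X"
    and "\<And>u v. u < n \<Longrightarrow> v < n \<Longrightarrow> u \<noteq> v \<Longrightarrow>
      card {c \<in> {1..k}. card (edges (G c)) < r \<and> (\<forall>e\<in>edges (G c). fst e = {u, v})}
        \<le> card {e \<in> X. fst e \<noteq> {u, v}}"
proof -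
  have nm: "n < m" "0 < m" using n m by auto
  have decH: "decomposition k (complete_mgraph mu m) H"
    using H by (simp add: two_edge_connected_factorization_def)
  obtain c where c: "\<And>e. e \<in> edges (complete_mgraph lam n) \<Longrightarrow> c e \<in> {1..k}"
    "\<And>i. i \<in> {1..k} \<Longrightarrow> edges (G i) = color_class (edges (complete_mgraph lam n)) c i"
    "\<And>i. i \<in> {1..k} \<Longrightarrow> verts (G i) = {..<n}"
    using decomposition_coloring[OF G] by (metis verts_complete)
  obtain d where d: "\<And>e. e \<in> edges (complete_mgraph mu m) \<Longrightarrow> d e \<in> {1..k}"
    "\<And>i. i \<in> {1..k} \<Longrightarrow> edges (H i) = color_class (edges (complete_mgraph mu m)) d i"
    "\<And>i. i \<in> {1..k} \<Longrightarrow> verts (H i) = {..<m}"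
    using decomposition_coloring[OF decH] by (metis verts_complete)
  have sub: "edges (G i) \<subseteq> edges (H i)" if "i \<in> {1..k}" for i
    using GH that by (simp add: enclosed_def subgraph_def)
  have onH: "edges_on (edges (H i)) {..<m}" if "i \<in> {1..k}" for i
    unfolding d(2)[OF that] by (rule edges_on_subset[OF edges_on_complete color_class_subset])
  have onG: "edges_on (edges (G i)) {..<n}" if "i \<in> {1..k}" for i
    unfolding c(2)[OF that] by (rule edges_on_subset[OF edges_on_complete color_class_subset])
  have reg: "deg (edges (H i)) v = r" if "i \<in> {1..k}" "v < m" for i v
    using H that d(3)[OF that(1)]
    by (auto simp: two_edge_connected_factorization_def regular_def degree_eq_deg)
  have cuts: "2 \<le> cut (edges (H i)) S"
    if "i \<in> {1..k}" "S \<subseteq> {..<m}" "S \<noteq> {}" "S \<noteq> {..<m}" for i S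
    using H that d(3)[OF that(1)] onH[OF that(1)]
    by (intro two_edge_connected_cuts) (auto simp: two_edge_connected_factorization_def)
  have degs: "r * card S = 2 * inner (edges (H i)) S + cut (edges (H i)) S"
    if i: "i \<in> {1..k}" and S: "S \<subseteq> {..<m}" for i S
  proof -
    have "finite S" using S finite_subset by blast
    moreover have "(\<Sum>v\<in>S. deg (edges (H i)) v) = (\<Sum>v\<in>S. r)"
      using reg[OF i] S by (intro sum.cong) auto
    ultimately show ?thesis
      using handshake[OF edges_onD(1,3)[OF onH[OF i]], of S] by (simp add: mult.commute)
  qed
  show "r * k = mu * (m - 1)"
  proof -
    let ?S = "{e \<in> edges (complete_mgraph mu m). 0 \<in> fst e}"
    have "card ?S = (\<Sum>i\<in>{1..k}. card {e \<in> ?S. d e = i})"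
      using d(1) finite_complete by (intro card_fibers) auto
    also have "\<dots> = (\<Sum>i\<in>{1..k}. deg (edges (H i)) 0)"
    proof (rule sum.cong[OF refl])
      fix i assume i: "i \<in> {1..k}"
      have "{e \<in> ?S. d e = i} = {e \<in> edges (H i). 0 \<in> fst e}"
        unfolding d(2)[OF i] by (auto simp: color_class_def)
      then show "card {e \<in> ?S. d e = i} = deg (edges (H i)) 0" by (simp add: deg_def)
    qed
    also have "\<dots> = r * k" using reg nm by simp
    finally show ?thesis using deg_complete[OF nm(2), of mu] by (simp add: deg_def)
  qed
  show "admissible r k G"
  proof (rule extendable_admissible)
    fix i assume i: "i \<in> {1..k}"
    show "edges_on (edges (G i)) (verts (G i))" "finite (verts (G i))"
      using onG[OF i] c(3)[OF i] by auto
    note finH = edges_onD(1)[OF onH[OF i]]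
    show "extendable r (verts (G i)) (edges (G i))"
      unfolding c(3)[OF i] extendable_def
    proof (intro conjI ballI allI impI)
      fix v assume "v \<in> {..<n}"
      then show "deg (edges (G i)) v \<le> r"
        using deg_mono[OF finH sub[OF i], of v] reg[OF i, of v] nm by simp
    next
      fix S assume S: "S \<subseteq> {..<n} \<and> S \<noteq> {}"
      then have S': "S \<subseteq> {..<m}" "S \<noteq> {..<m}" using nm by auto
      then have "2 \<le> cut (edges (H i)) S" using S by (intro cuts[OF i]) auto
      then show "2 * inner (edges (G i)) S + 2 \<le> r * card S"
        using degs[OF i S'(1)] inner_mono[OF finH sub[OF i] subset_refl, of S] by linarith
    qed
  qed
  define N where "N i = {e \<in> edges (H i). fst e \<subseteq> {..<n}} - edges (G i)" for i
  have inner_n: "r \<le> inner (edges (H i)) {..<n}" if i: "i \<in> {1..k}" for i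
  proof -
    let ?F = "edges (H i)" and ?W = "{..<m} - {..<n}"
    have "cut ?F {..<n} = cut ?F ?W"
      using edges_onD(1)[OF onH[OF i]] edges_on_whole(1)[OF onH[OF i]] nm
      by (intro cut_complement[symmetric]) auto
    also have "\<dots> \<le> r * card ?W" using degs[OF i Diff_subset, of "{..<n}"] by linarith
    also have "card ?W = n - 2" using nm m by (simp add: card_Diff_subset)
    finally have "r * n \<le> 2 * inner ?F {..<n} + r * (n - 2)" using degs[OF i, of "{..<n}"] nm by simp
    moreover have "r * n = r * (n - 2) + 2 * r"
    proof -
      have "n = (n - 2) + 2" using n by simp
      then show ?thesis by (metis distrib_left mult.commute)
    qed
    ultimately show ?thesis by linarith
  qed
  have G_sub: "edges (G i) \<subseteq> {e \<in> edges (H i). fst e \<subseteq> {..<n}}" if "i \<in> {1..k}" for i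
    using sub[OF that] edges_onD(2)[OF onG[OF that]] by blast
  have card_N: "r - card (edges (G i)) \<le> card (N i)" if i: "i \<in> {1..k}" for i
    unfolding N_def
    using card_Diff_subset[OF edges_onD(1)[OF onG[OF i]] G_sub[OF i]] inner_n[OF i]
    by (simp add: inner_def)
  have N_X: "N i \<subseteq> X" if i: "i \<in> {1..k}" for i
  proof
    fix e assume e: "e \<in> N i"
    then have eH: "e \<in> edges (complete_mgraph mu m)" "d e = i"
      unfolding N_def d(2)[OF i] by (auto simp: mem_color_class)
    moreover have "fst e \<subseteq> {..<n}" using e by (simp add: N_def)
    ultimately have "e \<in> edges (complete_mgraph mu n)" by (simp add: mem_complete_mgraph)
    moreover have "e \<notin> edges (complete_mgraph lam n)"
    proof
      assume e0: "e \<in> edges (complete_mgraph lam n)"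
      then have "e \<in> edges (G (c e))" using c(1,2) by (simp add: mem_color_class)
      then have "e \<in> edges (H (c e))" using sub[OF c(1)[OF e0]] by blast
      then have "c e = i" using d(2)[OF c(1)[OF e0]] eH by (simp add: mem_color_class)
      then show False using \<open>e \<in> edges (G (c e))\<close> e by (simp add: N_def)
    qed
    ultimately show "e \<in> X" by (simp add: X_def)
  qed
  have N_disj: "N i \<inter> N j = {}" if "i \<in> {1..k}" "j \<in> {1..k}" "i \<noteq> j" for i j
    using that d(2) by (auto simp: N_def mem_color_class)
  have finX: "finite X" unfolding X_def using finite_complete by blast
  have "(\<Sum>i\<in>{1..k}. r - card (edges (G i))) \<le> (\<Sum>i\<in>{1..k}. card (N i))"
    using card_N by (rule sum_mono)
  also have "\<dots> \<le> card X" using finX N_X N_disj by (intro disjoint_sum_le) auto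
  finally show "(\<Sum>c\<in>{1..k}. r - card (edges (G c))) \<le> card X" .
  fix u v assume uv: "u < n" "v < n" "u \<noteq> v"
  let ?T = "{c \<in> {1..k}. card (edges (G c)) < r \<and> (\<forall>e\<in>edges (G c). fst e = {u, v})}"
  \<comment> \<open>Otherwise at least \<open>r\<close> edges of color \<open>i\<close> join
    \<open>u\<close> and \<open>v\<close>; they use up the whole degree sum \<open>2 r\<close> of
    the pair and leave nothing for its cut.\<close>
  have "1 \<le> card {e \<in> N i. fst e \<noteq> {u, v}}" if i: "i \<in> ?T" for i
  proof -
    have ik: "i \<in> {1..k}" using i by blast
    note F = edges_onD[OF onH[OF ik]]
    have "{e \<in> N i. fst e \<noteq> {u, v}} \<noteq> {}"
    proof
      assume empty: "{e \<in> N i. fst e \<noteq> {u, v}} = {}"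
      have "{e \<in> edges (H i). fst e \<subseteq> {..<n}} \<subseteq> {e \<in> edges (H i). fst e \<subseteq> {u, v}}"
      proof
        fix e assume e: "e \<in> {e \<in> edges (H i). fst e \<subseteq> {..<n}}"
        have "fst e = {u, v}"
        proof (cases "e \<in> edges (G i)")
          case True then show ?thesis using i by blast
        next
          case False
          then have "e \<in> N i" using e by (simp add: N_def)
          then show ?thesis using empty by blast
        qed
        then show "e \<in> {e \<in> edges (H i). fst e \<subseteq> {u, v}}" using e by simp
      qed
      then have "inner (edges (H i)) {..<n} \<le> inner (edges (H i)) {u, v}"
        unfolding inner_def using F(1) by (intro card_mono) auto
      then have "r \<le> inner (edges (H i)) {u, v}" using inner_n[OF ik] by simp
      \<comment> \<open>The cut bound holds for proper subsets only. It applies because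
        \<open>n \<ge> 3\<close> gives \<open>m \<ge> 4\<close>; for \<open>n = 2\<close> the pair
        would be the whole graph.\<close>
      moreover have "{u, v} \<noteq> {..<m}"
      proof
        assume "{u, v} = {..<m}"
        then have "card {u, v} = m" by (simp only: card_lessThan)
        then show False using uv(3) n m by simp
      qed
      then have "2 \<le> cut (edges (H i)) {u, v}" using uv nm by (intro cuts[OF ik]) auto
      ultimately show False using degs[OF ik, of "{u, v}"] uv nm by simp
    qed
    moreover have "finite (N i)" using N_X[OF ik] finX finite_subset by blast
    ultimately show ?thesis by (simp add: Suc_le_eq card_gt_0_iff)
  qed
  then have "(\<Sum>i\<in>?T. 1) \<le> (\<Sum>i\<in>?T. card {e \<in> N i. fst e \<noteq> {u, v}})" by (rule sum_mono)
  also have "\<dots> \<le> card {e \<in> X. fst e \<noteq> {u, v}}"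
  proof (rule disjoint_sum_le)
    show "{e \<in> N i. fst e \<noteq> {u, v}} \<subseteq> {e \<in> X. fst e \<noteq> {u, v}}" if "i \<in> ?T" for i
      using N_X that by blast
    show "{e \<in> N i. fst e \<noteq> {u, v}} \<inter> {e \<in> N j. fst e \<noteq> {u, v}} = {}"
      if "i \<in> ?T" "j \<in> ?T" "i \<noteq> j" for i j
      using N_disj[of i j] that by blast
  qed (use finX in auto)
  finally show "card ?T \<le> card {e \<in> X. fst e \<noteq> {u, v}}" by simp
qed

lemma enclosing_sufficient:
  fixes lam mu k r m n :: nat and G :: "nat \<Rightarrow> nat mgraph"
  defines "X \<equiv> edges (complete_mgraph mu n) - edges (complete_mgraph lam n)"
  assumes par: "0 < lam" "lam < mu" "mu \<le> 2 * (r - 1)" "2 \<le> r" and n: "3 \<le> n" and m: "m = 2 * n - 2"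
    and G: "decomposition k (complete_mgraph lam n) G"
    and rk: "r * k = mu * (m - 1)" and adm: "admissible r k G"
    and few: "(\<Sum>c\<in>{1..k}. r - card (edges (G c))) \<le> card X"
    and parallel: "\<And>u v. u < n \<Longrightarrow> v < n \<Longrightarrow> u \<noteq> v \<Longrightarrow>
      card {c \<in> {1..k}. card (edges (G c)) < r \<and> (\<forall>e\<in>edges (G c). fst e = {u, v})}
        \<le> card {e \<in> X. fst e \<noteq> {u, v}}"
  shows "\<exists>H. two_edge_connected_factorization r k (complete_mgraph mu m) H \<and> enclosed k G H"
proof -
  have m1: "m - 1 = 2 * n - 3" "m - 1 = 2 * (n - 1) - 1" "m = 2 * (n - 1)" using m n by auto
  interpret enclosing_params lam mu k r n
    using par n rk m1(1) by unfold_locales auto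
  interpret D: detach_params mu k r "n - 1"
    using par n rk m1(2) by unfold_locales auto
  obtain c where c: "\<And>e. e \<in> E\<^sub>0 \<Longrightarrow> c e \<in> {1..k}"
    "\<And>i. i \<in> {1..k} \<Longrightarrow> edges (G i) = color_class E\<^sub>0 c i"
    "\<And>i. i \<in> {1..k} \<Longrightarrow> verts (G i) = {..<n}"
    using decomposition_coloring[OF G] by (metis verts_complete)
  have onG: "edges_on (edges (G i)) {..<n}" if "i \<in> {1..k}" for i
    unfolding c(2)[OF that] by (rule edges_on_subset[OF edges_on_complete color_class_subset])
  have "\<exists>c'. valid c' \<and> (\<forall>e\<in>E\<^sub>0. c' e = c e)"
  proof (rule fill_colors[OF c(1)])
    fix i assume i: "i \<in> {1..k}"
    show "extendable r {..<n} (color_class E\<^sub>0 c i)"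
      using admissible_extendable[OF adm i] c(2,3)[OF i] onG[OF i] by simp
  next
    show "(\<Sum>i\<in>{1..k}. r - card (color_class E\<^sub>0 c i)) \<le> card (E - E\<^sub>0)"
      using few c(2) by (simp add: X_def)
  next
    fix u v assume uv: "u < n" "v < n" "u \<noteq> v"
    have "{i \<in> {1..k}. card (color_class E\<^sub>0 c i) < r \<and> (\<forall>e\<in>color_class E\<^sub>0 c i. fst e = {u, v})} =
        {i \<in> {1..k}. card (edges (G i)) < r \<and> (\<forall>e\<in>edges (G i). fst e = {u, v})}"
      using c(2) by auto
    then show "card {i \<in> {1..k}. card (color_class E\<^sub>0 c i) < r \<and>
        (\<forall>e\<in>color_class E\<^sub>0 c i. fst e = {u, v})} \<le> card {e \<in> E - E\<^sub>0. fst e \<noteq> {u, v}}"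
      using parallel[OF uv] by (simp add: X_def)
  qed
  then obtain c1 where c1: "valid c1" "\<forall>e\<in>E\<^sub>0. c1 e = c e" by blast
  have "c1 e \<noteq> 0" if "e \<in> E" "snd e < lam" for e
    using c1(2) c(1)[of e] that by (auto simp: E0_iff)
  then obtain c2 where c2: "valid c2" "\<forall>e\<in>E. snd e < lam \<longrightarrow> c2 e = c1 e" "\<forall>e\<in>E. c2 e \<noteq> 0"
    using color_all[OF c1(1)] by blast
  have "D.outline n c2" unfolding D.outline_def
  proof (intro conjI ballI)
    fix e assume "e \<in> E"
    then show "c2 e \<in> {1..k}" using c2(1,3) by (auto simp: valid_def Suc_le_eq)
  next
    fix i assume i: "i \<in> {1..k}"
    show "extendable r {..<n} (color_class E c2 i)" using c2(1) i by (simp add: valid_def)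
    \<comment> \<open>For \<open>p = n\<close> and \<open>h = n - 1\<close> the loop condition of
      \<open>outline\<close> is exactly the lower bound \<open>r\<close> contained in
      \<open>valid\<close>.\<close>
    have "r \<le> card (color_class E c2 i)" using c2(1) i by (simp add: valid_def)
    moreover obtain p where "n = Suc p" using n by (cases n) auto
    ultimately show "r * n \<le> card (color_class E c2 i) + r * (n - 1)" by simp
  qed
  moreover have "n + 1 \<le> 2 * (n - 1)" using n by simp
  ultimately obtain c3 where c3: "\<forall>e\<in>D.K m. c3 e \<in> {1..k}" "\<forall>e\<in>E. c3 e = c2 e"
    "\<forall>i\<in>{1..k}. (\<forall>v<m. deg (D.F m c3 i) v = r) \<and>
      (\<forall>S. S \<subseteq> {..<m} \<and> S \<noteq> {} \<and> S \<noteq> {..<m} \<longrightarrow> 2 \<le> cut (D.F m c3 i) S)"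
    using D.outline_extends[of n c2] unfolding m1(3)[symmetric] by (elim meta_impE exE conjE)
  define H where "H i = \<lparr>verts = {..<m}, edges = D.F m c3 i\<rparr>" for i
  have H: "verts (H i) = {..<m}" "edges (H i) = D.F m c3 i" for i by (simp_all add: H_def)
  have "decomposition k (complete_mgraph mu m) H"
    unfolding decomposition_def spanning_subgraph_def subgraph_def disjoint_family_on_def H
    using c3(1) by (auto simp: color_class_def)
  moreover have "regular r (H i)" if "i \<in> {1..k}" for i
    using c3(3) that by (simp add: regular_def degree_eq_deg H)
  moreover have "two_edge_connected (H i)" if i: "i \<in> {1..k}" for i
  proof (rule two_edge_connected_by_cuts)
    show "edges_on (edges (H i)) (verts (H i))" unfolding H by (rule D.on)
    show "verts (H i) \<noteq> {}" unfolding H using m n by (simp add: lessThan_empty_iff)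
    show "2 \<le> cut (edges (H i)) S" if "S \<subseteq> verts (H i)" "S \<noteq> {}" "S \<noteq> verts (H i)" for S
      using c3(3) i that unfolding H by blast
  qed
  ultimately have "two_edge_connected_factorization r k (complete_mgraph mu m) H"
    by (simp add: two_edge_connected_factorization_def)
  moreover have "enclosed k G H" unfolding enclosed_def subgraph_def
  proof (intro ballI conjI)
    fix i assume i: "i \<in> {1..k}"
    have "n \<le> m" using m n by simp
    then show "verts (G i) \<subseteq> verts (H i)" unfolding c(3)[OF i] H by simp
    show "edges (G i) \<subseteq> edges (H i)"
    proof
      fix e assume "e \<in> edges (G i)"
      then have e: "e \<in> E\<^sub>0" "c e = i" unfolding c(2)[OF i] by (auto simp: mem_color_class)
      then have eE: "e \<in> E" "snd e < lam" by (auto simp: E0_iff)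
      then have "c3 e = i" using c3(2) c2(2) c1(2) e by simp
      moreover have "{..<n} \<subseteq> {..<m}" using \<open>n \<le> m\<close> by simp
      then have "e \<in> D.K m"
        using eE(1) unfolding mem_complete_mgraph by (meson order_trans)
      ultimately show "e \<in> edges (H i)" unfolding H by (simp add: mem_color_class)
    qed
  qed
  ultimately show ?thesis by blast
qed

theorem theorem1p3:
  fixes lam mu k r m n :: nat
    and G :: "nat \<Rightarrow> nat mgraph"
  assumes "0 < lam" and "0 < mu" and "0 < k" and "0 < r" and "0 < m" and "0 < n"
    and "n \<le> m"
    and "mu \<le> 2 * (r - 1)" and "lam < mu"
    and "m = 2 * n - 2"
    and "2 \<le> r"
    and "n \<noteq> 2"
    and "decomposition k (complete_mgraph lam n) G"
  shows "(\<exists>H. two_edge_connected_factorization r k (complete_mgraph mu m) H \<and> enclosed k G H) \<longleftrightarrow>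
    (r * k = mu * (m - 1) \<and> even (r * m)) \<and>
    admissible r k G \<and>
    (\<Sum>i=0..r. (real r - real i) * real (card (classes_of_size k G i)))
      \<le> (real mu - real lam) * (real n * (real n - 1) / 2) \<and>
    (\<forall>u \<in> {..<n}. \<forall>v \<in> {..<n}.
       real (card (classes_of_size k G 0))
         + (\<Sum>i=1..r-1. real (card (classes_between k G i u v)))
       \<le> (real mu - real lam) * (real n * (real n - 1) / 2 - 1))"
proof -
  have n: "3 \<le> n" using assms(5,10,12) by linarith
  have even: "even (r * m)" using assms(10) by simp
  let ?X = "edges (complete_mgraph mu n) - edges (complete_mgraph lam n)"
  let ?T = "\<lambda>u v. {c \<in> {1..k}. card (edges (G c)) < r \<and> (\<forall>e\<in>edges (G c). fst e = {u, v})}"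
  have G_sub: "edges (G c) \<subseteq> edges (complete_mgraph lam n)" if "c \<in> {1..k}" for c
    using assms(13) that by (auto simp: decomposition_def)
  have finG: "finite (edges (G c))" if "c \<in> {1..k}" for c
    using G_sub[OF that] finite_complete by (rule finite_subset)
  have lm: "real (mu - lam) = real mu - real lam" using assms(9) by (simp add: of_nat_diff)
  have C3: "(\<Sum>i=0..r. (real r - real i) * real (card (classes_of_size k G i)))
      \<le> (real mu - real lam) * (real n * (real n - 1) / 2) \<longleftrightarrow>
      (\<Sum>c\<in>{1..k}. r - card (edges (G c))) \<le> card ?X"
  proof -
    have "(real mu - real lam) * (real n * (real n - 1) / 2) = real (card ?X)"
      using card_extra_edges[of lam mu n] assms(9) lm
      by (simp add: real_choose_two[symmetric] mult.commute)
    then show ?thesis unfolding sum_deficits by (simp only: of_nat_le_iff)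
  qed
  \<comment> \<open>The right side of (C4) counts the extra edges that do not join \<open>u\<close>
    and \<open>v\<close>, that is, those that can break up a class consisting of edges between
    \<open>u\<close> and \<open>v\<close>.\<close>
  have off: "real (card {e \<in> ?X. fst e \<noteq> {u, v}}) =
      (real mu - real lam) * (real n * (real n - 1) / 2 - 1)" if "u < n" "v < n" "u \<noteq> v" for u v
  proof -
    have "real (card {e \<in> ?X. fst e \<noteq> {u, v}} + (mu - lam)) = real ((n choose 2) * (mu - lam))"
      using card_extra_edges_off[OF _ that, of lam mu] assms(9) by (simp only:)
    then have "real (card {e \<in> ?X. fst e \<noteq> {u, v}}) + (real mu - real lam) =
        real n * (real n - 1) / 2 * (real mu - real lam)"
      by (simp only: of_nat_add of_nat_mult lm real_choose_two)
    then show ?thesis by (simp only: right_diff_distrib mult.commute)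
  qed
  have T: "real (card (classes_of_size k G 0)) + (\<Sum>i=1..r-1. real (card (classes_between k G i u v))) =
      real (card (?T u v))" for u v
    using sum_parallel_classes[of k G r u v] finG assms(4) by (simp flip: of_nat_sum of_nat_add)
  have C4: "(\<forall>u \<in> {..<n}. \<forall>v \<in> {..<n}.
       real (card (classes_of_size k G 0)) + (\<Sum>i=1..r-1. real (card (classes_between k G i u v)))
       \<le> (real mu - real lam) * (real n * (real n - 1) / 2 - 1)) \<longleftrightarrow>
      (\<forall>u v. u < n \<longrightarrow> v < n \<longrightarrow> u \<noteq> v \<longrightarrow> card (?T u v) \<le> card {e \<in> ?X. fst e \<noteq> {u, v}})"
    (is "?L \<longleftrightarrow> ?R")
  proof
    assume ?L
    show ?R
    proof (intro allI impI)
      fix u v assume uv: "u < n" "v < n" "u \<noteq> v"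
      then have "real (card (?T u v)) \<le> real (card {e \<in> ?X. fst e \<noteq> {u, v}})"
        using \<open>?L\<close> unfolding T off[OF uv] by blast
      then show "card (?T u v) \<le> card {e \<in> ?X. fst e \<noteq> {u, v}}" by simp
    qed
  next
    assume R: ?R
    show ?L unfolding T
    proof (intro ballI)
      fix u v assume uv: "u \<in> {..<n}" "v \<in> {..<n}"
      \<comment> \<open>(C4) also allows \<open>u = v\<close>. Then only edgeless classes are
        counted, as no edge has a single end, and the bound follows from the one for
        \<open>u\<close> and any other vertex \<open>w\<close>.\<close>
      define w where "w = (if u = v then (if u = 0 then 1 else 0) else v)"
      have w: "u < n" "w < n" "u \<noteq> w" using uv n by (auto simp: w_def)
      have "?T u v \<subseteq> ?T u w"
      proof (cases "u = v")
        case True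
        have "edges (G c) = {}" if "c \<in> ?T u v" for c
        proof (rule equals0I)
          fix e assume e: "e \<in> edges (G c)"
          then have "fst e = {u}" using that True by auto
          moreover have "e \<in> edges (complete_mgraph lam n)" using e that G_sub by blast
          ultimately show False by (simp add: mem_complete_mgraph)
        qed
        then show ?thesis by blast
      qed (simp add: w_def)
      then have "card (?T u v) \<le> card (?T u w)" by (intro card_mono) auto
      also have "\<dots> \<le> card {e \<in> ?X. fst e \<noteq> {u, w}}" using R w by blast
      finally show "real (card (?T u v)) \<le> (real mu - real lam) * (real n * (real n - 1) / 2 - 1)"
        unfolding off[OF w, symmetric] by simp
    qed
  qed
  show ?thesis unfolding C3 C4
  proof (intro iffI)
    assume "\<exists>H. two_edge_connected_factorization r k (complete_mgraph mu m) H \<and> enclosed k G H"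
    then obtain H where "two_edge_connected_factorization r k (complete_mgraph mu m) H" "enclosed k G H"
      by blast
    from enclosing_necessary[OF n assms(10,13) this] even
    show "(r * k = mu * (m - 1) \<and> even (r * m)) \<and> admissible r k G \<and>
      (\<Sum>c\<in>{1..k}. r - card (edges (G c))) \<le> card ?X \<and>
      (\<forall>u v. u < n \<longrightarrow> v < n \<longrightarrow> u \<noteq> v \<longrightarrow> card (?T u v) \<le> card {e \<in> ?X. fst e \<noteq> {u, v}})"
      by blast
  next
    assume "(r * k = mu * (m - 1) \<and> even (r * m)) \<and> admissible r k G \<and>
      (\<Sum>c\<in>{1..k}. r - card (edges (G c))) \<le> card ?X \<and>
      (\<forall>u v. u < n \<longrightarrow> v < n \<longrightarrow> u \<noteq> v \<longrightarrow> card (?T u v) \<le> card {e \<in> ?X. fst e \<noteq> {u, v}})"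
    then show "\<exists>H. two_edge_connected_factorization r k (complete_mgraph mu m) H \<and> enclosed k G H"
      using assms n by (intro enclosing_sufficient) auto
  qed
qed

end
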